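(* Let $(\Omega,P)$ be a probability space, let $X_1,X_2,\dots$ be independent random variables distributed according to $P$, and let $F\subset L_2(P)$ be a class of functions. Let $G=\{G_f:f\in F\}$ be the centered Gaussian process indexed by $F$ with covariance structure endowed by $L_2(P)$, and assume that $\mathbb{E}\|G\|_F<\infty$. Let $\Phi_n$ be the modification map defined in the context, built from an almost optimal admissible sequence $(F_s)_{s\ge0}$ of $F$ with the properties (A) and (B) of the context. If the Gaussian process $G$ indexed by $F$ is continuous, then $$\{\sqrt{n}\,(P_n(\Phi_n(f))-Pf):f\in F\}$$ converges (weakly in $\ell_\infty(F)$, as $n\to\infty$) to $\{G_f:f\in F\}$.
   Context: Notation: $Pf=\mathbb{E}f=\int f\,dP$, $P_n h=\frac1n\sum_{i=1}^n h(X_i)$, $\|\cdot\|_2=\|\cdot\|_{L_2(P)}$, $\mathbb{E}\|G\|_F=\mathbb{E}\sup_{f\in F}|G_f|$. "Covariance structure endowed by $L_2(P)$" means $\mathbb{E}G_fG_g=\int fg\,dP$. Continuity of $G$ means that $f\mapsto G_f$ is uniformly continuous on $(F,\|\cdot\|_2)$ with probability one. Admissible sequence: a sequence $(F_s)_{s\ge0}$ of nonempty subsets of $F$ with $|F_0|=1$ and $|F_s|\le 2^{2^s}$ for $s\ge1$. For each $s$, $\pi_s:F\to F_s$ maps $f$ to a nearest element of $F_s$ in $\|\cdot\|_2$. Let $\gamma_2(F,L_2(P))=\inf\sup_{f\in F}\sum_{s=0}^\infty 2^{s/2}d(f,F_s)$, where $d(f,F_s)=\inf_{g\in F_s}\|f-g\|_2$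 and the infimum is over all admissible sequences of $F$. The almost optimal admissible sequence $(F_s)$ fixed for $F$ satisfies, with an absolute constant $K$: (A) $\sup_{f\in F}\sum_{s=0}^\infty 2^{s/2}\|f-\pi_s(f)\|_2\le K\gamma_2(F,L_2(P))$; (B) $\lim_{s_0\to\infty}\sup_{f\in F}\sum_{s\ge s_0}2^{s/2}\|f-\pi_s(f)\|_2=0$. For $s\ge1$ put $\Delta_s(f)=\pi_s(f)-\pi_{s-1}(f)$ and, for $\lambda\ge0$, $\Delta'_s(f,\lambda)=\Delta_s(f)\mathbb{1}_{\{|\Delta_s(f)|\le\lambda\}}$. The truncation level is $\lambda=\lambda(f,n,s)=c_0\sqrt n\,\|\Delta_s(f)\|_2/2^{s/2}$, where $c_0>0$ is a fixed absolute constant, chosen so that for some absolute constants $a,b>0$: for every class of functions in $L_2$ of a probability space, every admissible sequence, every $n$, every $u>1/2$ and every integer $s\ge1$, with probability at least $1-2\exp(-a2^s\min\{u^2,u\})$, for all $f$ in the class, $\left|\frac1n\sum_{i=1}^n\Delta'_s(f,\lambda)(X_i)-\mathbb{E}\Delta'_s(f,\lambda)\right|\le b\,u\,2^{s/2}\|\Delta_s(f)\|_2/\sqrt n$. The modification map is $\Phi_n(f)=\sum_{s=1}^\infty\Delta'_s(f,\lambda)$. Weak convergence in $\ell_\infty(F)$ is in the sense of outer expectations, the limit being a tight Borel measurable map into $\ell_\infty(F)$.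
   Formalization: It is also assumed that Pf=0 for all f in F and that π_0(f)=0 almost everywhere; without these the claim fails (F={f} with Pf=0, Pf²>0 gives Φ_n(f)=0), and the stated convergence itself forces both. *)

theory Defs
  imports "HOL-Probability.Probability"
begin

subsection \<open>Functions in $L_2(P)$\<close>

text \<open>Elements of $L_2(P)$ are genuine functions, not classes modulo null sets, so
  \<^term>\<open>l2norm\<close> below is a seminorm.\<close>

definition L2 :: "'a measure \<Rightarrow> ('a \<Rightarrow> real) set" where
  "L2 P = {f \<in> borel_measurable P. integrable P (\<lambda>x. (f x)\<^sup>2)}"

definition l2norm :: "'a measure \<Rightarrow> ('a \<Rightarrow> real) \<Rightarrow> real" where
  "l2norm P f = sqrt (\<integral>x. (f x)\<^sup>2 \<partial>P)"

definition l2dist :: "'a measure \<Rightarrow> ('a \<Rightarrow> real) \<Rightarrow> ('a \<Rightarrow> real) \<Rightarrow> real" where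
  "l2dist P f g = l2norm P (\<lambda>x. f x - g x)"

subsection \<open>Admissible sequences and the $\gamma_2$ functional\<close>

definition admissible :: "'b set \<Rightarrow> (nat \<Rightarrow> 'b set) \<Rightarrow> bool" where
  "admissible F Fs \<longleftrightarrow>
     (\<forall>s. Fs s \<noteq> {} \<and> Fs s \<subseteq> F \<and> finite (Fs s)) \<and>
     card (Fs 0) = 1 \<and> (\<forall>s\<ge>1. card (Fs s) \<le> 2 ^ (2 ^ s))"

definition nearest_maps ::
  "'a measure \<Rightarrow> ('a \<Rightarrow> real) set \<Rightarrow> (nat \<Rightarrow> ('a \<Rightarrow> real) set) \<Rightarrow>
   (nat \<Rightarrow> ('a \<Rightarrow> real) \<Rightarrow> ('a \<Rightarrow> real)) \<Rightarrow> bool" where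
  "nearest_maps P F Fs \<pi> \<longleftrightarrow>
     (\<forall>s. \<forall>f\<in>F. \<pi> s f \<in> Fs s \<and> (\<forall>g\<in>Fs s. l2dist P f (\<pi> s f) \<le> l2dist P f g))"

definition gamma2 :: "'a measure \<Rightarrow> ('a \<Rightarrow> real) set \<Rightarrow> ennreal" where
  "gamma2 P F =
     (INF Fs\<in>{Fs. admissible F Fs}. SUP f\<in>F.
        \<Sum>s. ennreal (2 powr (real s / 2) * (INF g\<in>Fs s. l2dist P f g)))"

definition almost_optimal ::
  "real \<Rightarrow> 'a measure \<Rightarrow> ('a \<Rightarrow> real) set \<Rightarrow> (nat \<Rightarrow> ('a \<Rightarrow> real) \<Rightarrow> ('a \<Rightarrow> real)) \<Rightarrow> bool" where
  "almost_optimal K P F \<pi> \<longleftrightarrow>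
     (SUP f\<in>F. \<Sum>s. ennreal (2 powr (real s / 2) * l2dist P f (\<pi> s f))) \<le> ennreal K * gamma2 P F \<and>
     (\<lambda>s0. SUP f\<in>F. \<Sum>s. ennreal (2 powr (real (s + s0) / 2) * l2dist P f (\<pi> (s + s0) f)))
       \<longlonglongrightarrow> 0"

subsection \<open>Truncated increments and the modification map\<close>

definition incr ::
  "(nat \<Rightarrow> ('a \<Rightarrow> real) \<Rightarrow> ('a \<Rightarrow> real)) \<Rightarrow> nat \<Rightarrow> ('a \<Rightarrow> real) \<Rightarrow> ('a \<Rightarrow> real)" where
  "incr \<pi> s f = (\<lambda>x. \<pi> s f x - \<pi> (s - 1) f x)"

definition trunc :: "real \<Rightarrow> ('a \<Rightarrow> real) \<Rightarrow> ('a \<Rightarrow> real)" where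
  "trunc l h = (\<lambda>x. if \<bar>h x\<bar> \<le> l then h x else 0)"

definition trunc_level ::
  "real \<Rightarrow> 'a measure \<Rightarrow> (nat \<Rightarrow> ('a \<Rightarrow> real) \<Rightarrow> ('a \<Rightarrow> real)) \<Rightarrow>
   ('a \<Rightarrow> real) \<Rightarrow> nat \<Rightarrow> nat \<Rightarrow> real" where
  "trunc_level c0 P \<pi> f n s = c0 * sqrt (real n) * l2norm P (incr \<pi> s f) / 2 powr (real s / 2)"

definition trunc_incr ::
  "real \<Rightarrow> 'a measure \<Rightarrow> (nat \<Rightarrow> ('a \<Rightarrow> real) \<Rightarrow> ('a \<Rightarrow> real)) \<Rightarrow>
   nat \<Rightarrow> nat \<Rightarrow> ('a \<Rightarrow> real) \<Rightarrow> ('a \<Rightarrow> real)" where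
  "trunc_incr c0 P \<pi> n s f = trunc (trunc_level c0 P \<pi> f n s) (incr \<pi> s f)"

text \<open>The sum over $s \ge 1$ is pointwise; \<open>trunc_level\<close> makes it absolutely convergent for an almost optimal sequence.\<close>

definition modification ::
  "real \<Rightarrow> 'a measure \<Rightarrow> (nat \<Rightarrow> ('a \<Rightarrow> real) \<Rightarrow> ('a \<Rightarrow> real)) \<Rightarrow>
   nat \<Rightarrow> ('a \<Rightarrow> real) \<Rightarrow> ('a \<Rightarrow> real)" where
  "modification c0 P \<pi> n f = (\<lambda>x. \<Sum>s. trunc_incr c0 P \<pi> n (Suc s) f x)"

definition emp_mean :: "nat \<Rightarrow> (nat \<Rightarrow> 'a) \<Rightarrow> ('a \<Rightarrow> real) \<Rightarrow> real" where
  "emp_mean n x h = (\<Sum>i<n. h (x i)) / real n"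

text \<open>The requirement on the truncation constant $c_0$. HOL cannot quantify over types, so the
  probability spaces range over all probability measures on one type; this only weakens what is
  required of $c_0$.\<close>

definition truncation_constant :: "'a itself \<Rightarrow> real \<Rightarrow> bool" where
  "truncation_constant _ c0 \<longleftrightarrow> c0 > 0 \<and>
     (\<exists>a>0. \<exists>b>0. \<forall>(Q :: 'a measure) F Fs \<pi> (n::nat) (u::real) (s::nat).
        prob_space Q \<longrightarrow> F \<subseteq> L2 Q \<longrightarrow> admissible F Fs \<longrightarrow> nearest_maps Q F Fs \<pi> \<longrightarrow>
        n \<ge> 1 \<longrightarrow> u > 1/2 \<longrightarrow> s \<ge> 1 \<longrightarrow>
        measure (Pi\<^sub>M {..<n} (\<lambda>_. Q))
          {x \<in> space (Pi\<^sub>M {..<n} (\<lambda>_. Q)). \<forall>f\<in>F.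
             \<bar>emp_mean n x (trunc_incr c0 Q \<pi> n s f) - (\<integral>y. trunc_incr c0 Q \<pi> n s f y \<partial>Q)\<bar>
               \<le> b * u * 2 powr (real s / 2) * l2norm Q (incr \<pi> s f) / sqrt (real n)}
        \<ge> 1 - 2 * exp (- a * 2 ^ s * min (u\<^sup>2) u))"

subsection \<open>Gaussian processes\<close>

definition gaussian_law :: "real \<Rightarrow> real \<Rightarrow> real measure" where
  "gaussian_law m \<sigma> =
     (if \<sigma> = 0 then return borel m else density lborel (\<lambda>x. ennreal (normal_density m \<sigma> x)))"

definition centered_gaussian_process ::
  "'c measure \<Rightarrow> 't set \<Rightarrow> ('t \<Rightarrow> 't \<Rightarrow> real) \<Rightarrow> ('t \<Rightarrow> 'c \<Rightarrow> real) \<Rightarrow> bool" where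
  "centered_gaussian_process N T cov G \<longleftrightarrow>
     (\<forall>t\<in>T. G t \<in> borel_measurable N) \<and>
     (\<forall>J a. finite J \<longrightarrow> J \<subseteq> T \<longrightarrow>
        (\<exists>m. \<exists>\<sigma>\<ge>0. distr N borel (\<lambda>\<omega>. \<Sum>t\<in>J. a t * G t \<omega>) = gaussian_law m \<sigma>)) \<and>
     (\<forall>t\<in>T. (\<integral>\<omega>. G t \<omega> \<partial>N) = 0) \<and>
     (\<forall>s\<in>T. \<forall>t\<in>T. (\<integral>\<omega>. G s \<omega> * G t \<omega> \<partial>N) = cov s t)"

text \<open>No measurability of the set of good paths is required: it contains a measurable set
  of probability one.\<close>

definition continuous_process ::
  "'c measure \<Rightarrow> 't set \<Rightarrow> ('t \<Rightarrow> 't \<Rightarrow> real) \<Rightarrow> ('t \<Rightarrow> 'c \<Rightarrow> real) \<Rightarrow> bool" where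
  "continuous_process N T d G \<longleftrightarrow>
     (AE \<omega> in N. \<forall>\<epsilon>>0. \<exists>\<delta>>0. \<forall>s\<in>T. \<forall>t\<in>T. d s t < \<delta> \<longrightarrow> \<bar>G s \<omega> - G t \<omega>\<bar> < \<epsilon>)"

subsection \<open>Outer expectations and weak convergence in $\ell_\infty(T)$\<close>

text \<open>The supremum of an uncountable family need not be measurable, and \<^const>\<open>nn_integral\<close>
  of a nonmeasurable function is a lower integral; hence the explicit upper integral.\<close>

definition outer_nn_expectation :: "'c measure \<Rightarrow> ('c \<Rightarrow> ennreal) \<Rightarrow> ennreal" where
  "outer_nn_expectation N h =
     (INF u\<in>{u \<in> borel_measurable N. \<forall>\<omega>\<in>space N. h \<omega> \<le> u \<omega>}. \<integral>\<^sup>+\<omega>. u \<omega> \<partial>N)"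

text \<open>Used only for bounded functions on probability spaces.\<close>

definition outer_expectation :: "'b measure \<Rightarrow> ('b \<Rightarrow> real) \<Rightarrow> real" where
  "outer_expectation M h =
     (INF u\<in>{u. integrable M u \<and> (\<forall>\<omega>\<in>space M. h \<omega> \<le> u \<omega>)}. \<integral>\<omega>. u \<omega> \<partial>M)"

text \<open>Points of $\ell_\infty(T)$ are the bounded functions that are extensional on $T$.\<close>

abbreviation linf :: "'t set \<Rightarrow> ('t \<Rightarrow> real) metric" where
  "linf T \<equiv> funspace T euclidean_metric"

definition borel_of_metric :: "'m metric \<Rightarrow> 'm measure" where
  "borel_of_metric m = sigma (mspace m) {U. openin (mtopology_of m) U}"

definition tight_map :: "'m metric \<Rightarrow> 'c measure \<Rightarrow> ('c \<Rightarrow> 'm) \<Rightarrow> bool" where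
  "tight_map m N Y \<longleftrightarrow>
     (\<forall>\<epsilon>>0. \<exists>C. compactin (mtopology_of m) C \<and> measure N {\<omega> \<in> space N. Y \<omega> \<in> C} \<ge> 1 - \<epsilon>)"

definition outer_weak_convergence ::
  "'m metric \<Rightarrow> 'b measure \<Rightarrow> (nat \<Rightarrow> 'b \<Rightarrow> 'm) \<Rightarrow> 'c measure \<Rightarrow> ('c \<Rightarrow> 'm) \<Rightarrow> bool" where
  "outer_weak_convergence m M Z N Y \<longleftrightarrow>
     (\<forall>n. \<forall>\<omega>\<in>space M. Z n \<omega> \<in> mspace m) \<and>
     Y \<in> measurable N (borel_of_metric m) \<and> tight_map m N Y \<and>
     (\<forall>h. continuous_map (mtopology_of m) euclideanreal h \<longrightarrow> bounded (h ` mspace m) \<longrightarrow>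
        (\<lambda>n. outer_expectation M (\<lambda>\<omega>. h (Z n \<omega>))) \<longlonglongrightarrow> (\<integral>\<omega>. h (Y \<omega>) \<partial>N))"

end

theory Submission
  imports Defs
begin

text \<open>Write \<open>\<nu>\<^sub>n g = sqrt n * P\<^sub>n g\<close>. Since the increments of the chain are centred, the part cut off
  by the truncation at level \<open>s\<close> has mean at most \<open>\<parallel>\<Delta>\<^sub>s f\<parallel>\<^sup>2 / \<lambda>\<close>. With the deviation inequality that is required
  of \<open>c0\<close> and property (B), this makes the part \<open>s > s\<^sub>0\<close> of the chain small uniformly in \<open>f\<close> and \<open>n\<close>,
  outside an event of small probability. For \<open>s \<le> s\<^sub>0\<close> there are only finitely many increments, and
  truncating them costs \<open>o(1)\<close> in mean by dominated convergence. The chain up to \<open>s\<^sub>0\<close> telescopes, so that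
  the process is uniformly close to \<open>f \<mapsto> \<nu>\<^sub>n (\<pi>\<^sub>s\<^sub>0 f)\<close>, which lives on the finite set \<open>F\<^sub>s\<^sub>0\<close> and converges to
  \<open>f \<mapsto> G (\<pi>\<^sub>s\<^sub>0 f)\<close> by the central limit theorem and the Cramer-Wold device. By continuity of the paths
  the latter converges uniformly to \<open>G\<close> as \<open>s\<^sub>0\<close> tends to infinity.

  Only bounded Lipschitz test functions have to be treated: a bounded continuous function is the
  monotone limit of Lipschitz functions from below and from above, and outer expectation is monotone.\<close>

section \<open>Weak convergence and tightness in metric spaces\<close>

text \<open>The class may be uncountable, so the modified process need not be measurable into
  \<open>linf F\<close>. It is therefore only compared, path by path, with a process that factors
  through finitely many coordinates and whose integrals are ordinary ones; outer expectations enter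
  through one-sided bounds alone. The form of the truncation level comes from a balance. With
  \<open>\<lambda>\<close> proportional to \<open>sqrt n\<close> times the norm of the increment
  over \<open>2 powr (s / 2)\<close>, the scaled bias, \<open>sqrt n\<close> times the squared norm
  over \<open>\<lambda>\<close>, is \<open>2 powr (s / 2)\<close> times the norm over
  \<open>c0\<close>. This has the size of the deviation bound and is controlled by the sums in (B).
  The paths of \<open>G\<close> are only almost surely good, so the limit is a version of
  \<open>G\<close> whose paths are all uniformly continuous. Its Borel measurability and tightness
  in the in general nonseparable space \<open>linf F\<close> come from its uniform approximation by
  paths in images of finite-dimensional cubes. The central limit theorem is one-dimensional. Joint
  convergence is obtained from characteristic functions by approximating test functions by
  trigonometric polynomials, with uniformly bounded second moments in the role of tightness.\<close>

lemma (in prob_space) outer_expectation_le: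
  assumes "\<And>\<omega>. \<omega> \<in> space M \<Longrightarrow> B \<le> h \<omega>" "integrable M u" "\<And>\<omega>. \<omega> \<in> space M \<Longrightarrow> h \<omega> \<le> u \<omega>"
  shows "outer_expectation M h \<le> (\<integral>\<omega>. u \<omega> \<partial>M)"
  unfolding outer_expectation_def
proof (rule cINF_lower)
  show "bdd_below ((\<lambda>u. integral\<^sup>L M u) ` {u. integrable M u \<and> (\<forall>\<omega>\<in>space M. h \<omega> \<le> u \<omega>)})"
  proof (rule bdd_belowI2)
    fix u assume "u \<in> {u. integrable M u \<and> (\<forall>\<omega>\<in>space M. h \<omega> \<le> u \<omega>)}"
    then show "B \<le> integral\<^sup>L M u"
      using assms(1) by (intro integral_ge_const AE_I2) (auto intro: order_trans)
  qed
qed (use assms in auto)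

text \<open>Any integrable minorant integrates to at most the integral of any integrable majorant.
  The bound \<open>B\<close> on \<open>h\<close> makes the set of majorants nonempty, without which
  the real-valued infimum would mean nothing; in \<open>outer_expectation_le\<close> the lower bound
  serves to bound the set of integrals from below.\<close>

lemma (in prob_space) le_outer_expectation:
  assumes "\<And>\<omega>. \<omega> \<in> space M \<Longrightarrow> h \<omega> \<le> B" "integrable M v" "AE \<omega> in M. v \<omega> \<le> h \<omega>"
  shows "(\<integral>\<omega>. v \<omega> \<partial>M) \<le> outer_expectation M h"
  unfolding outer_expectation_def
proof (rule cINF_greatest)
  show "{u. integrable M u \<and> (\<forall>\<omega>\<in>space M. h \<omega> \<le> u \<omega>)} \<noteq> {}"
    using assms(1) by (auto intro!: exI[of _ "\<lambda>_. B"])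
next
  fix u assume u: "u \<in> {u. integrable M u \<and> (\<forall>\<omega>\<in>space M. h \<omega> \<le> u \<omega>)}"
  have "AE \<omega> in M. v \<omega> \<le> u \<omega>"
    using assms(3) AE_space by eventually_elim (use u in force)
  with assms u show "integral\<^sup>L M v \<le> integral\<^sup>L M u"
    by (intro integral_mono_AE) auto
qed

lemma (in prob_space) outer_expectation_mono:
  assumes "\<And>\<omega>. \<omega> \<in> space M \<Longrightarrow> A \<le> g \<omega>" "\<And>\<omega>. \<omega> \<in> space M \<Longrightarrow> g \<omega> \<le> h \<omega>"
    "\<And>\<omega>. \<omega> \<in> space M \<Longrightarrow> h \<omega> \<le> B"
  shows "outer_expectation M g \<le> outer_expectation M h"
  unfolding outer_expectation_def[of M h]
proof (rule cINF_greatest)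
  show "{u. integrable M u \<and> (\<forall>\<omega>\<in>space M. h \<omega> \<le> u \<omega>)} \<noteq> {}"
    using assms(3) by (auto intro!: exI[of _ "\<lambda>_. B"])
next
  fix u assume "u \<in> {u. integrable M u \<and> (\<forall>\<omega>\<in>space M. h \<omega> \<le> u \<omega>)}"
  with assms show "outer_expectation M g \<le> integral\<^sup>L M u"
    by (intro outer_expectation_le[of A]) force+
qed

section \<open>Lipschitz envelopes of bounded functions\<close>

text \<open>The inf-convolution of \<open>h\<close> with \<open>k\<close> times the distance: for
  bounded \<open>h\<close> and \<open>k \<ge> 0\<close> it is the largest \<open>k\<close>-Lipschitz
  function below \<open>h\<close>. Applied to \<open>- h\<close> and negated, it gives the smallest
  one above \<open>h\<close>.\<close>

definition lipschitz_inf :: "'m metric \<Rightarrow> real \<Rightarrow> ('m \<Rightarrow> real) \<Rightarrow> 'm \<Rightarrow> real" where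
  "lipschitz_inf m k h x = (INF y\<in>mspace m. h y + k * mdist m x y)"

lemma
  assumes h: "\<forall>y\<in>mspace m. \<bar>h y\<bar> \<le> B" and "k \<ge> 0"
  shows lipschitz_inf_le: "x \<in> mspace m \<Longrightarrow> y \<in> mspace m \<Longrightarrow> lipschitz_inf m k h x \<le> h y + k * mdist m x y"
    and le_lipschitz_inf: "x \<in> mspace m \<Longrightarrow> (\<And>y. y \<in> mspace m \<Longrightarrow> b \<le> h y + k * mdist m x y) \<Longrightarrow> b \<le> lipschitz_inf m k h x"
proof -
  have "bdd_below ((\<lambda>y. h y + k * mdist m x y) ` mspace m)" for x
    using h \<open>k \<ge> 0\<close> by (intro bdd_belowI2[of _ "-B"]) (fastforce simp: abs_le_iff intro: add_increasing2)
  then show "x \<in> mspace m \<Longrightarrow> y \<in> mspace m \<Longrightarrow> lipschitz_inf m k h x \<le> h y + k * mdist m x y"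
    unfolding lipschitz_inf_def by (rule cINF_lower)
  show "x \<in> mspace m \<Longrightarrow> (\<And>y. y \<in> mspace m \<Longrightarrow> b \<le> h y + k * mdist m x y) \<Longrightarrow> b \<le> lipschitz_inf m k h x"
    unfolding lipschitz_inf_def by (rule cINF_greatest) auto
qed

lemma lipschitz_inf_bounds:
  assumes h: "\<forall>y\<in>mspace m. \<bar>h y\<bar> \<le> B" and "k \<ge> 0" and x: "x \<in> mspace m"
  shows "- B \<le> lipschitz_inf m k h x" "lipschitz_inf m k h x \<le> h x" "\<bar>lipschitz_inf m k h x\<bar> \<le> B"
proof -
  show 1: "- B \<le> lipschitz_inf m k h x"
    using h \<open>k \<ge> 0\<close> x by (intro le_lipschitz_inf[of m h B]) (fastforce simp: abs_le_iff intro: add_increasing2)+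
  show 2: "lipschitz_inf m k h x \<le> h x"
    using lipschitz_inf_le[OF h \<open>k \<ge> 0\<close> x x] mdist_zero[OF x x] by simp
  show "\<bar>lipschitz_inf m k h x\<bar> \<le> B"
    using 1 2 h[rule_format, OF x] by linarith
qed

lemma lipschitz_inf_lipschitz:
  assumes h: "\<forall>y\<in>mspace m. \<bar>h y\<bar> \<le> B" and "k \<ge> 0" and "x \<in> mspace m" "y \<in> mspace m"
  shows "\<bar>lipschitz_inf m k h x - lipschitz_inf m k h y\<bar> \<le> k * mdist m x y"
proof -
  have "lipschitz_inf m k h x - k * mdist m x y \<le> lipschitz_inf m k h y"
    if x: "x \<in> mspace m" and y: "y \<in> mspace m" for x y
  proof (rule le_lipschitz_inf[OF h \<open>k \<ge> 0\<close> y])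
    fix z assume z: "z \<in> mspace m"
    have "k * mdist m x z \<le> k * (mdist m x y + mdist m y z)"
      using mdist_triangle[OF x y z] \<open>k \<ge> 0\<close> by (rule mult_left_mono)
    then show "lipschitz_inf m k h x - k * mdist m x y \<le> h z + k * mdist m y z"
      using lipschitz_inf_le[OF h \<open>k \<ge> 0\<close> x z] by (simp add: distrib_left)
  qed
  from this[of x y] this[of y x] assms show ?thesis by (simp add: mdist_commute abs_le_iff)
qed

section \<open>Borel measurability and continuity in a metric space\<close>

lemma openin_mtopology_of_subset: "openin (mtopology_of m) U \<Longrightarrow> U \<subseteq> mspace m"
  using openin_subset[of "mtopology_of m" U] by simp

lemma measurable_borel_of_metricI:
  assumes "\<And>\<omega>. \<omega> \<in> space N \<Longrightarrow> Y \<omega> \<in> mspace m"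
    and "\<And>U. openin (mtopology_of m) U \<Longrightarrow> {\<omega> \<in> space N. Y \<omega> \<in> U} \<in> sets N"
  shows "Y \<in> measurable N (borel_of_metric m)"
  unfolding borel_of_metric_def
  using assms by (intro measurable_measure_of) (auto simp: vimage_def Int_def conj_commute dest: openin_mtopology_of_subset)

lemma
  assumes "Y \<in> measurable N (borel_of_metric m)"
  shows measurable_borel_of_metric_space: "\<omega> \<in> space N \<Longrightarrow> Y \<omega> \<in> mspace m"
    and measurable_borel_of_metric_open: "openin (mtopology_of m) U \<Longrightarrow> {\<omega> \<in> space N. Y \<omega> \<in> U} \<in> sets N"
proof -
  have sub: "{U. openin (mtopology_of m) U} \<subseteq> Pow (mspace m)"
    by (auto dest: openin_mtopology_of_subset)
  have sp: "space (borel_of_metric m) = mspace m" and "openin (mtopology_of m) U \<Longrightarrow> U \<in> sets (borel_of_metric m)"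
    using sub by (simp_all add: borel_of_metric_def space_measure_of)
  then show "openin (mtopology_of m) U \<Longrightarrow> {\<omega> \<in> space N. Y \<omega> \<in> U} \<in> sets N"
    using measurable_sets[OF assms, of U] by (simp add: vimage_def Int_def conj_commute)
  show "\<omega> \<in> space N \<Longrightarrow> Y \<omega> \<in> mspace m"
    using measurable_space[OF assms] sp by auto
qed

lemma openin_mtopology_of_iff:
  "openin (mtopology_of m) U \<longleftrightarrow>
    U \<subseteq> mspace m \<and> (\<forall>x\<in>U. \<exists>r>0. \<forall>y\<in>mspace m. mdist m x y < r \<longrightarrow> y \<in> U)"
proof -
  interpret Metric_space "mspace m" "mdist m" by (rule Metric_space_mspace_mdist)
  have "mball x r \<subseteq> U \<longleftrightarrow> (\<forall>y\<in>mspace m. mdist m x y < r \<longrightarrow> y \<in> U)" if "x \<in> mspace m" for x r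
    using that by (auto simp: subset_iff)
  then show ?thesis
    unfolding mtopology_of_def openin_mtopology by (metis subsetD)
qed

lemma continuous_map_real_metricD:
  assumes "continuous_map (mtopology_of m) euclideanreal h" "x \<in> mspace m" "e > 0"
  obtains d where "d > 0" "\<And>y. y \<in> mspace m \<Longrightarrow> mdist m x y < d \<Longrightarrow> \<bar>h y - h x\<bar> < e"
proof -
  interpret Metric_space "mspace m" "mdist m" by (rule Metric_space_mspace_mdist)
  have "openin (mtopology_of m) {y \<in> topspace (mtopology_of m). h y \<in> ball (h x) e}"
    using assms(1) by (rule openin_continuous_map_preimage) auto
  then obtain d where "d > 0" "mball x d \<subseteq> {y \<in> mspace m. h y \<in> ball (h x) e}"
    using assms by (auto simp: mtopology_of_def openin_mtopology)
  then show ?thesis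
    using that[of d] assms(2) by (auto simp: subset_iff dist_real_def abs_minus_commute)
qed

text \<open>Near \<open>x\<close> continuity keeps \<open>h\<close> close to \<open>h x\<close>; at
  distance at least \<open>d\<close> the penalty \<open>k * d\<close> outweighs the oscillation of
  \<open>h\<close>, which is at most \<open>2 * B\<close>. So for large \<open>k\<close> no point
  pushes the infimum much below \<open>h x\<close>.\<close>

lemma lipschitz_inf_tendsto:
  assumes h: "\<forall>y\<in>mspace m. \<bar>h y\<bar> \<le> B"
    and cont: "continuous_map (mtopology_of m) euclideanreal h" and x: "x \<in> mspace m"
  shows "(\<lambda>k. lipschitz_inf m (real k) h x) \<longlonglongrightarrow> h x"
proof (rule LIMSEQ_I)
  fix r :: real assume "r > 0"
  then obtain d where d: "d > 0" "\<And>y. y \<in> mspace m \<Longrightarrow> mdist m x y < d \<Longrightarrow> \<bar>h y - h x\<bar> < r / 2"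
    using continuous_map_real_metricD[OF cont x, of "r/2"] by auto
  have B: "B \<ge> 0" using h[rule_format, OF x] by simp
  obtain k0 :: nat where k0: "2 * B / d < k0" using reals_Archimedean2 by blast
  have "norm (lipschitz_inf m (real k) h x - h x) < r" if "k \<ge> k0" for k
  proof -
    have "h x - r / 2 \<le> lipschitz_inf m (real k) h x"
    proof (rule le_lipschitz_inf[OF h _ x])
      fix y assume y: "y \<in> mspace m"
      show "h x - r / 2 \<le> h y + real k * mdist m x y"
      proof (cases "mdist m x y < d")
        case True
        have "0 \<le> real k * mdist m x y" by simp
        then show ?thesis using d(2)[OF y True] by linarith
      next
        case False
        have "2 * B \<le> k0 * d" using k0 d by (simp add: field_simps)
        also have "\<dots> \<le> real k * mdist m x y"
          using False that d(1) by (intro mult_mono) auto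
        finally show ?thesis using h[rule_format, OF x] h[rule_format, OF y] \<open>r > 0\<close> by linarith
      qed
    qed simp_all
    then show ?thesis
      using lipschitz_inf_bounds(2)[OF h _ x, of k] \<open>r > 0\<close> by simp
  qed
  then show "\<exists>k0. \<forall>k\<ge>k0. norm (lipschitz_inf m (real k) h x - h x) < r" by blast
qed

lemma lipschitz_imp_continuous_map:
  assumes "\<And>x y. x \<in> mspace m \<Longrightarrow> y \<in> mspace m \<Longrightarrow> \<bar>h x - h y\<bar> \<le> k * mdist m x y"
  shows "continuous_map (mtopology_of m) euclideanreal h"
proof -
  have "Lipschitz_continuous_map m euclidean_metric h"
    using assms by (auto simp: Lipschitz_continuous_map_def dist_real_def intro!: exI[of _ k])
  then show ?thesis
    using Lipschitz_continuous_imp_continuous_map[of m euclidean_metric h] by (simp add: mtopology_of_euclidean)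
qed

lemma continuous_map_measurable_comp:
  assumes Y: "Y \<in> measurable N (borel_of_metric m)"
    and h: "continuous_map (mtopology_of m) euclideanreal h"
  shows "(\<lambda>\<omega>. h (Y \<omega>)) \<in> borel_measurable N"
proof (rule borel_measurableI)
  fix S :: "real set" assume "open S"
  then have "openin (mtopology_of m) {x \<in> mspace m. h x \<in> S}"
    using openin_continuous_map_preimage[OF h] by auto
  from measurable_borel_of_metric_open[OF Y this]
  have "{\<omega> \<in> space N. Y \<omega> \<in> mspace m \<and> h (Y \<omega>) \<in> S} \<in> sets N" by simp
  also have "{\<omega> \<in> space N. Y \<omega> \<in> mspace m \<and> h (Y \<omega>) \<in> S} = (\<lambda>\<omega>. h (Y \<omega>)) -` S \<inter> space N"
    using measurable_borel_of_metric_space[OF Y] by auto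
  finally show "(\<lambda>\<omega>. h (Y \<omega>)) -` S \<inter> space N \<in> sets N" .
qed

theorem outer_weak_convergence_lipschitz:
  assumes "prob_space M" "prob_space N"
    and Z: "\<And>n \<omega>. \<omega> \<in> space M \<Longrightarrow> Z n \<omega> \<in> mspace m"
    and Y: "Y \<in> measurable N (borel_of_metric m)" "tight_map m N Y"
    and lip: "\<And>h k B. (\<And>x. x \<in> mspace m \<Longrightarrow> \<bar>h x\<bar> \<le> B) \<Longrightarrow>
      (\<And>x y. x \<in> mspace m \<Longrightarrow> y \<in> mspace m \<Longrightarrow> \<bar>h x - h y\<bar> \<le> k * mdist m x y) \<Longrightarrow> k \<ge> 0 \<Longrightarrow>
      (\<lambda>n. outer_expectation M (\<lambda>\<omega>. h (Z n \<omega>))) \<longlonglongrightarrow> (\<integral>\<omega>. h (Y \<omega>) \<partial>N)"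
  shows "outer_weak_convergence m M Z N Y"
proof -
  interpret M: prob_space M by fact
  interpret N: prob_space N by fact
  note spY = measurable_borel_of_metric_space[OF Y(1)]
  have conv: "(\<lambda>n. outer_expectation M (\<lambda>\<omega>. h (Z n \<omega>))) \<longlonglongrightarrow> (\<integral>\<omega>. h (Y \<omega>) \<partial>N)"
    if h: "continuous_map (mtopology_of m) euclideanreal h" and "bounded (h ` mspace m)" for h
  proof -
    obtain B where B: "\<forall>x\<in>mspace m. \<bar>h x\<bar> \<le> B"
      using \<open>bounded (h ` mspace m)\<close> by (auto simp: bounded_iff)
    define lo where "lo k = lipschitz_inf m (real k) h" for k :: nat
    define up where "up k x = - lipschitz_inf m (real k) (\<lambda>x. - h x) x" for k :: nat and x
    have B': "\<forall>x\<in>mspace m. \<bar>- h x\<bar> \<le> B" using B by simp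
    have h': "continuous_map (mtopology_of m) euclideanreal (\<lambda>x. - h x)"
      using h by (rule continuous_map_minus)
    have lo_b: "\<bar>lo k x\<bar> \<le> B" "lo k x \<le> h x" and up_b: "\<bar>up k x\<bar> \<le> B" "h x \<le> up k x"
      if "x \<in> mspace m" for k x
      using lipschitz_inf_bounds[OF B _ that, of k] lipschitz_inf_bounds[OF B' _ that, of k]
      by (auto simp: lo_def up_def)
    have lo_l: "\<bar>lo k x - lo k y\<bar> \<le> real k * mdist m x y"
      and up_l: "\<bar>up k x - up k y\<bar> \<le> real k * mdist m x y"
      if "x \<in> mspace m" "y \<in> mspace m" for k x y
      using lipschitz_inf_lipschitz[OF B _ that, of k] lipschitz_inf_lipschitz[OF B' _ that, of k]
      by (auto simp: lo_def up_def abs_minus_commute)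
    have lo_c: "(\<lambda>n. outer_expectation M (\<lambda>\<omega>. lo k (Z n \<omega>))) \<longlonglongrightarrow> (\<integral>\<omega>. lo k (Y \<omega>) \<partial>N)"
      and up_c: "(\<lambda>n. outer_expectation M (\<lambda>\<omega>. up k (Z n \<omega>))) \<longlonglongrightarrow> (\<integral>\<omega>. up k (Y \<omega>) \<partial>N)" for k
      using lip[OF lo_b(1) lo_l] lip[OF up_b(1) up_l] by auto
    have m: "(\<lambda>\<omega>. h (Y \<omega>)) \<in> borel_measurable N" "(\<lambda>\<omega>. lo k (Y \<omega>)) \<in> borel_measurable N"
      "(\<lambda>\<omega>. up k (Y \<omega>)) \<in> borel_measurable N" for k
      using continuous_map_measurable_comp[OF Y(1)] h lipschitz_imp_continuous_map[OF lo_l]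
        lipschitz_imp_continuous_map[OF up_l] by auto
    have lo: "(\<lambda>k. \<integral>\<omega>. lo k (Y \<omega>) \<partial>N) \<longlonglongrightarrow> (\<integral>\<omega>. h (Y \<omega>) \<partial>N)"
      using lipschitz_inf_tendsto[OF B h spY] lo_b(1)[OF spY] m
      by (intro integral_dominated_convergence[where w = "\<lambda>_. B"]) (auto simp: lo_def)
    have up: "(\<lambda>k. \<integral>\<omega>. up k (Y \<omega>) \<partial>N) \<longlonglongrightarrow> (\<integral>\<omega>. h (Y \<omega>) \<partial>N)"
      using tendsto_minus[OF lipschitz_inf_tendsto[OF B' h' spY]] up_b(1)[OF spY] m
      by (intro integral_dominated_convergence[where w = "\<lambda>_. B"]) (auto simp: up_def)
    have le: "outer_expectation M (\<lambda>\<omega>. lo k (Z n \<omega>)) \<le> outer_expectation M (\<lambda>\<omega>. h (Z n \<omega>))"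
      "outer_expectation M (\<lambda>\<omega>. h (Z n \<omega>)) \<le> outer_expectation M (\<lambda>\<omega>. up k (Z n \<omega>))" for k n
      using lo_b up_b B Z
      by (auto intro!: M.outer_expectation_mono[of "-B" _ _ B] simp: abs_le_iff minus_le_iff)
    \<comment> \<open>The limits are taken one after the other: \<open>k\<close> is fixed so that
      the integral of the envelope at \<open>Y\<close> is on the right side of \<open>a\<close>, and
      only then does \<open>n\<close> tend to infinity.\<close>
    show ?thesis
    proof (rule order_tendstoI)
      fix a assume "a < (\<integral>\<omega>. h (Y \<omega>) \<partial>N)"
      then obtain k where "a < (\<integral>\<omega>. lo k (Y \<omega>) \<partial>N)"
        using order_tendstoD(1)[OF lo] eventually_happens' sequentially_bot by blast
      from order_tendstoD(1)[OF lo_c this]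
      show "\<forall>\<^sub>F n in sequentially. a < outer_expectation M (\<lambda>\<omega>. h (Z n \<omega>))"
        by (rule eventually_mono) (rule less_le_trans[OF _ le(1)])
    next
      fix a assume "(\<integral>\<omega>. h (Y \<omega>) \<partial>N) < a"
      then obtain k where "(\<integral>\<omega>. up k (Y \<omega>) \<partial>N) < a"
        using order_tendstoD(2)[OF up] eventually_happens' sequentially_bot by blast
      from order_tendstoD(2)[OF up_c this]
      show "\<forall>\<^sub>F n in sequentially. outer_expectation M (\<lambda>\<omega>. h (Z n \<omega>)) < a"
        by (rule eventually_mono) (rule le_less_trans[OF le(2)])
    qed
  qed
  show ?thesis
    unfolding outer_weak_convergence_def
    by (intro conjI allI ballI impI) (fact Z Y conv)+
qed

section \<open>Pointwise limits of Borel maps, and tightness\<close>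

text \<open>The limit lies in an open set iff, for some \<open>k\<close>, the approximations
  eventually lie in it together with a ball of radius larger than \<open>1 / Suc k\<close>. This is
  a countable combination of measurable events, and separability plays no part.\<close>

lemma measurable_borel_of_metric_limit:
  assumes U: "\<And>s. U s \<in> measurable N (borel_of_metric m)"
    and Y: "\<And>\<omega>. \<omega> \<in> space N \<Longrightarrow> Y \<omega> \<in> mspace m"
    and lim: "\<And>\<omega>. \<omega> \<in> space N \<Longrightarrow> (\<lambda>s. mdist m (U s \<omega>) (Y \<omega>)) \<longlonglongrightarrow> 0"
  shows "Y \<in> measurable N (borel_of_metric m)"
proof (rule measurable_borel_of_metricI[OF Y])
  fix O' assume O': "openin (mtopology_of m) O'"
  \<comment> \<open>The strict \<open>r > e\<close> is what makes \<open>V e\<close> open: moving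
    the centre by less than \<open>(r - e) / 2\<close> leaves the radius \<open>(r + e) / 2\<close>,
    still larger than \<open>e\<close>.\<close>
  define V where "V e = {x \<in> mspace m. \<exists>r>e. \<forall>y\<in>mspace m. mdist m x y < r \<longrightarrow> y \<in> O'}" for e :: real
  have V: "openin (mtopology_of m) (V e)" for e
    unfolding openin_mtopology_of_iff
  proof (intro conjI ballI)
    fix x assume "x \<in> V e"
    then obtain r where x: "x \<in> mspace m" and r: "r > e" "\<And>y. y \<in> mspace m \<Longrightarrow> mdist m x y < r \<Longrightarrow> y \<in> O'"
      by (auto simp: V_def)
    show "\<exists>r>0. \<forall>y\<in>mspace m. mdist m x y < r \<longrightarrow> y \<in> V e"
    proof (intro exI[of _ "(r - e) / 2"] conjI ballI impI)
      fix y assume y: "y \<in> mspace m" "mdist m x y < (r - e) / 2"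
      have "z \<in> O'" if z: "z \<in> mspace m" "mdist m y z < (r + e) / 2" for z
        using mdist_triangle[OF x y(1) z(1)] y z by (intro r(2)) (auto simp: field_simps)
      with y r show "y \<in> V e"
        by (auto simp: V_def intro!: exI[of _ "(r + e) / 2"])
    qed (use r in auto)
  qed (auto simp: V_def)
  have "Y \<omega> \<in> O' \<longleftrightarrow> (\<exists>k s0. \<forall>s\<ge>s0. U s \<omega> \<in> V (1 / Suc k))" if \<omega>: "\<omega> \<in> space N" for \<omega>
  proof
    assume "Y \<omega> \<in> O'"
    then obtain r where r: "r > 0" "\<And>y. y \<in> mspace m \<Longrightarrow> mdist m (Y \<omega>) y < r \<Longrightarrow> y \<in> O'"
      using O' by (auto simp: openin_mtopology_of_iff)
    obtain k :: nat where k: "1 / Suc k < r / 3"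
      using nat_approx_posE[of "r / 3"] r(1) by auto
    obtain s0 where s0: "\<And>s. s \<ge> s0 \<Longrightarrow> mdist m (U s \<omega>) (Y \<omega>) < r / 3"
      using order_tendstoD(2)[OF lim[OF \<omega>], of "r / 3"] r(1) by (auto simp: eventually_sequentially)
    have "U s \<omega> \<in> V (1 / Suc k)" if "s \<ge> s0" for s
    proof -
      note Us = measurable_borel_of_metric_space[OF U \<omega>, of s]
      have "y \<in> O'" if y: "y \<in> mspace m" "mdist m (U s \<omega>) y < r / 2" for y
        using mdist_triangle[OF Y[OF \<omega>] Us y(1)] y s0[OF \<open>s \<ge> s0\<close>] r(1)
        by (intro r(2)) (auto simp: mdist_commute)
      then show ?thesis
        using Us k r(1) by (auto simp: V_def intro!: exI[of _ "r / 2"])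
    qed
    then show "\<exists>k s0. \<forall>s\<ge>s0. U s \<omega> \<in> V (1 / Suc k)" by blast
  next
    assume "\<exists>k s0. \<forall>s\<ge>s0. U s \<omega> \<in> V (1 / Suc k)"
    then obtain k s0 where k: "\<And>s. s \<ge> s0 \<Longrightarrow> U s \<omega> \<in> V (1 / Suc k)" by blast
    obtain s1 where s1: "\<And>s. s \<ge> s1 \<Longrightarrow> mdist m (U s \<omega>) (Y \<omega>) < 1 / Suc k"
      using order_tendstoD(2)[OF lim[OF \<omega>], of "1 / Suc k"] by (auto simp: eventually_sequentially)
    show "Y \<omega> \<in> O'"
      using k[of "max s0 s1"] s1[of "max s0 s1"] Y[OF \<omega>] by (force simp: V_def)
  qed
  then have "{\<omega> \<in> space N. Y \<omega> \<in> O'} = {\<omega> \<in> space N. \<exists>k s0. \<forall>s\<ge>s0. U s \<omega> \<in> V (1 / Suc k)}"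
    by blast
  also have "\<dots> = (\<Union>k. \<Union>s0. space N \<inter> (\<Inter>s\<in>{s0..}. {\<omega> \<in> space N. U s \<omega> \<in> V (1 / Suc k)}))"
    by auto
  also have "\<dots> \<in> sets N"
    using measurable_borel_of_metric_open[OF U V]
    by (intro sets.countable_UN' sets.Int sets.countable_INT'') auto
  finally show "{\<omega> \<in> space N. Y \<omega> \<in> O'} \<in> sets N" .
qed

text \<open>The argument of Ulam's theorem.\<close>

lemma (in prob_space) tight_mapI:
  assumes "mcomplete_of m" and Y: "Y \<in> measurable M (borel_of_metric m)"
    and A: "\<And>i::nat. compactin (mtopology_of m) (A i)"
    and near: "\<And>\<omega> e. \<omega> \<in> space M \<Longrightarrow> e > 0 \<Longrightarrow> \<exists>i. \<exists>x\<in>A i. mdist m (Y \<omega>) x < e"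
  shows "tight_map m M Y"
  unfolding tight_map_def
proof (intro allI impI)
  fix \<epsilon> :: real assume "\<epsilon> > 0"
  interpret Metric_space "mspace m" "mdist m" by (rule Metric_space_mspace_mdist)
  \<comment> \<open>The open \<open>1 / Suc k\<close>-neighbourhood of the compact set formed by
    \<open>A 0\<close> to \<open>A i\<close>. It increases with \<open>i\<close> and finally
    contains every value of \<open>Y\<close>.\<close>
  define D where "D k i = {y \<in> mspace m. \<exists>j\<le>i. \<exists>x\<in>A j. mdist m y x < 1 / Suc k}" for k i :: nat
  have Asub: "A i \<subseteq> mspace m" for i using compactin_subset_topspace[OF A] by simp
  have D_open: "openin (mtopology_of m) (D k i)" for k i
    unfolding openin_mtopology_of_iff
  proof (intro conjI ballI)
    fix y assume "y \<in> D k i"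
    then obtain j x where y: "y \<in> mspace m" "j \<le> i" "x \<in> A j" "mdist m y x < 1 / Suc k"
      by (auto simp: D_def)
    then have "z \<in> D k i" if "z \<in> mspace m" "mdist m y z < 1 / Suc k - mdist m y x" for z
      using mdist_triangle[OF that(1) y(1), of x] that Asub
      by (force simp: D_def mdist_commute)
    then show "\<exists>r>0. \<forall>z\<in>mspace m. mdist m y z < r \<longrightarrow> z \<in> D k i"
      using y by (intro exI[of _ "1 / Suc k - mdist m y x"]) auto
  qed (auto simp: D_def)
  note meas = measurable_borel_of_metric_open[OF Y D_open]
  have ex: "\<exists>i. prob {\<omega> \<in> space M. Y \<omega> \<in> D k i} > 1 - \<epsilon> * (1/2) ^ Suc k" for k
  proof -
    have "(\<lambda>i. prob {\<omega> \<in> space M. Y \<omega> \<in> D k i}) \<longlonglongrightarrow> prob (\<Union>i. {\<omega> \<in> space M. Y \<omega> \<in> D k i})"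
    proof (rule finite_Lim_measure_incseq)
      show "incseq (\<lambda>i. {\<omega> \<in> space M. Y \<omega> \<in> D k i})"
        unfolding D_def incseq_def by (auto intro: order_trans)
    qed (use meas in auto)
    also have "(\<Union>i. {\<omega> \<in> space M. Y \<omega> \<in> D k i}) = space M"
    proof (intro equalityI subsetI)
      fix \<omega> assume \<omega>: "\<omega> \<in> space M"
      then show "\<omega> \<in> (\<Union>i. {\<omega> \<in> space M. Y \<omega> \<in> D k i})"
        using near[OF \<omega>, of "1 / Suc k"] measurable_borel_of_metric_space[OF Y \<omega>]
        by (auto simp: D_def)
    qed auto
    finally have "(\<lambda>i. prob {\<omega> \<in> space M. Y \<omega> \<in> D k i}) \<longlonglongrightarrow> 1" by (simp add: prob_space)
    then have "\<forall>\<^sub>F i in sequentially. prob {\<omega> \<in> space M. Y \<omega> \<in> D k i} > 1 - \<epsilon> * (1/2) ^ Suc k"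
      using \<open>\<epsilon> > 0\<close> by (intro order_tendstoD(1)) auto
    then show ?thesis by (rule eventually_happens'[OF sequentially_bot])
  qed
  then obtain i where i: "\<And>k. prob {\<omega> \<in> space M. Y \<omega> \<in> D k (i k)} > 1 - \<epsilon> * (1/2) ^ Suc k"
    by metis
  \<comment> \<open>\<open>Y\<close> misses level \<open>k\<close> with probability at most
    \<open>\<epsilon> * (1/2) ^ Suc k\<close>, in total at most \<open>\<epsilon>\<close>. Being
    within every scale of a compact set, \<open>C0\<close> is totally bounded, and by completeness
    its closure is compact.\<close>
  define C0 where "C0 = (\<Inter>k. D k (i k))"
  have C0: "C0 \<subseteq> mspace m" by (auto simp: C0_def D_def)
  have tb: "mtotally_bounded C0"
    unfolding mtotally_bounded_def
  proof (intro allI impI)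
    fix e :: real assume "e > 0"
    then obtain k :: nat where k: "1 / Suc k < e / 4" using nat_approx_posE[of "e / 4"] by auto
    have "mtotally_bounded (\<Union>j\<le>i k. A j)"
      using compactin_imp_mtotally_bounded A by (intro mtotally_bounded_Union) (auto simp: mtopology_of_def)
    then obtain K where K: "finite K" "(\<Union>j\<le>i k. A j) \<subseteq> (\<Union>x\<in>K. mball x (e / 4))"
      unfolding mtotally_bounded_def using \<open>e > 0\<close> by (metis zero_less_divide_iff zero_less_numeral)
    have near_K: "\<exists>z\<in>K. y \<in> mball z (e / 2)" if "y \<in> C0" for y
    proof -
      have "y \<in> D k (i k)" using that by (auto simp: C0_def)
      then obtain j x where x: "y \<in> mspace m" "j \<le> i k" "x \<in> A j" "mdist m y x < 1 / Suc k"
        by (auto simp: D_def)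
      then have "x \<in> (\<Union>x\<in>K. mball x (e / 4))" using K(2) by blast
      then obtain z where z: "z \<in> K" "x \<in> mball z (e / 4)" by blast
      have "mdist m z y \<le> mdist m z x + mdist m x y"
        using x z by (intro mdist_triangle) auto
      also have "\<dots> < e / 2"
        using x z k by (simp add: mdist_commute[of m x y])
      finally show ?thesis using x z by auto
    qed
    \<comment> \<open>Total boundedness asks for centres inside \<open>C0\<close>, whereas those in
      \<open>K\<close> may lie outside. Each ball that meets \<open>C0\<close> gets a centre there,
      which doubles the radius from \<open>e / 2\<close> to \<open>e\<close>.\<close>
    define K' where "K' = {z \<in> K. mball z (e / 2) \<inter> C0 \<noteq> {}}"
    then have "\<forall>z\<in>K'. \<exists>x. x \<in> mball z (e / 2) \<inter> C0" by blast
    then obtain f where "\<forall>z\<in>K'. f z \<in> mball z (e / 2) \<inter> C0"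
      by (rule bchoice[THEN exE])
    then have f: "\<And>z. z \<in> K' \<Longrightarrow> f z \<in> mball z (e / 2) \<inter> C0" by blast
    have "C0 \<subseteq> (\<Union>x\<in>f ` K'. mball x e)"
    proof
      fix y assume y: "y \<in> C0"
      then obtain z where z: "z \<in> K" "y \<in> mball z (e / 2)" using near_K by blast
      then have "z \<in> K'" using y by (auto simp: K'_def)
      have fz: "f z \<in> mspace m" "z \<in> mspace m" "y \<in> mspace m" "mdist m z (f z) < e / 2" "mdist m z y < e / 2"
        using f[OF \<open>z \<in> K'\<close>] z by auto
      have "mdist m (f z) y \<le> mdist m (f z) z + mdist m z y"
        using fz by (intro mdist_triangle)
      also have "\<dots> < e" using fz by (simp add: mdist_commute[of m "f z" z])
      finally show "y \<in> (\<Union>x\<in>f ` K'. mball x e)"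
        using \<open>z \<in> K'\<close> fz by auto
    qed
    moreover have "finite K'" using K by (simp add: K'_def)
    ultimately show "\<exists>K. finite K \<and> K \<subseteq> C0 \<and> C0 \<subseteq> (\<Union>x\<in>K. mball x e)"
      using f by (intro exI[of _ "f ` K'"]) auto
  qed
  define C where "C = mtopology closure_of C0"
  have C: "compactin (mtopology_of m) C"
    using tb \<open>mcomplete_of m\<close> mtotally_bounded_eq_compact_closure_of
    by (simp add: C_def mtopology_of_def mcomplete_of_def)
  have "closedin (mtopology_of m) C" by (simp add: C_def mtopology_of_def)
  then have "{\<omega> \<in> space M. Y \<omega> \<in> mspace m - C} \<in> sets M"
    using measurable_borel_of_metric_open[OF Y, of "mspace m - C"] by (auto simp: closedin_def)
  moreover have "{\<omega> \<in> space M. Y \<omega> \<in> C} = space M - {\<omega> \<in> space M. Y \<omega> \<in> mspace m - C}"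
    using measurable_borel_of_metric_space[OF Y] by auto
  ultimately have mC: "{\<omega> \<in> space M. Y \<omega> \<in> C} \<in> sets M" by auto
  let ?B = "\<lambda>k. space M - {\<omega> \<in> space M. Y \<omega> \<in> D k (i k)}"
  have sB: "?B k \<in> sets M" for k using meas by auto
  have pB: "prob (?B k) \<le> \<epsilon> * (1/2) ^ Suc k" for k
    using prob_compl[OF meas] i[of k] by (simp add: less_imp_le)
  have sum: "(\<lambda>k. \<epsilon> * (1/2) ^ Suc k) sums \<epsilon>"
    using sums_mult[OF power_half_series, of \<epsilon>] by simp
  have summ: "summable (\<lambda>k. prob (?B k))"
    by (rule summable_comparison_test[OF _ sums_summable[OF sum]]) (use pB in auto)
  have "prob (\<Union>k. ?B k) \<le> (\<Sum>k. prob (?B k))"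
    using sB by (intro finite_measure_subadditive_countably summ) auto
  also have "\<dots> \<le> (\<Sum>k. \<epsilon> * (1/2) ^ Suc k)"
    using pB summ sums_summable[OF sum] by (intro suminf_le)
  also have "\<dots> = \<epsilon>" using sum by (simp add: sums_iff)
  finally have "prob (\<Union>k. ?B k) \<le> \<epsilon>" .
  moreover have "prob (space M - (\<Union>k. ?B k)) = 1 - prob (\<Union>k. ?B k)"
    by (intro prob_compl sets.countable_UN image_subsetI sB)
  moreover have "prob (space M - (\<Union>k. ?B k)) \<le> prob {\<omega> \<in> space M. Y \<omega> \<in> C}"
  proof (rule finite_measure_mono[OF _ mC], intro subsetI CollectI conjI)
    fix \<omega> assume \<omega>: "\<omega> \<in> space M - (\<Union>k. ?B k)"
    then have "Y \<omega> \<in> C0" by (auto simp: C0_def)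
    moreover have "C0 \<subseteq> C"
      unfolding C_def using mtotally_bounded_imp_subset[OF tb] by (intro closure_of_subset) simp
    ultimately show "Y \<omega> \<in> C" by blast
  qed auto
  ultimately show "\<exists>C. compactin (mtopology_of m) C \<and> prob {\<omega> \<in> space M. Y \<omega> \<in> C} \<ge> 1 - \<epsilon>"
    using C by (intro exI[of _ C]) auto
qed

section \<open>The Cramer-Wold device\<close>

text \<open>Trigonometric polynomials in finitely many coordinates. Sequences serve as arguments in
  place of a space for each dimension. The expectations of the generators are the characteristic
  functions of linear combinations, which is what the Cramer-Wold device has to start from.\<close>

inductive_set trig :: "((nat \<Rightarrow> real) \<Rightarrow> complex) set" where
  basic: "(\<lambda>w. iexp (\<Sum>j<k. a j * w j)) \<in> trig"
| scale: "f \<in> trig \<Longrightarrow> (\<lambda>w. c * f w) \<in> trig"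
| add: "f \<in> trig \<Longrightarrow> g \<in> trig \<Longrightarrow> (\<lambda>w. f w + g w) \<in> trig"

text \<open>Both coefficient vectors are padded with zeros to the length \<open>max k l\<close>,
  after which the exponents add.\<close>

lemma trig_basic_mult:
  "(\<lambda>w. iexp (\<Sum>j<k. a j * w j) * iexp (\<Sum>j<l. b j * w j)) \<in> trig"
proof -
  let ?c = "\<lambda>j. (if j < k then a j else 0) + (if j < l then b j else 0)"
  have "iexp (\<Sum>j<k. a j * w j) * iexp (\<Sum>j<l. b j * w j) = iexp (\<Sum>j<max k l. ?c j * w j)" for w
  proof -
    have "(\<Sum>j<k. a j * w j) = (\<Sum>j<max k l. (if j < k then a j else 0) * w j)"
      by (rule sum.mono_neutral_cong_left) auto
    moreover have "(\<Sum>j<l. b j * w j) = (\<Sum>j<max k l. (if j < l then b j else 0) * w j)"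
      by (rule sum.mono_neutral_cong_left) auto
    ultimately have "(\<Sum>j<max k l. ?c j * w j) = (\<Sum>j<k. a j * w j) + (\<Sum>j<l. b j * w j)"
      by (simp add: distrib_right sum.distrib)
    then show ?thesis by (simp add: exp_add distrib_left)
  qed
  then show ?thesis using trig.basic[of ?c "max k l"] by simp
qed

lemma trig_mult:
  assumes "f \<in> trig" "g \<in> trig"
  shows "(\<lambda>w. f w * g w) \<in> trig"
  using assms(1)
proof induction
  case (basic a k)
  from assms(2) show ?case
  proof induction
    case (basic b l)
    then show ?case by (rule trig_basic_mult)
  next
    case (scale f c)
    then show ?case using trig.scale[OF scale.IH, of c] by (simp add: mult.left_commute)
  next
    case (add f g)
    then show ?case using trig.add[OF add.IH] by (simp add: distrib_left)
  qed
next
  case (scale f c)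
  then show ?case using trig.scale[OF scale.IH, of c] by (simp add: mult.assoc)
next
  case (add f g)
  then show ?case using trig.add[OF add.IH] by (simp add: distrib_right)
qed

lemma trig_const: "(\<lambda>w. c) \<in> trig"
  using trig.scale[OF trig.basic[of "\<lambda>_. 0" 0], of c] by simp

text \<open>Euler's formula, with the frequencies \<open>c\<close> and \<open>- c\<close> in the
  single coordinate \<open>j\<close>.\<close>

lemma trig_sin: "(\<lambda>w. complex_of_real (sin (c * w j))) \<in> trig"
proof -
  have *: "(\<Sum>i<Suc j. (if i = j then r else 0) * w i) = r * w j" for r and w :: "nat \<Rightarrow> real"
    by (simp add: if_distrib[of "\<lambda>x. x * _"] cong: if_cong)
  have e: "(\<lambda>w. iexp (r * w j)) \<in> trig" for r
    using trig.basic[of "\<lambda>i. if i = j then r else 0" "Suc j"] by (simp only: *)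
  have "complex_of_real (sin t) = 1 / (2 * \<i>) * iexp t + - 1 / (2 * \<i>) * iexp (- t)" for t
    by (simp add: sin_of_real[symmetric] sin_exp_eq field_simps)
  then have "(\<lambda>w. complex_of_real (sin (c * w j))) =
      (\<lambda>w. 1 / (2 * \<i>) * iexp (c * w j) + - 1 / (2 * \<i>) * iexp ((- c) * w j))"
    by (simp add: fun_eq_iff)
  then show ?thesis using trig.add[OF trig.scale[OF e] trig.scale[OF e]] by (simp only:)
qed

text \<open>Convergence on the generators passes to their span by linearity. Integrability is
  carried along in the induction because the integral is additive only on integrable
  functions.\<close>

lemma trig_expectation_tendsto:
  fixes W :: "nat \<Rightarrow> 'b \<Rightarrow> nat \<Rightarrow> real" and V :: "'c \<Rightarrow> nat \<Rightarrow> real"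
  assumes "prob_space M" "prob_space N"
    and W[measurable]: "\<And>n j. (\<lambda>\<omega>. W n \<omega> j) \<in> borel_measurable M"
    and V[measurable]: "\<And>j. (\<lambda>\<omega>. V \<omega> j) \<in> borel_measurable N"
    and char: "\<And>k a. (\<lambda>n. CLINT \<omega>|M. iexp (\<Sum>j<k. a j * W n \<omega> j))
                  \<longlonglongrightarrow> (CLINT \<omega>|N. iexp (\<Sum>j<k. a j * V \<omega> j))"
    and "f \<in> trig"
  shows "(\<forall>n. complex_integrable M (\<lambda>\<omega>. f (W n \<omega>))) \<and> complex_integrable N (\<lambda>\<omega>. f (V \<omega>)) \<and>
    (\<lambda>n. CLINT \<omega>|M. f (W n \<omega>)) \<longlonglongrightarrow> (CLINT \<omega>|N. f (V \<omega>))"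
proof -
  interpret M: prob_space M by fact
  interpret N: prob_space N by fact
  show ?thesis
    using \<open>f \<in> trig\<close>
  proof induction
    case (basic a k)
    have "complex_integrable M (\<lambda>\<omega>. iexp (\<Sum>j<k. a j * W n \<omega> j))" for n
      by (rule M.integrable_const_bound[of _ 1]) (auto intro!: AE_I2 simp: norm_exp_i_times simp del: of_real_sum)
    moreover have "complex_integrable N (\<lambda>\<omega>. iexp (\<Sum>j<k. a j * V \<omega> j))"
      by (rule N.integrable_const_bound[of _ 1]) (auto intro!: AE_I2 simp: norm_exp_i_times simp del: of_real_sum)
    ultimately show ?case using char by auto
  next
    case (scale f c)
    then show ?case by (auto intro!: tendsto_intros)
  next
    case (add f g)
    then show ?case by (auto intro!: tendsto_intros)
  qed
qed

text \<open>Tychonoff's theorem. Compactness of the cube in infinitely many coordinates lets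
  Stone-Weierstrass be applied to functions of sequences.\<close>

lemma compact_cube: "compact {y :: nat \<Rightarrow> real. \<forall>j. \<bar>y j\<bar> \<le> r}"
proof -
  have "compactin (product_topology (\<lambda>i. euclidean :: real topology) UNIV)
      (PiE (UNIV :: nat set) (\<lambda>_. {-r..r}))"
    by (auto simp: compactin_PiE)
  moreover have "PiE (UNIV :: nat set) (\<lambda>_. {-r..r}) = {y. \<forall>j. \<bar>y j\<bar> \<le> r}"
    by (auto simp: PiE_def Pi_def abs_le_iff minus_le_iff)
  ultimately show ?thesis
    by (simp add: euclidean_product_topology)
qed

text \<open>Stone-Weierstrass for the algebra of those continuous \<open>p\<close> that become
  trigonometric polynomials after the substitution \<open>y j = sin (c * w j)\<close>. It is an
  algebra because \<open>trig\<close> is closed under sums and products, and the coordinates, which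
  belong to it by \<open>trig_sin\<close>, separate points.\<close>

lemma sine_polynomial_approximation:
  fixes g :: "(nat \<Rightarrow> real) \<Rightarrow> real"
  assumes "continuous_on {y. \<forall>j. \<bar>y j\<bar> \<le> 1} g" "e > 0"
  obtains p where "continuous_on {y. \<forall>j. \<bar>y j\<bar> \<le> 1} p"
    "(\<lambda>w. complex_of_real (p (\<lambda>j. sin (c * w j)))) \<in> trig"
    "\<And>y. (\<And>j. \<bar>y j\<bar> \<le> 1) \<Longrightarrow> \<bar>g y - p y\<bar> < e"
proof -
  let ?S = "{y :: nat \<Rightarrow> real. \<forall>j. \<bar>y j\<bar> \<le> 1}"
  let ?P = "\<lambda>p. continuous_on ?S p \<and> (\<lambda>w. complex_of_real (p (\<lambda>j. sin (c * w j)))) \<in> trig"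
  have "\<exists>p. ?P p \<and> (\<forall>y\<in>?S. \<bar>g y - p y\<bar> < e)"
  proof (rule Stone_Weierstrass_HOL[where P = ?P])
    show "compact ?S" by (rule compact_cube)
    show "continuous_on ?S g" "e > 0" by fact+
    show "?P (\<lambda>x. c)" for c :: real
      by (intro conjI continuous_intros trig_const)
    show "continuous_on ?S f" if "?P f" for f
      using that by (rule conjunct1)
    show "?P (\<lambda>x. f x + g x)" if "?P f \<and> ?P g" for f g
      using that trig.add[of "\<lambda>w. complex_of_real (f (\<lambda>j. sin (c * w j)))"]
      by (auto intro: continuous_on_add)
    show "?P (\<lambda>x. f x * g x)" if "?P f \<and> ?P g" for f g
      using that trig_mult[of "\<lambda>w. complex_of_real (f (\<lambda>j. sin (c * w j)))"]
      by (auto intro: continuous_on_mult)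
    fix x y :: "nat \<Rightarrow> real"
    assume "x \<in> ?S \<and> y \<in> ?S \<and> x \<noteq> y"
    then obtain j where "x j \<noteq> y j" by (auto simp: fun_eq_iff)
    moreover have "?P (\<lambda>y. y j)"
      by (intro conjI trig_sin continuous_on_subset[OF continuous_on_product_coordinates]) simp
    ultimately show "\<exists>f. ?P f \<and> f x \<noteq> f y" by blast
  qed
  then show ?thesis using that by blast
qed

text \<open>The triangle wave \<open>2 * R / pi * arcsin (sin (pi / (2 * R) * t))\<close> is the identity on
  \<open>[-R, R]\<close>, bounded by \<open>R\<close>, and a continuous function of a sine; it turns a bounded continuous
  function into one that trigonometric polynomials approximate uniformly.\<close>

lemma trig_approximation:
  fixes \<phi> :: "(nat \<Rightarrow> real) \<Rightarrow> real"
  assumes cont: "continuous_on UNIV \<phi>" and bound: "\<And>w. \<bar>\<phi> w\<bar> \<le> B"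
    and dep: "\<And>w w'. (\<And>j. j \<in> J \<Longrightarrow> w j = w' j) \<Longrightarrow> \<phi> w = \<phi> w'"
    and "finite J" "R > 0" "e > 0"
  obtains q :: "(nat \<Rightarrow> real) \<Rightarrow> real" where "(\<lambda>w. complex_of_real (q w)) \<in> trig"
    "\<And>w. \<bar>\<phi> w - q w\<bar> \<le> e + 2 * B * (\<Sum>j\<in>J. (w j)\<^sup>2) / R\<^sup>2"
proof -
  define \<psi> where "\<psi> y = \<phi> (\<lambda>j. 2 * R / pi * arcsin (y j))" for y :: "nat \<Rightarrow> real"
  have "continuous_on {y. \<forall>j. \<bar>y j\<bar> \<le> 1} \<psi>"
    unfolding \<psi>_def
    by (intro continuous_on_compose2[OF cont] continuous_intros
          continuous_on_subset[OF continuous_on_product_coordinates])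
       (auto simp: abs_le_iff minus_le_iff)
  then obtain p where
    p: "(\<lambda>w. complex_of_real (p (\<lambda>j. sin (pi / (2 * R) * w j)))) \<in> trig"
      "\<And>y. (\<And>j. \<bar>y j\<bar> \<le> 1) \<Longrightarrow> \<bar>\<psi> y - p y\<bar> < e"
    using sine_polynomial_approximation[OF _ \<open>e > 0\<close>] by metis
  show ?thesis
  proof (rule that[OF p(1)])
    fix w :: "nat \<Rightarrow> real"
    let ?y = "\<lambda>j. sin (pi / (2 * R) * w j)"
    let ?s = "(\<Sum>j\<in>J. (w j)\<^sup>2)"
    have B: "B \<ge> 0" using bound[of w] by simp
    have "\<bar>\<psi> ?y - p ?y\<bar> < e" by (rule p(2)) simp
    moreover have "\<bar>\<phi> w - \<psi> ?y\<bar> \<le> 2 * B * ?s / R\<^sup>2"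
    \<comment> \<open>If a relevant coordinate leaves \<open>[-R, R]\<close>, the sum of squares is
      at least \<open>R\<^sup>2\<close> and the trivial bound \<open>2 * B\<close> suffices.
      Otherwise the triangle wave fixes all coordinates in \<open>J\<close>, and
      \<open>\<phi>\<close> sees no others.\<close>
    proof (cases "\<exists>j\<in>J. \<bar>w j\<bar> > R")
      case True
      then obtain j where j: "j \<in> J" "\<bar>w j\<bar> > R" by blast
      have "R\<^sup>2 \<le> (w j)\<^sup>2" using j \<open>R > 0\<close> by (simp add: abs_le_square_iff[symmetric])
      also have "\<dots> \<le> ?s" by (rule member_le_sum) (use j \<open>finite J\<close> in auto)
      finally have "2 * B * 1 \<le> 2 * B * (?s / R\<^sup>2)"
        using \<open>R > 0\<close> B by (intro mult_left_mono) (auto simp: field_simps)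
      then show ?thesis
        using bound[of w] bound[of "\<lambda>j. 2 * R / pi * arcsin (?y j)"] by (simp add: \<psi>_def)
    next
      case False
      have "\<phi> w = \<psi> ?y"
        unfolding \<psi>_def
      proof (rule dep)
        fix j assume "j \<in> J"
        with False have "\<bar>w j\<bar> \<le> R" by force
        then have "\<bar>pi / (2 * R) * w j\<bar> \<le> pi / (2 * R) * R"
          using \<open>R > 0\<close> by (simp add: abs_mult field_simps)
        then have "\<bar>pi / (2 * R) * w j\<bar> \<le> pi / 2" using \<open>R > 0\<close> by simp
        then have "arcsin (?y j) = pi / (2 * R) * w j" by (intro arcsin_sin) linarith+
        then show "w j = 2 * R / pi * arcsin (?y j)" using \<open>R > 0\<close> by simp
      qed
      then show ?thesis using B by (simp add: sum_nonneg)
    qed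
    ultimately show "\<bar>\<phi> w - p ?y\<bar> \<le> e + 2 * B * ?s / R\<^sup>2" by linarith
  qed
qed

text \<open>Integration turns the pointwise error into a bound that depends on the law of
  \<open>U\<close> only through its second moments. Hence one \<open>q\<close> serves for all
  \<open>W n\<close> and for the limit \<open>V\<close>.\<close>

lemma (in prob_space) integral_diff_le_second_moments:
  fixes U :: "'a \<Rightarrow> nat \<Rightarrow> real" and \<phi> q :: "(nat \<Rightarrow> real) \<Rightarrow> real" and B C e R :: real
  assumes U: "\<And>j. (\<lambda>\<omega>. U \<omega> j) \<in> borel_measurable M"
    and U2: "\<And>j. j \<in> J \<Longrightarrow> integrable M (\<lambda>\<omega>. (U \<omega> j)\<^sup>2)" "\<And>j. j \<in> J \<Longrightarrow> (\<integral>\<omega>. (U \<omega> j)\<^sup>2 \<partial>M) \<le> C"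
    and \<phi>: "continuous_on UNIV \<phi>" "\<And>w. \<bar>\<phi> w\<bar> \<le> B"
    and q: "integrable M (\<lambda>\<omega>. q (U \<omega>))"
      "\<And>w. \<bar>\<phi> w - q w\<bar> \<le> e + 2 * B * (\<Sum>j\<in>J. (w j)\<^sup>2) / R\<^sup>2"
  shows "\<bar>(\<integral>\<omega>. \<phi> (U \<omega>) \<partial>M) - (\<integral>\<omega>. q (U \<omega>) \<partial>M)\<bar> \<le> e + 2 * B * (card J * C) / R\<^sup>2"
proof -
  have "U \<in> measurable M borel" using U by (rule measurable_coordinatewise_then_product)
  then have m: "(\<lambda>\<omega>. \<phi> (U \<omega>)) \<in> borel_measurable M"
    using borel_measurable_continuous_onI[OF \<phi>(1)] by measurable
  have B: "B \<ge> 0" using \<phi>(2)[of undefined] by simp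
  have i: "integrable M (\<lambda>\<omega>. \<phi> (U \<omega>))"
    by (rule integrable_const_bound[OF _ m, of B]) (simp add: \<phi>(2))
  have "\<bar>(\<integral>\<omega>. \<phi> (U \<omega>) \<partial>M) - (\<integral>\<omega>. q (U \<omega>) \<partial>M)\<bar> = \<bar>\<integral>\<omega>. \<phi> (U \<omega>) - q (U \<omega>) \<partial>M\<bar>"
    using i q by simp
  also have "\<dots> \<le> (\<integral>\<omega>. \<bar>\<phi> (U \<omega>) - q (U \<omega>)\<bar> \<partial>M)"
    by (rule integral_abs_bound)
  also have "\<dots> \<le> (\<integral>\<omega>. e + 2 * B * (\<Sum>j\<in>J. (U \<omega> j)\<^sup>2) / R\<^sup>2 \<partial>M)"
    using i q U2(1) by (intro integral_mono) auto
  also have "\<dots> = e + 2 * B * (\<Sum>j\<in>J. (\<integral>\<omega>. (U \<omega> j)\<^sup>2 \<partial>M)) / R\<^sup>2"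
    using U2(1) by (simp add: prob_space)
  also have "\<dots> \<le> e + 2 * B * (card J * C) / R\<^sup>2"
    using B sum_bounded_above[of J "\<lambda>j. \<integral>\<omega>. (U \<omega> j)\<^sup>2 \<partial>M" C] U2(2)
    by (intro add_left_mono divide_right_mono mult_left_mono) auto
  finally show ?thesis .
qed

text \<open>The uniform bound \<open>C\<close> on the second moments replaces tightness: it makes
  the error of the trigonometric approximation small uniformly in \<open>n\<close>.\<close>

theorem cramer_wold_expectation:
  fixes W :: "nat \<Rightarrow> 'b \<Rightarrow> nat \<Rightarrow> real" and V :: "'c \<Rightarrow> nat \<Rightarrow> real"
    and \<phi> :: "(nat \<Rightarrow> real) \<Rightarrow> real" and B C :: real
  assumes M: "prob_space M" and N: "prob_space N"
    and W: "\<And>n j. (\<lambda>\<omega>. W n \<omega> j) \<in> borel_measurable M"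
    and V: "\<And>j. (\<lambda>\<omega>. V \<omega> j) \<in> borel_measurable N"
    and char: "\<And>k a. (\<lambda>n. CLINT \<omega>|M. iexp (\<Sum>j<k. a j * W n \<omega> j))
                  \<longlonglongrightarrow> (CLINT \<omega>|N. iexp (\<Sum>j<k. a j * V \<omega> j))"
    and W2: "\<And>n j. j \<in> J \<Longrightarrow> integrable M (\<lambda>\<omega>. (W n \<omega> j)\<^sup>2)"
      "\<And>n j. j \<in> J \<Longrightarrow> (\<integral>\<omega>. (W n \<omega> j)\<^sup>2 \<partial>M) \<le> C"
    and V2: "\<And>j. j \<in> J \<Longrightarrow> integrable N (\<lambda>\<omega>. (V \<omega> j)\<^sup>2)"
      "\<And>j. j \<in> J \<Longrightarrow> (\<integral>\<omega>. (V \<omega> j)\<^sup>2 \<partial>N) \<le> C"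
    and "finite J"
    and \<phi>: "continuous_on UNIV \<phi>" "\<And>w. \<bar>\<phi> w\<bar> \<le> B"
    and dep: "\<And>w w'. (\<And>j. j \<in> J \<Longrightarrow> w j = w' j) \<Longrightarrow> \<phi> w = \<phi> w'"
  shows "(\<lambda>n. \<integral>\<omega>. \<phi> (W n \<omega>) \<partial>M) \<longlonglongrightarrow> (\<integral>\<omega>. \<phi> (V \<omega>) \<partial>N)"
proof (rule LIMSEQ_I)
  interpret M: prob_space M by fact
  interpret N: prob_space N by fact
  fix r :: real assume "r > 0"
  \<comment> \<open>Chosen so that the second-moment term is at most \<open>r / 12\<close>; the
    summand 1 gives \<open>R \<ge> 1\<close> and so \<open>R \<le> R\<^sup>2\<close>. The
    approximation then costs \<open>r / 6\<close> for \<open>W n\<close> and \<open>r / 6\<close>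
    for \<open>V\<close>, which leaves room for the \<open>r / 2\<close> from the convergence of
    \<open>q\<close>.\<close>
  define R where "R = 1 + 12 * \<bar>2 * B * (card J * C)\<bar> / r"
  have R: "R > 0" "R \<ge> 1" using \<open>r > 0\<close> by (auto simp: R_def add_pos_nonneg)
  have small: "2 * B * (card J * C) / R\<^sup>2 \<le> r / 12"
  proof -
    have "\<bar>2 * B * (card J * C)\<bar> \<le> r / 12 * R"
      using \<open>r > 0\<close> by (simp add: R_def field_simps)
    also have "\<dots> \<le> r / 12 * R\<^sup>2"
      using R \<open>r > 0\<close> by (intro mult_left_mono) (auto simp: power2_eq_square)
    finally show ?thesis using R by (simp add: field_simps)
  qed
  obtain q where q: "(\<lambda>w. complex_of_real (q w)) \<in> trig"
    "\<And>w. \<bar>\<phi> w - q w\<bar> \<le> r / 12 + 2 * B * (\<Sum>j\<in>J. (w j)\<^sup>2) / R\<^sup>2"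
    using trig_approximation[OF \<phi> dep \<open>finite J\<close> R(1), of "r / 12"] \<open>r > 0\<close> by auto
  have t: "\<And>n. integrable M (\<lambda>\<omega>. q (W n \<omega>))" "integrable N (\<lambda>\<omega>. q (V \<omega>))"
    "(\<lambda>n. \<integral>\<omega>. q (W n \<omega>) \<partial>M) \<longlonglongrightarrow> (\<integral>\<omega>. q (V \<omega>) \<partial>N)"
    using trig_expectation_tendsto[OF M N W V char q(1)]
    by (auto simp: complex_of_real_integrable_eq tendsto_of_real_iff)
  obtain n0 where n0: "\<And>n. n \<ge> n0 \<Longrightarrow> norm ((\<integral>\<omega>. q (W n \<omega>) \<partial>M) - (\<integral>\<omega>. q (V \<omega>) \<partial>N)) < r / 2"
    using LIMSEQ_D[OF t(3), of "r / 2"] \<open>r > 0\<close> by auto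
  have "norm ((\<integral>\<omega>. \<phi> (W n \<omega>) \<partial>M) - (\<integral>\<omega>. \<phi> (V \<omega>) \<partial>N)) < r" if "n \<ge> n0" for n
  proof -
    have "\<bar>(\<integral>\<omega>. \<phi> (W n \<omega>) \<partial>M) - (\<integral>\<omega>. q (W n \<omega>) \<partial>M)\<bar> \<le> r / 12 + r / 12"
      using M.integral_diff_le_second_moments[OF W W2 \<phi> t(1) q(2), of n] small by linarith
    moreover have "\<bar>(\<integral>\<omega>. \<phi> (V \<omega>) \<partial>N) - (\<integral>\<omega>. q (V \<omega>) \<partial>N)\<bar> \<le> r / 12 + r / 12"
      using N.integral_diff_le_second_moments[OF V V2 \<phi> t(2) q(2)] small by linarith
    ultimately show ?thesis using n0[OF that] \<open>r > 0\<close> unfolding real_norm_def by linarith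
  qed
  then show "\<exists>n0. \<forall>n\<ge>n0. norm ((\<integral>\<omega>. \<phi> (W n \<omega>) \<partial>M) - (\<integral>\<omega>. \<phi> (V \<omega>) \<partial>N)) < r" by blast
qed

section \<open>Gaussian laws and the central limit theorem\<close>

text \<open>The definition of a Gaussian process supplies the parameters \<open>m\<close> and
  \<open>\<sigma>\<close> only existentially, so they are eliminated in favour of the moments of
  \<open>U\<close>. For \<open>\<sigma> = 0\<close> the variable is almost surely constant;
  otherwise it is an affine image of a standard normal one.\<close>

lemma (in prob_space)
  fixes U :: "'a \<Rightarrow> real"
  assumes U[measurable]: "U \<in> borel_measurable M"
    and law: "distr M borel U = gaussian_law m \<sigma>" and "\<sigma> \<ge> 0"
  shows gaussian_law_square_integrable: "integrable M (\<lambda>\<omega>. (U \<omega>)\<^sup>2)"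
    and gaussian_law_char: "expectation U = 0 \<Longrightarrow>
      (CLINT \<omega>|M. iexp (U \<omega>)) = complex_of_real (exp (- (\<integral>\<omega>. (U \<omega>)\<^sup>2 \<partial>M) / 2))"
proof -
  have "integrable M (\<lambda>\<omega>. (U \<omega>)\<^sup>2) \<and> (expectation U = 0 \<longrightarrow>
      (CLINT \<omega>|M. iexp (U \<omega>)) = complex_of_real (exp (- (\<integral>\<omega>. (U \<omega>)\<^sup>2 \<partial>M) / 2)))"
  proof (cases "\<sigma> = 0")
    case True
    then have "distr M borel U = return borel m" using law by (simp add: gaussian_law_def)
    moreover have "AE x in return borel m. x = m" by (simp add: AE_return)
    ultimately have "AE x in distr M borel U. x = m" by metis
    then have ae: "AE \<omega> in M. U \<omega> = m" by (simp add: AE_distr_iff)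
    have 1: "integrable M (\<lambda>\<omega>. (U \<omega>)\<^sup>2) = integrable M (\<lambda>\<omega>. m\<^sup>2)"
      using ae by (intro integrable_cong_AE) auto
    have 2: "expectation U = expectation (\<lambda>_. m)"
      "(\<integral>\<omega>. (U \<omega>)\<^sup>2 \<partial>M) = (\<integral>\<omega>. m\<^sup>2 \<partial>M)"
      "(CLINT \<omega>|M. iexp (U \<omega>)) = (CLINT \<omega>|M. iexp m)"
      by (rule integral_cong_AE, measurable, use ae in \<open>eventually_elim, simp\<close>)+
    show ?thesis
      unfolding 1 2 by (simp add: prob_space)
  next
    case False
    with \<open>\<sigma> \<ge> 0\<close> have \<sigma>: "\<sigma> > 0" by simp
    have "distr M lborel U = distr M borel U" by (rule distr_cong) auto
    then have D: "distributed M lborel U (normal_density m \<sigma>)"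
      using law False by (simp add: distributed_def gaussian_law_def)
    define S where "S \<omega> = (U \<omega> - m) / \<sigma>" for \<omega>
    have [measurable]: "S \<in> borel_measurable M" unfolding S_def by measurable
    have U_eq: "U = (\<lambda>\<omega>. \<sigma> * S \<omega> + m)" using \<sigma> by (auto simp: S_def)
    have DS: "distributed M lborel S std_normal_density"
      using D normal_standard_normal_convert[OF \<sigma>] by (simp add: S_def[abs_def])
    have i: "integrable M (\<lambda>\<omega>. (S \<omega>) ^ k)" for k
      using distributed_integrable[OF DS, of "\<lambda>x. x ^ k"] integrable_std_normal_moment[of k] by auto
    have i': "integrable M S" "integrable M (\<lambda>\<omega>. (S \<omega>)\<^sup>2)"
      using i[of 1] i[of 2] by auto
    have int: "integrable M (\<lambda>\<omega>. (U \<omega>)\<^sup>2)"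
      unfolding U_eq power2_sum using i' by (simp add: power_mult_distrib mult.assoc)
    have mean: "expectation U = m" by (rule normal_distributed_expectation[OF \<sigma> D])
    have var: "variance U = \<sigma>\<^sup>2" by (rule normal_distributed_variance[OF \<sigma> D])
    have "(CLINT \<omega>|M. iexp (U \<omega>)) = complex_of_real (exp (- (\<integral>\<omega>. (U \<omega>)\<^sup>2 \<partial>M) / 2))"
      if "expectation U = 0"
    proof -
      from that mean have m: "m = 0" by simp
      have "distr M borel S = distr M lborel S" by (rule distr_cong) auto
      then have dS: "distr M borel S = std_normal_distribution"
        using DS by (simp add: distributed_def)
      have "(CLINT \<omega>|M. iexp (U \<omega>)) = (CLINT \<omega>|M. iexp (\<sigma> * S \<omega>))"
        unfolding U_eq m by simp
      also have "\<dots> = char (distr M borel S) \<sigma>"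
        unfolding char_def by (subst integral_distr) auto
      also have "\<dots> = complex_of_real (exp (- (\<sigma>\<^sup>2) / 2))"
        unfolding dS char_std_normal_distribution by simp
      finally show ?thesis using var that by simp
    qed
    with int show ?thesis by blast
  qed
  then show "integrable M (\<lambda>\<omega>. (U \<omega>)\<^sup>2)"
    "expectation U = 0 \<Longrightarrow>
      (CLINT \<omega>|M. iexp (U \<omega>)) = complex_of_real (exp (- (\<integral>\<omega>. (U \<omega>)\<^sup>2 \<partial>M) / 2))"
    by blast+
qed

lemma integrable_mult_of_squares:
  fixes f g :: "'a \<Rightarrow> real"
  assumes [measurable]: "f \<in> borel_measurable M" "g \<in> borel_measurable M"
    and "integrable M (\<lambda>x. (f x)\<^sup>2)" "integrable M (\<lambda>x. (g x)\<^sup>2)"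
  shows "integrable M (\<lambda>x. f x * g x)"
proof (rule Bochner_Integration.integrable_bound)
  show "integrable M (\<lambda>x. (f x)\<^sup>2 + (g x)\<^sup>2)" using assms by simp
  have "\<bar>a * b\<bar> \<le> a\<^sup>2 + b\<^sup>2" for a b :: real
    using sum_squares_bound[of "\<bar>a\<bar>" "\<bar>b\<bar>"] abs_ge_zero[of "a * b"] unfolding abs_mult power2_abs by linarith
  then show "AE x in M. norm (f x * g x) \<le> norm ((f x)\<^sup>2 + (g x)\<^sup>2)" by simp
qed measurable

text \<open>Used on both sides of the central limit theorem, for the Gaussian coordinates and for
  the functions in \<open>L2 P\<close>, so that the two variances appear as the same quadratic form
  in the covariances.\<close>

lemma integrable_integral_square_sum:
  fixes f :: "'i \<Rightarrow> 'a \<Rightarrow> real"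
  assumes m: "\<And>i. i \<in> I \<Longrightarrow> f i \<in> borel_measurable M"
    and i: "\<And>i. i \<in> I \<Longrightarrow> integrable M (\<lambda>x. (f i x)\<^sup>2)"
  shows "integrable M (\<lambda>x. (\<Sum>i\<in>I. a i * f i x)\<^sup>2)"
    and "(\<integral>x. (\<Sum>i\<in>I. a i * f i x)\<^sup>2 \<partial>M) = (\<Sum>i\<in>I. \<Sum>j\<in>I. a i * a j * (\<integral>x. f i x * f j x \<partial>M))"
proof -
  have p: "integrable M (\<lambda>x. f i x * f j x)" if "i \<in> I" "j \<in> I" for i j
    using m i that by (intro integrable_mult_of_squares) auto
  have eq: "(\<Sum>i\<in>I. a i * f i x)\<^sup>2 = (\<Sum>i\<in>I. \<Sum>j\<in>I. a i * a j * (f i x * f j x))" for x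
    unfolding power2_eq_square sum_product by (simp add: mult_ac)
  show "integrable M (\<lambda>x. (\<Sum>i\<in>I. a i * f i x)\<^sup>2)"
    unfolding eq using p by (intro Bochner_Integration.integrable_sum integrable_mult_right)
  have "(\<integral>x. (\<Sum>i\<in>I. a i * f i x)\<^sup>2 \<partial>M) = (\<Sum>i\<in>I. (\<integral>x. (\<Sum>j\<in>I. a i * a j * (f i x * f j x)) \<partial>M))"
    unfolding eq using p by (intro Bochner_Integration.integral_sum Bochner_Integration.integrable_sum integrable_mult_right)
  also have "\<dots> = (\<Sum>i\<in>I. \<Sum>j\<in>I. a i * a j * (\<integral>x. f i x * f j x \<partial>M))"
    using p by (intro sum.cong refl, subst Bochner_Integration.integral_sum) auto
  finally show "(\<integral>x. (\<Sum>i\<in>I. a i * f i x)\<^sup>2 \<partial>M) = (\<Sum>i\<in>I. \<Sum>j\<in>I. a i * a j * (\<integral>x. f i x * f j x \<partial>M))" .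
qed

lemma (in prob_space) gaussian_process_square_integrable:
  assumes "centered_gaussian_process M T cov G" and "t \<in> T"
  shows "integrable M (\<lambda>\<omega>. (G t \<omega>)\<^sup>2)"
proof -
  have "G t \<in> borel_measurable M" using assms by (auto simp: centered_gaussian_process_def)
  moreover have "\<exists>m. \<exists>\<sigma>\<ge>0. distr M borel (\<lambda>\<omega>. \<Sum>s\<in>{t}. 1 * G s \<omega>) = gaussian_law m \<sigma>"
    using assms(1)[unfolded centered_gaussian_process_def, THEN conjunct2, THEN conjunct1,
        rule_format, of "{t}" "\<lambda>_. 1"] assms(2) by simp
  then obtain m \<sigma> where "\<sigma> \<ge> 0" "distr M borel (G t) = gaussian_law m \<sigma>" by auto
  ultimately show ?thesis by (intro gaussian_law_square_integrable)
qed

lemma (in prob_space) gaussian_process_char: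
  fixes g :: "nat \<Rightarrow> 't"
  assumes gp: "centered_gaussian_process M T cov G" and g: "\<And>j. g j \<in> T"
  shows "(CLINT \<omega>|M. iexp (\<Sum>j<k. a j * G (g j) \<omega>)) =
    complex_of_real (exp (- (\<Sum>i<k. \<Sum>j<k. a i * a j * cov (g i) (g j)) / 2))"
proof -
  let ?U = "\<lambda>\<omega>. \<Sum>j<k. a j * G (g j) \<omega>"
  let ?J = "g ` {..<k}"
  \<comment> \<open>\<open>g\<close> may repeat an index, as an enumeration of a finite set by all
    naturals must, while joint Gaussianity is stated for finite sets of indices. So the coefficients
    of equal indices are collected.\<close>
  define b where "b t = (\<Sum>j | j < k \<and> g j = t. a j)" for t
  have "(\<Sum>t\<in>?J. b t * G t \<omega>) = ?U \<omega>" for \<omega>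
  proof -
    have "(\<Sum>t\<in>?J. b t * G t \<omega>) = (\<Sum>t\<in>?J. \<Sum>j\<in>{j\<in>{..<k}. g j = t}. a j * G (g j) \<omega>)"
      by (auto simp: b_def sum_distrib_right intro!: sum.cong)
    also have "\<dots> = ?U \<omega>" by (rule sum.image_gen[symmetric]) simp
    finally show ?thesis .
  qed
  moreover have "finite ?J" "?J \<subseteq> T" using g by auto
  then have "\<exists>m. \<exists>\<sigma>\<ge>0. distr M borel (\<lambda>\<omega>. \<Sum>t\<in>?J. b t * G t \<omega>) = gaussian_law m \<sigma>"
    by (rule gp[unfolded centered_gaussian_process_def, THEN conjunct2, THEN conjunct1, rule_format])
  ultimately obtain m \<sigma> where \<sigma>: "\<sigma> \<ge> 0" "distr M borel ?U = gaussian_law m \<sigma>" by auto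
  have Gm[measurable]: "G (g j) \<in> borel_measurable M" for j
    using gp g by (auto simp: centered_gaussian_process_def)
  have G2: "integrable M (\<lambda>\<omega>. (G (g j) \<omega>)\<^sup>2)" for j
    by (rule gaussian_process_square_integrable[OF gp g])
  have "integrable M (G (g j))" for j
    using square_integrable_imp_integrable[OF Gm G2] .
  then have "expectation ?U = (\<Sum>j<k. a j * expectation (G (g j)))" by simp
  also have "\<dots> = 0" using gp g by (simp add: centered_gaussian_process_def)
  finally have "(CLINT \<omega>|M. iexp (?U \<omega>)) = complex_of_real (exp (- (\<integral>\<omega>. (?U \<omega>)\<^sup>2 \<partial>M) / 2))"
    using \<sigma> by (intro gaussian_law_char) auto
  also have "(\<integral>\<omega>. (?U \<omega>)\<^sup>2 \<partial>M) = (\<Sum>i<k. \<Sum>j<k. a i * a j * cov (g i) (g j))"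
    using gp g by (subst integrable_integral_square_sum(2)[OF Gm G2]) (simp add: centered_gaussian_process_def)
  finally show ?thesis .
qed

section \<open>Independent samples and the one-dimensional central limit theorem\<close>

locale iid_sample = M: prob_space M + P: prob_space P
  for M :: "'b measure" and P :: "'a measure" +
  fixes X :: "nat \<Rightarrow> 'b \<Rightarrow> 'a"
  assumes indep: "M.indep_vars (\<lambda>_. P) X UNIV"
    and law: "\<And>i. distr M P (X i) = P"
begin

lemma X_measurable[measurable]: "X i \<in> measurable M P"
  using indep by (auto simp: M.indep_vars_def)

lemma sample_integrable: "integrable P h \<Longrightarrow> integrable M (\<lambda>\<omega>. h (X i \<omega>))" for h :: "'a \<Rightarrow> real"
  by (rule integrable_distr[OF X_measurable]) (simp add: law)

lemma sample_integral:
  fixes h :: "'a \<Rightarrow> real"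
  assumes "h \<in> borel_measurable P"
  shows "(\<integral>\<omega>. h (X i \<omega>) \<partial>M) = (\<integral>x. h x \<partial>P)"
  using integral_distr[OF X_measurable assms, of i] by (simp add: law)

lemma sample_AE: "AE x in P. Q x \<Longrightarrow> AE \<omega> in M. Q (X i \<omega>)"
  using AE_distrD[OF X_measurable[of i], of Q] unfolding law .

lemma sample_indep:
  assumes "h \<in> borel_measurable P"
  shows "M.indep_vars (\<lambda>_. borel) (\<lambda>i \<omega>. h (X i \<omega>)) UNIV"
  using M.indep_vars_compose2[OF indep, of "\<lambda>_. h"] assms by simp

lemma emp_mean_measurable[measurable]:
  assumes [measurable]: "h \<in> borel_measurable P"
  shows "(\<lambda>\<omega>. emp_mean n (\<lambda>i. X i \<omega>) h) \<in> borel_measurable M"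
  unfolding emp_mean_def by measurable

text \<open>Induction on \<open>n\<close>: the new summand is independent of the partial sum and
  centred, so the cross term has mean zero.\<close>

lemma sample_sum_second_moment:
  fixes h :: "'a \<Rightarrow> real"
  assumes h[measurable]: "h \<in> borel_measurable P" and h2: "integrable P (\<lambda>x. (h x)\<^sup>2)"
    and h0: "(\<integral>x. h x \<partial>P) = 0"
  shows "integrable M (\<lambda>\<omega>. (\<Sum>i<n. h (X i \<omega>))\<^sup>2) \<and>
    (\<integral>\<omega>. (\<Sum>i<n. h (X i \<omega>))\<^sup>2 \<partial>M) = real n * (\<integral>x. (h x)\<^sup>2 \<partial>P)"
proof (induction n)
  case (Suc n)
  let ?S = "\<lambda>\<omega>. \<Sum>i<n. h (X i \<omega>)"
  have ih: "integrable P h" using P.square_integrable_imp_integrable[OF h h2] .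
  have i1: "integrable M (\<lambda>\<omega>. h (X n \<omega>))" "integrable M (\<lambda>\<omega>. (h (X n \<omega>))\<^sup>2)" "integrable M ?S"
    using sample_integrable[OF ih] sample_integrable[OF h2] by auto
  have v: "M.indep_var borel (\<lambda>\<omega>. h (X n \<omega>)) borel ?S"
    by (rule M.indep_vars_sum) (auto intro: M.indep_vars_subset[OF sample_indep[OF h]])
  have i2: "integrable M (\<lambda>\<omega>. h (X n \<omega>) * ?S \<omega>)"
    "(\<integral>\<omega>. h (X n \<omega>) * ?S \<omega> \<partial>M) = 0"
    using M.indep_var_integrable[OF v i1(1,3)] M.indep_var_lebesgue_integral[OF v i1(1,3)]
    by (simp_all add: sample_integral h0)
  have "(\<Sum>i<Suc n. h (X i \<omega>))\<^sup>2 = (?S \<omega>)\<^sup>2 + (h (X n \<omega>))\<^sup>2 + 2 * (h (X n \<omega>) * ?S \<omega>)" for \<omega>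
    by (simp add: power2_sum)
  then show ?case
    using Suc i1 i2 sample_integral[of "\<lambda>x. (h x)\<^sup>2" n] by (simp add: algebra_simps)
qed simp

lemma scaled_emp_mean: "sqrt (real n) * emp_mean n x h = (\<Sum>i<n. h (x i)) / sqrt (real n)"
  by (cases "n = 0") (simp_all add: emp_mean_def field_simps)

lemma scaled_emp_mean_second_moment:
  fixes h :: "'a \<Rightarrow> real"
  assumes "h \<in> borel_measurable P" "integrable P (\<lambda>x. (h x)\<^sup>2)" "(\<integral>x. h x \<partial>P) = 0"
  shows "integrable M (\<lambda>\<omega>. (sqrt (real n) * emp_mean n (\<lambda>i. X i \<omega>) h)\<^sup>2)"
    "(\<integral>\<omega>. (sqrt (real n) * emp_mean n (\<lambda>i. X i \<omega>) h)\<^sup>2 \<partial>M) \<le> (\<integral>x. (h x)\<^sup>2 \<partial>P)"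
  using sample_sum_second_moment[OF assms, of n]
  by (auto simp: scaled_emp_mean power_divide)

text \<open>The central limit theorem divides by the standard deviation, so a function of zero
  variance is treated apart: there the process is almost surely zero. Otherwise the characteristic
  function of the normalised sum is evaluated at \<open>\<sigma>\<close>, which undoes the
  normalisation.\<close>

lemma emp_process_char_tendsto:
  fixes h :: "'a \<Rightarrow> real"
  assumes h[measurable]: "h \<in> borel_measurable P" and h2: "integrable P (\<lambda>x. (h x)\<^sup>2)"
    and h0: "(\<integral>x. h x \<partial>P) = 0"
  shows "(\<lambda>n. CLINT \<omega>|M. iexp (sqrt (real n) * emp_mean n (\<lambda>i. X i \<omega>) h))
    \<longlonglongrightarrow> complex_of_real (exp (- (\<integral>x. (h x)\<^sup>2 \<partial>P) / 2))"
proof (cases "(\<integral>x. (h x)\<^sup>2 \<partial>P) = 0")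
  case True
  then have "AE x in P. h x = 0"
    using integral_nonneg_eq_0_iff_AE[OF h2] by simp
  then have "AE \<omega> in M. \<forall>i. h (X i \<omega>) = 0" by (auto simp: AE_all_countable intro: sample_AE)
  then have "AE \<omega> in M. iexp (sqrt (real n) * emp_mean n (\<lambda>i. X i \<omega>) h) = 1" for n
    by eventually_elim (simp add: emp_mean_def)
  then have "(CLINT \<omega>|M. iexp (sqrt (real n) * emp_mean n (\<lambda>i. X i \<omega>) h)) = (CLINT \<omega>|M. 1)" for n
    by (intro integral_cong_AE) auto
  then show ?thesis using True by (simp add: M.prob_space)
next
  case False
  define \<sigma> where "\<sigma> = sqrt (\<integral>x. (h x)\<^sup>2 \<partial>P)"
  have "(\<integral>x. (h x)\<^sup>2 \<partial>P) > 0" using False by (simp add: less_le)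
  then have \<sigma>: "\<sigma> > 0" "\<sigma>\<^sup>2 = (\<integral>x. (h x)\<^sup>2 \<partial>P)" by (auto simp: \<sigma>_def)
  have "distr M borel (\<lambda>\<omega>. h (X i \<omega>)) = distr P borel h" for i
    using distr_distr[OF h X_measurable, of i] by (simp add: law comp_def)
  then have "weak_conv_m (\<lambda>n. distr M borel (\<lambda>\<omega>. (\<Sum>i<n. h (X i \<omega>)) / sqrt (real n * \<sigma>\<^sup>2))) std_normal_distribution"
    using sample_integrable[OF h2] \<sigma> h0
    by (intro M.central_limit_theorem_zero_mean[OF sample_indep[OF h]])
       (auto simp: sample_integral sample_integral[of "\<lambda>x. (h x)\<^sup>2"])
  then have "(\<lambda>n. char (distr M borel (\<lambda>\<omega>. (\<Sum>i<n. h (X i \<omega>)) / sqrt (real n * \<sigma>\<^sup>2))) \<sigma>)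
      \<longlonglongrightarrow> char std_normal_distribution \<sigma>"
    by (intro levy_continuity1 M.real_distribution_distr real_dist_normal_dist) auto
  moreover have "char (distr M borel (\<lambda>\<omega>. (\<Sum>i<n. h (X i \<omega>)) / sqrt (real n * \<sigma>\<^sup>2))) \<sigma>
      = (CLINT \<omega>|M. iexp (sqrt (real n) * emp_mean n (\<lambda>i. X i \<omega>) h))" for n
    unfolding char_def scaled_emp_mean using \<sigma>(1)
    by (subst integral_distr) (auto simp: real_sqrt_mult simp del: of_real_divide of_real_sum)
  ultimately show ?thesis
    unfolding char_std_normal_distribution \<sigma>(2) by simp
qed

end

section \<open>Truncation in $L_2$\<close>

lemma l2norm_nonneg [simp]: "0 \<le> l2norm P f"
  by (simp add: l2norm_def)

lemma l2norm_power2 [simp]: "(l2norm P f)\<^sup>2 = (\<integral>x. (f x)\<^sup>2 \<partial>P)"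
  by (simp add: l2norm_def)

lemma L2_measurable: "f \<in> L2 P \<Longrightarrow> f \<in> borel_measurable P"
  and L2_integrable: "f \<in> L2 P \<Longrightarrow> integrable P (\<lambda>x. (f x)\<^sup>2)"
  by (simp_all add: L2_def)

lemma square_diff_le: "(a - b)\<^sup>2 \<le> 2 * a\<^sup>2 + 2 * (b::real)\<^sup>2"
  using zero_le_power2[of "a + b"] by (simp add: power2_sum power2_diff)

lemma L2_diff:
  assumes "f \<in> L2 P" "g \<in> L2 P"
  shows "(\<lambda>x. f x - g x) \<in> L2 P"
proof -
  note [measurable] = assms[THEN L2_measurable]
  have "integrable P (\<lambda>x. (f x - g x)\<^sup>2)"
  proof (rule Bochner_Integration.integrable_bound)
    show "integrable P (\<lambda>x. 2 * (f x)\<^sup>2 + 2 * (g x)\<^sup>2)"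
      using assms[THEN L2_integrable] by simp
  qed (auto intro!: AE_I2 square_diff_le)
  then show ?thesis by (simp add: L2_def)
qed

text \<open>The factor 2 spares the Cauchy-Schwarz inequality; constants do not matter in the chaining bounds.\<close>

lemma l2norm_diff_le:
  assumes "f \<in> L2 P" "g \<in> L2 P"
  shows "l2norm P (\<lambda>x. f x - g x) \<le> 2 * (l2norm P f + l2norm P g)"
proof (rule power2_le_imp_le)
  have "(l2norm P (\<lambda>x. f x - g x))\<^sup>2 \<le> (\<integral>x. 2 * (f x)\<^sup>2 + 2 * (g x)\<^sup>2 \<partial>P)"
    unfolding l2norm_power2
    using L2_integrable[OF L2_diff[OF assms]] assms[THEN L2_integrable]
    by (intro integral_mono square_diff_le) auto
  also have "\<dots> = 2 * (l2norm P f)\<^sup>2 + 2 * (l2norm P g)\<^sup>2"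
    using assms[THEN L2_integrable] by simp
  also have "\<dots> \<le> (2 * (l2norm P f + l2norm P g))\<^sup>2"
    unfolding power_mult_distrib power2_sum using mult_nonneg_nonneg[OF l2norm_nonneg[of P f] l2norm_nonneg[of P g]]
      zero_le_power2[of "l2norm P f"] zero_le_power2[of "l2norm P g"] by (simp del: l2norm_power2)
  finally show "(l2norm P (\<lambda>x. f x - g x))\<^sup>2 \<le> (2 * (l2norm P f + l2norm P g))\<^sup>2" .
qed simp

lemma trunc_measurable [measurable (raw)]:
  assumes [measurable]: "h \<in> borel_measurable P"
  shows "trunc l h \<in> borel_measurable P"
  unfolding trunc_def by measurable

lemma abs_trunc_le: "l \<ge> 0 \<Longrightarrow> \<bar>trunc l h x\<bar> \<le> l" "\<bar>trunc l h x\<bar> \<le> \<bar>h x\<bar>"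
  by (auto simp: trunc_def)

text \<open>Where the truncation acts, \<open>l\<close> is less than \<open>\<bar>h x\<bar>\<close>.
  The indicator is kept for the limit in \<open>n\<close>, where the integral over the shrinking set
  matters; for the bound at fixed \<open>n\<close> it is estimated by 1.\<close>

lemma abs_diff_trunc_le: "l > 0 \<Longrightarrow> l * \<bar>h x - trunc l h x\<bar> \<le> (h x)\<^sup>2 * indicator {x. \<bar>h x\<bar> > l} x"
proof (cases "\<bar>h x\<bar> > l")
  case True
  then have "l * \<bar>h x\<bar> \<le> \<bar>h x\<bar> * \<bar>h x\<bar>" by (intro mult_right_mono) auto
  then show ?thesis using True by (simp add: trunc_def power2_eq_square)
qed (auto simp: trunc_def)

context prob_space
begin

lemma L2_trunc_integrable:
  assumes "h \<in> L2 M"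
  shows "integrable M h" "integrable M (trunc l h)" "integrable M (\<lambda>x. \<bar>h x - trunc l h x\<bar>)"
proof -
  note [measurable] = L2_measurable[OF assms]
  show 1: "integrable M h"
    using square_integrable_imp_integrable[OF L2_measurable L2_integrable] assms by blast
  show 2: "integrable M (trunc l h)"
    by (rule Bochner_Integration.integrable_bound[OF 1]) (auto intro!: AE_I2 abs_trunc_le)
  show "integrable M (\<lambda>x. \<bar>h x - trunc l h x\<bar>)"
    using 1 2 by simp
qed

lemma L2_null_AE:
  assumes "h \<in> L2 M" "l2norm M h = 0"
  shows "AE x in M. h x = 0"
proof -
  have "(\<integral>x. (h x)\<^sup>2 \<partial>M) = 0" using assms(2) l2norm_power2[of M h] by simp
  then show ?thesis using integral_nonneg_eq_0_iff_AE[OF L2_integrable[OF assms(1)]] by simp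
qed

text \<open>The truncation levels are proportional to the norm, so a null function gets level zero
  and one cannot divide by the level. But it vanishes almost everywhere, and the value 0 survives
  truncation at any level.\<close>

lemma integral_diff_trunc_null:
  assumes "h \<in> L2 M" "l2norm M h = 0" "l \<ge> 0"
  shows "(\<integral>x. \<bar>h x - trunc l h x\<bar> \<partial>M) = 0"
proof -
  note [measurable] = L2_measurable[OF assms(1)]
  have "(\<integral>x. \<bar>h x - trunc l h x\<bar> \<partial>M) = (\<integral>x. 0 \<partial>M)"
    using L2_null_AE[OF assms(1,2)]
    by (intro integral_cong_AE, measurable, eventually_elim) (auto simp: trunc_def)
  then show ?thesis by simp
qed

text \<open>The part cut off has mean at most the squared norm divided by the level; as the level is
  \<open>k\<close> times the norm, one factor of the norm cancels.\<close>

lemma integral_diff_trunc_le: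
  assumes h: "h \<in> L2 M" and k: "k > 0"
  shows "k * (\<integral>x. \<bar>h x - trunc (k * l2norm M h) h x\<bar> \<partial>M) \<le> l2norm M h"
proof (cases "l2norm M h = 0")
  case True
  then show ?thesis using integral_diff_trunc_null[OF h True, of 0] by simp
next
  case False
  then have pos: "l2norm M h > 0" by (simp add: less_le)
  then have l: "k * l2norm M h > 0" using k by simp
  have "k * l2norm M h * (\<integral>x. \<bar>h x - trunc (k * l2norm M h) h x\<bar> \<partial>M)
      = (\<integral>x. k * l2norm M h * \<bar>h x - trunc (k * l2norm M h) h x\<bar> \<partial>M)" by simp
  also have "\<dots> \<le> (\<integral>x. (h x)\<^sup>2 \<partial>M)"
    by (intro integral_mono integrable_mult_right L2_trunc_integrable L2_integrable h
          order_trans[OF abs_diff_trunc_le[OF l]]) (auto simp: indicator_def)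
  also have "\<dots> = l2norm M h * l2norm M h"
    using l2norm_power2[of M h] by (simp only: power2_eq_square)
  finally show ?thesis using pos by simp
qed

text \<open>The factor \<open>sqrt (real n)\<close> is absorbed by the level, which leaves a
  multiple of the integral of \<open>h\<^sup>2\<close> over the set where
  \<open>\<bar>h\<bar>\<close> exceeds \<open>c * sqrt (real n)\<close>. Square integrability is
  just what dominated convergence needs.\<close>

lemma sqrt_integral_diff_trunc_tendsto:
  assumes h: "h \<in> L2 M" and k: "k > 0"
  shows "(\<lambda>n. sqrt (real n) * (\<integral>x. \<bar>h x - trunc (k * sqrt (real n) * l2norm M h) h x\<bar> \<partial>M)) \<longlonglongrightarrow> 0"
proof (cases "l2norm M h = 0")
  case True
  then show ?thesis using integral_diff_trunc_null[OF h True, of 0] by simp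
next
  case False
  note [measurable] = L2_measurable[OF h]
  define c where "c = k * l2norm M h"
  have c: "c > 0" using False k by (simp add: c_def less_le)
  let ?q = "\<lambda>n x. (h x)\<^sup>2 * indicator {x. \<bar>h x\<bar> > c * sqrt (real n)} x"
  have "(\<lambda>n. \<integral>x. ?q n x \<partial>M) \<longlonglongrightarrow> (\<integral>x. 0 \<partial>M)"
  proof (rule integral_dominated_convergence[where w = "\<lambda>x. (h x)\<^sup>2"])
    have "(\<lambda>n. ?q n x) \<longlonglongrightarrow> 0" for x
    proof (rule tendsto_eventually)
      have "filterlim (\<lambda>n. c * sqrt (real n)) at_top sequentially"
        using c by (intro filterlim_tendsto_pos_mult_at_top[OF tendsto_const] filterlim_compose[OF sqrt_at_top filterlim_real_sequentially])
      then have "\<forall>\<^sub>F n in sequentially. \<bar>h x\<bar> \<le> c * sqrt (real n)"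
        by (auto simp: filterlim_at_top)
      then show "\<forall>\<^sub>F n in sequentially. ?q n x = 0" by eventually_elim auto
    qed
    then show "AE x in M. (\<lambda>n. ?q n x) \<longlonglongrightarrow> 0" by simp
  qed (use L2_integrable[OF h] in \<open>auto simp: indicator_def\<close>)
  then have lim: "(\<lambda>n. (\<integral>x. ?q n x \<partial>M) / c) \<longlonglongrightarrow> 0"
    using tendsto_divide_zero[of "\<lambda>n. \<integral>x. ?q n x \<partial>M"] by simp
  show ?thesis
  proof (rule tendsto_sandwich[OF _ _ tendsto_const lim])
    show "\<forall>\<^sub>F n in sequentially. sqrt (real n) * (\<integral>x. \<bar>h x - trunc (k * sqrt (real n) * l2norm M h) h x\<bar> \<partial>M)
        \<le> (\<integral>x. ?q n x \<partial>M) / c"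
      using eventually_gt_at_top[of 0]
    proof eventually_elim
      case (elim n)
      have l: "c * sqrt (real n) > 0" using c elim by simp
      have "integrable M (?q n)"
        by (rule Bochner_Integration.integrable_bound[OF L2_integrable[OF h]]) (auto simp: indicator_def)
      then have "(\<integral>x. c * sqrt (real n) * \<bar>h x - trunc (c * sqrt (real n)) h x\<bar> \<partial>M) \<le> (\<integral>x. ?q n x \<partial>M)"
        by (intro integral_mono integrable_mult_right L2_trunc_integrable(3)[OF h] abs_diff_trunc_le l)
      then have "c * (sqrt (real n) * (\<integral>x. \<bar>h x - trunc (c * sqrt (real n)) h x\<bar> \<partial>M)) \<le> (\<integral>x. ?q n x \<partial>M)"
        by (simp add: mult.assoc)
      moreover have "k * sqrt (real n) * l2norm M h = c * sqrt (real n)" by (simp add: c_def)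
      ultimately show ?case
        using c by (simp only: pos_le_divide_eq) (simp add: mult.commute)
    qed
  qed (auto intro!: always_eventually mult_nonneg_nonneg integral_nonneg)
qed

end

section \<open>Chaining\<close>

text \<open>This is \<^const>\<open>trunc_level\<close> as a function of the increment instead of \<open>f\<close>:
  there are only finitely many increments for each \<open>s\<close>.\<close>

definition incr_level :: "real \<Rightarrow> 'a measure \<Rightarrow> nat \<Rightarrow> nat \<Rightarrow> ('a \<Rightarrow> real) \<Rightarrow> real" where
  "incr_level c0 P n s h = c0 / 2 powr (real s / 2) * sqrt (real n) * l2norm P h"

lemma trunc_incr_eq: "trunc_incr c0 P \<pi> n s f = trunc (incr_level c0 P n s (incr \<pi> s f)) (incr \<pi> s f)"
  by (simp add: trunc_incr_def trunc_level_def incr_level_def)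

lemma incr_level_nonneg: "c0 \<ge> 0 \<Longrightarrow> 0 \<le> incr_level c0 P n s h"
  by (simp add: incr_level_def)

lemma emp_mean_abs_le:
  assumes "\<And>x. \<bar>g x\<bar> \<le> h x"
  shows "\<bar>emp_mean n y g\<bar> \<le> emp_mean n y h"
proof -
  have "\<bar>\<Sum>i<n. g (y i)\<bar> \<le> (\<Sum>i<n. h (y i))"
    using assms by (intro order_trans[OF sum_abs] sum_mono)
  then show ?thesis
    unfolding emp_mean_def abs_divide by (simp add: divide_right_mono)
qed

lemma emp_mean_diff: "emp_mean n y (\<lambda>x. f x - g x) = emp_mean n y f - emp_mean n y g"
  by (simp add: emp_mean_def sum_subtractf diff_divide_distrib)

lemma emp_mean_sum: "emp_mean n y (\<lambda>x. \<Sum>s\<in>S. f s x) = (\<Sum>s\<in>S. emp_mean n y (f s))"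
  unfolding emp_mean_def by (subst sum.swap) (simp add: sum_divide_distrib)

lemma emp_mean_suminf:
  assumes "\<And>x. summable (\<lambda>s. f s x)"
  shows "summable (\<lambda>s. emp_mean n y (f s))" "emp_mean n y (\<lambda>x. \<Sum>s. f s x) = (\<Sum>s. emp_mean n y (f s))"
proof -
  have s: "summable (\<lambda>s. \<Sum>i<n. f s (y i))" using assms by (intro summable_sum)
  then show "summable (\<lambda>s. emp_mean n y (f s))"
    unfolding emp_mean_def by (rule summable_divide)
  show "emp_mean n y (\<lambda>x. \<Sum>s. f s x) = (\<Sum>s. emp_mean n y (f s))"
    unfolding emp_mean_def suminf_divide[OF s] by (subst suminf_sum) (auto intro: assms)
qed

lemma emp_mean_const_le:
  assumes "\<And>x. \<bar>g x\<bar> \<le> c"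
  shows "\<bar>emp_mean n y g\<bar> \<le> c"
proof -
  have "c \<ge> 0" using assms[of undefined] by simp
  have "\<bar>emp_mean n y g\<bar> \<le> emp_mean n y (\<lambda>_. c)" by (rule emp_mean_abs_le) (rule assms)
  also have "\<dots> \<le> c" using \<open>c \<ge> 0\<close> by (simp add: emp_mean_def)
  finally show ?thesis .
qed

text \<open>\<open>tail\<close> is property (B). The sample is not part of the locale, so that the
  pathwise estimates hold for arbitrary points \<open>y\<close>.\<close>

locale chaining = prob_space P for P :: "'a measure" +
  fixes F :: "('a \<Rightarrow> real) set" and Fs :: "nat \<Rightarrow> ('a \<Rightarrow> real) set"
    and \<pi> :: "nat \<Rightarrow> ('a \<Rightarrow> real) \<Rightarrow> 'a \<Rightarrow> real" and c0 :: real
  assumes F: "F \<subseteq> L2 P" and adm: "admissible F Fs" and near: "nearest_maps P F Fs \<pi>"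
    and c0: "c0 > 0"
    and tail: "(\<lambda>s0. SUP f\<in>F. \<Sum>s. ennreal (2 powr (real (s + s0) / 2) * l2dist P f (\<pi> (s + s0) f)))
       \<longlonglongrightarrow> 0"
    and centred: "\<And>f. f \<in> F \<Longrightarrow> (\<integral>x. f x \<partial>P) = 0"
begin

lemma pi_in: "f \<in> F \<Longrightarrow> \<pi> s f \<in> Fs s"
  using near by (simp add: nearest_maps_def)

lemma Fs: "Fs s \<subseteq> F" "finite (Fs s)" "Fs s \<noteq> {}"
  using adm by (simp_all add: admissible_def)

lemma F_nonempty: "F \<noteq> {}"
  using Fs by blast

lemma pi_F: "f \<in> F \<Longrightarrow> \<pi> s f \<in> F"
  using pi_in Fs(1) by blast

lemma finite_incr: "finite (incr \<pi> s ` F)"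
proof (rule finite_subset)
  show "incr \<pi> s ` F \<subseteq> (\<lambda>(g, h) x. g x - h x) ` (Fs s \<times> Fs (s - 1))"
    using pi_in by (fastforce simp: incr_def image_iff)
qed (use Fs in auto)

lemma incr_L2: "f \<in> F \<Longrightarrow> incr \<pi> s f \<in> L2 P"
  unfolding incr_def using F pi_F by (intro L2_diff) auto

lemma incr_integral: "f \<in> F \<Longrightarrow> (\<integral>x. incr \<pi> s f x \<partial>P) = 0"
  unfolding incr_def using F pi_F L2_trunc_integrable(1) centred
  by (subst Bochner_Integration.integral_diff) auto

section \<open>Uniform summability of the chain\<close>

text \<open>The common scale of the deviation bound and of the truncation bias. The index is shifted
  by one because the chain starts with the increment at level 1 and series start at 0.\<close>

definition weight :: "('a \<Rightarrow> real) \<Rightarrow> nat \<Rightarrow> real" where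
  "weight f s = 2 powr (real (Suc s) / 2) * l2norm P (incr \<pi> (Suc s) f)"

lemma weight_nonneg: "0 \<le> weight f s"
  by (simp add: weight_def)

text \<open>Property (B) bounds extended-real sums; once such a sum is finite, the real series
  converges to the same value. From here on all sums are real.\<close>

lemma approximation_tail:
  assumes "e > 0"
  shows "\<exists>S. \<forall>s0\<ge>S. \<forall>f\<in>F. summable (\<lambda>s. 2 powr (real (s + s0) / 2) * l2dist P f (\<pi> (s + s0) f)) \<and>
    (\<Sum>s. 2 powr (real (s + s0) / 2) * l2dist P f (\<pi> (s + s0) f)) \<le> e"
proof -
  let ?v = "\<lambda>f s. 2 powr (real s / 2) * l2dist P f (\<pi> s f)"
  have v: "?v f s \<ge> 0" for f s by (simp add: l2dist_def)
  have "\<forall>\<^sub>F s0 in sequentially. (SUP f\<in>F. \<Sum>s. ennreal (?v f (s + s0))) < ennreal e"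
    using order_tendstoD(2)[OF tail] assms by simp
  then obtain S where S: "\<And>s0. s0 \<ge> S \<Longrightarrow> (SUP f\<in>F. \<Sum>s. ennreal (?v f (s + s0))) < ennreal e"
    by (auto simp: eventually_sequentially)
  have "summable (\<lambda>s. ?v f (s + s0)) \<and> (\<Sum>s. ?v f (s + s0)) \<le> e" if "s0 \<ge> S" "f \<in> F" for s0 f
  proof -
    have "(\<Sum>s. ennreal (?v f (s + s0))) \<le> (SUP f\<in>F. \<Sum>s. ennreal (?v f (s + s0)))"
      using \<open>f \<in> F\<close> by (rule SUP_upper)
    then have le: "(\<Sum>s. ennreal (?v f (s + s0))) < ennreal e" using S[OF \<open>s0 \<ge> S\<close>] by simp
    then have nt: "(\<Sum>s. ennreal (?v f (s + s0))) \<noteq> top" using order_less_trans top.not_eq_extremum by force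
    have sv: "summable (\<lambda>s. ?v f (s + s0))" by (rule summable_suminf_not_top[OF v nt])
    moreover have "ennreal (\<Sum>s. ?v f (s + s0)) < ennreal e"
      using le suminf_ennreal[OF v nt] by simp
    moreover have "0 \<le> (\<Sum>s. ?v f (s + s0))" by (rule suminf_nonneg) (fact sv v)+
    ultimately show ?thesis using sv by (simp only: ennreal_less_iff less_imp_le simp_thms)
  qed
  then show ?thesis by blast
qed

text \<open>The distance is at most the first term of the tail series, because
  \<open>2 powr (real s / 2) \<ge> 1\<close>.\<close>

lemma l2dist_uniform:
  assumes "e > 0"
  shows "\<exists>S. \<forall>s\<ge>S. \<forall>f\<in>F. l2dist P f (\<pi> s f) < e"
proof -
  obtain S where S: "\<And>s0 f. s0 \<ge> S \<Longrightarrow> f \<in> F \<Longrightarrow> summable (\<lambda>s. 2 powr (real (s + s0) / 2) * l2dist P f (\<pi> (s + s0) f)) \<and>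
    (\<Sum>s. 2 powr (real (s + s0) / 2) * l2dist P f (\<pi> (s + s0) f)) \<le> e / 2"
    using approximation_tail[of "e / 2"] assms by auto
  have "l2dist P f (\<pi> s0 f) < e" if "s0 \<ge> S" "f \<in> F" for s0 f
  proof -
    have "l2dist P f (\<pi> s0 f) \<le> 2 powr (real s0 / 2) * l2dist P f (\<pi> s0 f)"
      using mult_right_mono[of 1 "(2::real) powr (real s0 / 2)" "l2dist P f (\<pi> s0 f)"]
      by (simp add: ge_one_powr_ge_zero l2dist_def)
    also have "\<dots> = (\<Sum>s\<in>{0}. 2 powr (real (s + s0) / 2) * l2dist P f (\<pi> (s + s0) f))" by simp
    also have "\<dots> \<le> (\<Sum>s. 2 powr (real (s + s0) / 2) * l2dist P f (\<pi> (s + s0) f))"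
      using S[OF that] by (intro sum_le_suminf) (auto simp: l2dist_def)
    also have "\<dots> < e" using S[OF that] assms by simp
    finally show ?thesis .
  qed
  then show ?thesis by blast
qed

lemma weight_tail:
  assumes "e > 0"
  shows "\<exists>S. \<forall>s0\<ge>S. \<forall>f\<in>F. summable (\<lambda>s. weight f (s + s0)) \<and> (\<Sum>s. weight f (s + s0)) \<le> e"
proof -
  let ?v = "\<lambda>f s. 2 powr (real s / 2) * l2dist P f (\<pi> s f)"
  \<comment> \<open>An increment is at most twice the sum of the two approximation errors, and
    \<open>2 powr (1 / 2)\<close> is estimated by 2. This yields the coefficients 2 and 4, whence
    \<open>e / 6\<close>.\<close>
  obtain S where S: "\<And>s0 f. s0 \<ge> S \<Longrightarrow> f \<in> F \<Longrightarrow> summable (\<lambda>s. ?v f (s + s0)) \<and> (\<Sum>s. ?v f (s + s0)) \<le> e / 6"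
    using approximation_tail[of "e / 6"] assms by auto
  have w: "weight f s \<le> 2 * ?v f (Suc s) + 4 * ?v f s" if f: "f \<in> F" for f s
  proof -
    have eq: "incr \<pi> (Suc s) f = (\<lambda>x. (f x - \<pi> s f x) - (f x - \<pi> (Suc s) f x))"
      by (simp add: incr_def)
    have "l2norm P (incr \<pi> (Suc s) f) \<le> 2 * (l2dist P f (\<pi> s f) + l2dist P f (\<pi> (Suc s) f))"
      unfolding eq l2dist_def using F f pi_F by (intro l2norm_diff_le L2_diff) auto
    then have "weight f s \<le> 2 powr (real (Suc s) / 2) * (2 * (l2dist P f (\<pi> s f) + l2dist P f (\<pi> (Suc s) f)))"
      unfolding weight_def by (intro mult_left_mono) auto
    also have "2 powr (real (Suc s) / 2) * (2 * (l2dist P f (\<pi> s f) + l2dist P f (\<pi> (Suc s) f)))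
      = 2 * ?v f (Suc s) + 2 * (2 powr (real (Suc s) / 2) * l2dist P f (\<pi> s f))" by (simp add: distrib_left)
    also have "(2::real) powr (real (Suc s) / 2) \<le> 2 * 2 powr (real s / 2)"
    proof -
      have "(2::real) powr (real (Suc s) / 2) \<le> 2 powr (1 + real s / 2)" by (intro powr_mono) auto
      then show ?thesis by (simp add: powr_add)
    qed
    then have "2 * ?v f (Suc s) + 2 * (2 powr (real (Suc s) / 2) * l2dist P f (\<pi> s f)) \<le>
        2 * ?v f (Suc s) + 2 * (2 * 2 powr (real s / 2) * l2dist P f (\<pi> s f))"
      by (intro add_left_mono mult_left_mono mult_right_mono) (auto simp: l2dist_def)
    finally show ?thesis by simp
  qed
  have "summable (\<lambda>s. weight f (s + s0)) \<and> (\<Sum>s. weight f (s + s0)) \<le> e" if "s0 \<ge> S" "f \<in> F" for s0 f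
  proof -
    have s0: "summable (\<lambda>s. ?v f (s + s0))" "(\<Sum>s. ?v f (s + s0)) \<le> e / 6"
      and s1: "summable (\<lambda>s. ?v f (s + Suc s0))" "(\<Sum>s. ?v f (s + Suc s0)) \<le> e / 6"
      using S[of s0 f] S[of "Suc s0" f] that by auto
    have i: "summable (\<lambda>s. 2 * ?v f (s + Suc s0) + 4 * ?v f (s + s0))"
      by (intro summable_add summable_mult s0 s1)
    have wi: "weight f (s + s0) \<le> 2 * ?v f (s + Suc s0) + 4 * ?v f (s + s0)" for s
      using w[OF \<open>f \<in> F\<close>, of "s + s0"] by simp
    have sw: "summable (\<lambda>s. weight f (s + s0))"
      by (rule summable_comparison_test[OF _ i]) (use wi weight_nonneg in auto)
    have "(\<Sum>s. weight f (s + s0)) \<le> (\<Sum>s. 2 * ?v f (s + Suc s0) + 4 * ?v f (s + s0))"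
      by (rule suminf_le[OF wi sw i])
    also have "\<dots> = 2 * (\<Sum>s. ?v f (s + Suc s0)) + 4 * (\<Sum>s. ?v f (s + s0))"
      unfolding suminf_add[OF summable_mult[OF s1(1)] summable_mult[OF s0(1)], symmetric]
        suminf_mult[OF s0(1)] suminf_mult[OF s1(1)] ..
    finally show ?thesis using s0 s1 sw by simp
  qed
  then show ?thesis by blast
qed

text \<open>The tail is at most 1 by \<open>weight_tail\<close>, and each of the finitely many
  initial terms is at most a maximum over the finite set of increments of that level.\<close>

lemma weight_bound: "\<exists>B. \<forall>f\<in>F. summable (weight f) \<and> suminf (weight f) \<le> B"
proof -
  obtain S where S: "\<And>f. f \<in> F \<Longrightarrow> summable (\<lambda>s. weight f (s + S)) \<and> (\<Sum>s. weight f (s + S)) \<le> 1"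
    using weight_tail[of 1] by auto
  define m where "m s = Max ((\<lambda>h. 2 powr (real (Suc s) / 2) * l2norm P h) ` (incr \<pi> (Suc s) ` F))" for s
  have "weight f s \<le> m s" if "f \<in> F" for f s
    unfolding m_def weight_def using that finite_incr by (intro Max_ge) auto
  then have "summable (weight f) \<and> suminf (weight f) \<le> 1 + (\<Sum>s<S. m s)" if "f \<in> F" for f
  proof -
    have s: "summable (weight f)" using S[OF that] summable_iff_shift by blast
    have "suminf (weight f) = (\<Sum>s. weight f (s + S)) + (\<Sum>s<S. weight f s)"
      by (rule suminf_split_initial_segment[OF s])
    also have "\<dots> \<le> 1 + (\<Sum>s<S. m s)"
      using S[OF that] \<open>\<And>s f. f \<in> F \<Longrightarrow> weight f s \<le> m s\<close> that by (intro add_mono sum_mono) auto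
    finally show ?thesis using s by blast
  qed
  then show ?thesis by blast
qed

text \<open>A crude bound, in which the division by the power of 2 becomes a multiplication. For
  fixed \<open>n\<close> it is enough to make the modification an absolutely convergent series
  bounded uniformly on the class.\<close>

lemma abs_trunc_incr_le: "\<bar>trunc_incr c0 P \<pi> n (Suc s) f x\<bar> \<le> c0 * sqrt (real n) * weight f s"
proof -
  have "\<bar>trunc_incr c0 P \<pi> n (Suc s) f x\<bar> \<le> incr_level c0 P n (Suc s) (incr \<pi> (Suc s) f)"
    unfolding trunc_incr_eq using c0 by (intro abs_trunc_le incr_level_nonneg) simp
  also have "\<dots> = c0 * sqrt (real n) * (1 / 2 powr (real (Suc s) / 2) * l2norm P (incr \<pi> (Suc s) f))"
    by (simp add: incr_level_def)
  also have "\<dots> \<le> c0 * sqrt (real n) * weight f s"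
  proof -
    have "1 \<le> (2::real) powr (real (Suc s) / 2)" by (rule ge_one_powr_ge_zero) auto
    then have "1 / (2::real) powr (real (Suc s) / 2) \<le> 1" by simp
    also have "\<dots> \<le> (2::real) powr (real (Suc s) / 2)" by fact
    finally have "1 / (2::real) powr (real (Suc s) / 2) \<le> 2 powr (real (Suc s) / 2)" .
    then show ?thesis
      unfolding weight_def using c0 by (intro mult_left_mono mult_right_mono) auto
  qed
  finally show ?thesis .
qed

lemma trunc_incr_summable:
  assumes "f \<in> F"
  shows "summable (\<lambda>s. trunc_incr c0 P \<pi> n (Suc s) f x)"
proof -
  from assms have "summable (\<lambda>s. c0 * sqrt (real n) * weight f s)"
    using weight_bound by (intro summable_mult) blast
  then show ?thesis
    by (rule summable_comparison_test[rotated]) (use abs_trunc_incr_le in auto)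
qed

lemma emp_mean_modification:
  assumes "f \<in> F"
  shows "summable (\<lambda>s. emp_mean n y (trunc_incr c0 P \<pi> n (Suc s) f))"
    "emp_mean n y (modification c0 P \<pi> n f) = (\<Sum>s. emp_mean n y (trunc_incr c0 P \<pi> n (Suc s) f))"
  unfolding modification_def by (rule emp_mean_suminf trunc_incr_summable assms)+

text \<open>The bound may depend on \<open>n\<close>, but neither on \<open>f\<close> nor on the
  points \<open>y\<close>: every path of the modified process lies in \<open>linf F\<close>, not
  just almost every one.\<close>

lemma emp_mean_modification_bounded:
  "\<exists>B. \<forall>f\<in>F. \<forall>y. \<bar>emp_mean n y (modification c0 P \<pi> n f)\<bar> \<le> B"
proof -
  obtain B where B: "\<And>f. f \<in> F \<Longrightarrow> summable (weight f)" "\<And>f. f \<in> F \<Longrightarrow> suminf (weight f) \<le> B"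
    using weight_bound by auto
  have "\<bar>modification c0 P \<pi> n f x\<bar> \<le> c0 * sqrt (real n) * B" if "f \<in> F" for f x
  proof -
    have i: "summable (\<lambda>s. c0 * sqrt (real n) * weight f s)" using B that by (intro summable_mult)
    have "\<bar>modification c0 P \<pi> n f x\<bar> \<le> (\<Sum>s. c0 * sqrt (real n) * weight f s)"
      unfolding modification_def real_norm_def[symmetric]
      by (rule norm_suminf_le) (use abs_trunc_incr_le i in auto)
    also have "\<dots> = c0 * sqrt (real n) * suminf (weight f)" using B that by (intro suminf_mult)
    also have "\<dots> \<le> c0 * sqrt (real n) * B" using c0 B that by (intro mult_left_mono) auto
    finally show ?thesis .
  qed
  then show ?thesis
    by (intro exI[of _ "c0 * sqrt (real n) * B"] ballI allI emp_mean_const_le) auto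
qed

text \<open>The increments are centred, so the mean of a truncated increment is minus that of the part cut off.\<close>

lemma sqrt_integral_trunc_incr_le:
  assumes f: "f \<in> F" and "n \<ge> 1"
  shows "sqrt (real n) * \<bar>\<integral>x. trunc_incr c0 P \<pi> n (Suc s) f x \<partial>P\<bar> \<le> weight f s / c0"
proof -
  let ?h = "incr \<pi> (Suc s) f" and ?k = "c0 / 2 powr (real (Suc s) / 2) * sqrt (real n)"
  have k: "?k > 0" using c0 \<open>n \<ge> 1\<close> by simp
  have ti: "trunc_incr c0 P \<pi> n (Suc s) f = trunc (?k * l2norm P ?h) ?h"
    unfolding trunc_incr_eq incr_level_def ..
  have h: "?h \<in> L2 P" using incr_L2[OF f] .
  have "(\<integral>x. trunc_incr c0 P \<pi> n (Suc s) f x \<partial>P) = - (\<integral>x. ?h x - trunc_incr c0 P \<pi> n (Suc s) f x \<partial>P)"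
    unfolding ti using L2_trunc_integrable[OF h] incr_integral[OF f] by simp
  then have "\<bar>\<integral>x. trunc_incr c0 P \<pi> n (Suc s) f x \<partial>P\<bar> \<le> (\<integral>x. \<bar>?h x - trunc (?k * l2norm P ?h) ?h x\<bar> \<partial>P)"
    unfolding ti using integral_abs_bound[of P "\<lambda>x. ?h x - trunc (?k * l2norm P ?h) ?h x"] by simp
  also have "\<dots> \<le> l2norm P ?h / ?k"
    using integral_diff_trunc_le[OF h k] k by (simp only: pos_le_divide_eq mult.commute)
  finally have "sqrt (real n) * \<bar>\<integral>x. trunc_incr c0 P \<pi> n (Suc s) f x \<partial>P\<bar> \<le> sqrt (real n) * (l2norm P ?h / ?k)"
    by (intro mult_left_mono) auto
  \<comment> \<open>The factor \<open>sqrt (real n)\<close> cancels the one in \<open>?k\<close>, so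
    that the bias bound does not depend on \<open>n\<close>.\<close>
  also have "\<dots> = weight f s / c0" using \<open>n \<ge> 1\<close> by (simp add: weight_def)
  finally show ?thesis .
qed

text \<open>The cost of truncating the levels up to \<open>s0\<close>. Summing over all increments
  of a level, and not only the one of a given \<open>f\<close>, yields a single measurable bound for
  the whole class.\<close>

definition head :: "nat \<Rightarrow> nat \<Rightarrow> (nat \<Rightarrow> 'a) \<Rightarrow> real" where
  "head s0 n y = (\<Sum>s<s0. \<Sum>h\<in>incr \<pi> (Suc s) ` F.
     sqrt (real n) * emp_mean n y (\<lambda>x. \<bar>h x - trunc (incr_level c0 P n (Suc s) h) h x\<bar>))"

text \<open>A deterministic estimate for points \<open>y\<close> that satisfy the deviation bounds.
  In the tail \<open>b\<close> accounts for the deviation and \<open>1 / c0\<close> for the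
  truncation bias; \<open>head\<close> accounts for the initial levels.\<close>

lemma emp_mean_modification_approx:
  assumes f: "f \<in> F" and n: "n \<ge> 1" and b: "b \<ge> 0"
    and dev: "\<And>s. s \<ge> s0 \<Longrightarrow>
      \<bar>emp_mean n y (trunc_incr c0 P \<pi> n (Suc s) f) - (\<integral>x. trunc_incr c0 P \<pi> n (Suc s) f x \<partial>P)\<bar>
        \<le> b * 2 powr (real (Suc s) / 2) * l2norm P (incr \<pi> (Suc s) f) / sqrt (real n)"
    and zero: "\<And>i. i < n \<Longrightarrow> \<pi> 0 f (y i) = 0"
  shows "\<bar>sqrt (real n) * emp_mean n y (modification c0 P \<pi> n f) - sqrt (real n) * emp_mean n y (\<pi> s0 f)\<bar>
    \<le> (b + 1 / c0) * (\<Sum>s. weight f (s + s0)) + head s0 n y"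
proof -
  let ?t = "\<lambda>s. emp_mean n y (trunc_incr c0 P \<pi> n (Suc s) f)"
  let ?r = "sqrt (real n)"
  have "summable (weight f)" using weight_bound f by blast
  then have sw: "summable (\<lambda>s. weight f (s + s0))" by (rule summable_ignore_initial_segment)
  have tail_term: "\<bar>?r * ?t (s + s0)\<bar> \<le> (b + 1 / c0) * weight f (s + s0)" for s
  proof -
    let ?p = "\<integral>x. trunc_incr c0 P \<pi> n (Suc (s + s0)) f x \<partial>P"
    have "?r * \<bar>?t (s + s0) - ?p\<bar> \<le> ?r * (b * 2 powr (real (Suc (s + s0)) / 2) * l2norm P (incr \<pi> (Suc (s + s0)) f) / ?r)"
      using dev[of "s + s0"] by (intro mult_left_mono) auto
    also have "\<dots> = b * weight f (s + s0)" using n by (simp add: weight_def)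
    finally have 1: "\<bar>?r * (?t (s + s0) - ?p)\<bar> \<le> b * weight f (s + s0)" by (simp add: abs_mult)
    have 2: "\<bar>?r * ?p\<bar> \<le> weight f (s + s0) / c0"
      using sqrt_integral_trunc_incr_le[OF f n, of "s + s0"] by (simp add: abs_mult)
    have "?r * ?t (s + s0) = ?r * (?t (s + s0) - ?p) + ?r * ?p" by (simp add: algebra_simps)
    then show ?thesis using 1 2 by (simp add: distrib_right)
  qed
  have tail: "\<bar>\<Sum>s. ?r * ?t (s + s0)\<bar> \<le> (b + 1 / c0) * (\<Sum>s. weight f (s + s0))"
    using norm_suminf_le[of "\<lambda>s. ?r * ?t (s + s0)" "\<lambda>s. (b + 1 / c0) * weight f (s + s0)"]
      tail_term sw by (simp add: suminf_mult summable_mult)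
  \<comment> \<open>The modification contains no term for \<open>\<pi> 0 f\<close>, so the
    telescoping sum reproduces \<open>\<pi> s0 f\<close> on the sample because the base vanishes
    there.\<close>
  have "emp_mean n y (\<pi> 0 f) = 0" using zero by (simp add: emp_mean_def)
  moreover have "(\<Sum>s<s0. emp_mean n y (incr \<pi> (Suc s) f)) = emp_mean n y (\<pi> s0 f) - emp_mean n y (\<pi> 0 f)"
    by (induction s0) (simp_all add: incr_def emp_mean_diff)
  ultimately have tele: "emp_mean n y (\<pi> s0 f) = (\<Sum>s<s0. emp_mean n y (incr \<pi> (Suc s) f))" by simp
  have "\<bar>?r * (\<Sum>s<s0. ?t s) - ?r * emp_mean n y (\<pi> s0 f)\<bar>
      \<le> (\<Sum>s<s0. \<bar>?r * emp_mean n y (\<lambda>x. incr \<pi> (Suc s) f x - trunc_incr c0 P \<pi> n (Suc s) f x)\<bar>)"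
    unfolding tele right_diff_distrib[symmetric] sum_subtractf[symmetric] emp_mean_diff sum_distrib_left
    by (rule order_trans[OF sum_abs]) (simp add: abs_mult abs_minus_commute)
  also have "\<dots> \<le> head s0 n y"
    unfolding head_def
  proof (rule sum_mono)
    fix s
    let ?h = "incr \<pi> (Suc s) f"
    let ?e = "\<lambda>h. ?r * emp_mean n y (\<lambda>x. \<bar>h x - trunc (incr_level c0 P n (Suc s) h) h x\<bar>)"
    have "?e h \<ge> 0" for h by (auto simp: emp_mean_def intro!: mult_nonneg_nonneg divide_nonneg_nonneg sum_nonneg)
    then have "?e ?h \<le> (\<Sum>h\<in>incr \<pi> (Suc s) ` F. ?e h)"
      using finite_incr f by (intro member_le_sum) auto
    moreover have "\<bar>?r * emp_mean n y (\<lambda>x. ?h x - trunc_incr c0 P \<pi> n (Suc s) f x)\<bar> \<le> ?e ?h"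
      unfolding abs_mult trunc_incr_eq by (simp, intro mult_left_mono emp_mean_abs_le) auto
    ultimately show "\<bar>?r * emp_mean n y (\<lambda>x. ?h x - trunc_incr c0 P \<pi> n (Suc s) f x)\<bar> \<le> (\<Sum>h\<in>incr \<pi> (Suc s) ` F. ?e h)"
      by linarith
  qed
  finally have hd: "\<bar>?r * (\<Sum>s<s0. ?t s) - ?r * emp_mean n y (\<pi> s0 f)\<bar> \<le> head s0 n y" .
  note st = emp_mean_modification(1)[OF f, of n y]
  have "?r * emp_mean n y (modification c0 P \<pi> n f) = ?r * ((\<Sum>s. ?t (s + s0)) + (\<Sum>s<s0. ?t s))"
    unfolding emp_mean_modification(2)[OF f] by (subst suminf_split_initial_segment[OF st, of s0]) simp
  also have "\<dots> = (\<Sum>s. ?r * ?t (s + s0)) + ?r * (\<Sum>s<s0. ?t s)"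
    using summable_ignore_initial_segment[OF st, of s0] by (simp add: suminf_mult distrib_left)
  finally show ?thesis using tail hd by linarith
qed

text \<open>The expectation of an empirical mean is the mean under \<open>P\<close>, and
  \<open>head\<close> has finitely many summands, each of which is covered by
  \<open>sqrt_integral_diff_trunc_tendsto\<close>.\<close>

lemma head_integral_tendsto:
  assumes "iid_sample M P X"
  shows "integrable M (\<lambda>\<omega>. head s0 n (\<lambda>i. X i \<omega>))"
    "(\<lambda>n. \<integral>\<omega>. head s0 n (\<lambda>i. X i \<omega>) \<partial>M) \<longlonglongrightarrow> 0"
proof -
  interpret iid_sample M P X by fact
  let ?g = "\<lambda>n s h x. \<bar>h x - trunc (incr_level c0 P n (Suc s) h) h x\<bar>"
  have i: "integrable P (?g n s h)" if "h \<in> incr \<pi> (Suc s) ` F" for n s h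
    using that incr_L2 by (intro L2_trunc_integrable) auto
  have e: "integrable M (\<lambda>\<omega>. sqrt (real n) * emp_mean n (\<lambda>i. X i \<omega>) (?g n s h)) \<and>
      (\<integral>\<omega>. sqrt (real n) * emp_mean n (\<lambda>i. X i \<omega>) (?g n s h) \<partial>M) = sqrt (real n) * (\<integral>x. ?g n s h x \<partial>P)"
    if "h \<in> incr \<pi> (Suc s) ` F" for n s h
    using sample_integrable[OF i[OF that]] sample_integral[OF borel_measurable_integrable[OF i[OF that]]]
    by (cases "n = 0") (simp_all add: emp_mean_def)
  show "integrable M (\<lambda>\<omega>. head s0 n (\<lambda>i. X i \<omega>))"
    unfolding head_def using e by (intro Bochner_Integration.integrable_sum) blast
  have "(\<integral>\<omega>. head s0 n (\<lambda>i. X i \<omega>) \<partial>M) = (\<Sum>s<s0. \<Sum>h\<in>incr \<pi> (Suc s) ` F. sqrt (real n) * (\<integral>x. ?g n s h x \<partial>P))" for n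
  proof -
    have "(\<integral>\<omega>. head s0 n (\<lambda>i. X i \<omega>) \<partial>M) =
      (\<Sum>s<s0. (\<integral>\<omega>. (\<Sum>h\<in>incr \<pi> (Suc s) ` F. sqrt (real n) * emp_mean n (\<lambda>i. X i \<omega>) (?g n s h)) \<partial>M))"
      unfolding head_def using e by (intro Bochner_Integration.integral_sum Bochner_Integration.integrable_sum) blast
    also have "\<dots> = (\<Sum>s<s0. \<Sum>h\<in>incr \<pi> (Suc s) ` F. sqrt (real n) * (\<integral>x. ?g n s h x \<partial>P))"
    proof (rule sum.cong[OF refl])
      fix s
      have "(\<integral>\<omega>. (\<Sum>h\<in>incr \<pi> (Suc s) ` F. sqrt (real n) * emp_mean n (\<lambda>i. X i \<omega>) (?g n s h)) \<partial>M) =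
          (\<Sum>h\<in>incr \<pi> (Suc s) ` F. (\<integral>\<omega>. sqrt (real n) * emp_mean n (\<lambda>i. X i \<omega>) (?g n s h) \<partial>M))"
        using e by (intro Bochner_Integration.integral_sum) blast
      also have "\<dots> = (\<Sum>h\<in>incr \<pi> (Suc s) ` F. sqrt (real n) * (\<integral>x. ?g n s h x \<partial>P))"
        by (intro sum.cong refl e[THEN conjunct2])
      finally show "(\<integral>\<omega>. (\<Sum>h\<in>incr \<pi> (Suc s) ` F. sqrt (real n) * emp_mean n (\<lambda>i. X i \<omega>) (?g n s h)) \<partial>M) =
          (\<Sum>h\<in>incr \<pi> (Suc s) ` F. sqrt (real n) * (\<integral>x. ?g n s h x \<partial>P))" .
    qed
    finally show ?thesis .
  qed
  moreover have "(\<lambda>n. \<Sum>s<s0. \<Sum>h\<in>incr \<pi> (Suc s) ` F. sqrt (real n) * (\<integral>x. ?g n s h x \<partial>P)) \<longlonglongrightarrow> (\<Sum>s<s0. \<Sum>h\<in>incr \<pi> (Suc s) ` F. 0)"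
    unfolding incr_level_def using c0 incr_L2
    by (intro tendsto_sum sqrt_integral_diff_trunc_tendsto) auto
  ultimately show "(\<lambda>n. \<integral>\<omega>. head s0 n (\<lambda>i. X i \<omega>) \<partial>M) \<longlonglongrightarrow> 0" by simp
qed

end

section \<open>The limit process\<close>

lemma linf_mspace_iff: "z \<in> mspace (linf T) \<longleftrightarrow> z \<in> extensional T \<and> bounded (z ` T)"
  for z :: "'t \<Rightarrow> real"
  by (simp add: Met_TC.fspace_def)

lemma linf_memI:
  fixes z :: "'t \<Rightarrow> real"
  assumes "\<And>t. t \<in> T \<Longrightarrow> \<bar>z t\<bar> \<le> B"
  shows "restrict z T \<in> mspace (linf T)"
  unfolding linf_mspace_iff using assms by (auto simp: bounded_iff intro!: exI[of _ B])

lemma linf_dist_le: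
  fixes z z' :: "'t \<Rightarrow> real"
  assumes "z \<in> mspace (linf T)" "z' \<in> mspace (linf T)" "T \<noteq> {}"
  shows "mdist (linf T) z z' \<le> c \<longleftrightarrow> (\<forall>t\<in>T. \<bar>z t - z' t\<bar> \<le> c)"
  using funspace_mdist_le[OF assms] by (simp add: dist_real_def)

text \<open>Completeness turns totally bounded sets into sets with compact closure in the proof of
  tightness.\<close>

lemma mcomplete_linf: "mcomplete_of (linf T)" for T :: "'t set"
proof -
  have "euclidean_metric = (Met_TC.Self :: real metric)" by (simp add: euclidean_metric_def Met_TC.Self_def)
  moreover have "mcomplete_of (funspace T (Met_TC.Self :: real metric))"
    by (rule Met_TC.mcomplete_funspace) (simp add: complete_UNIV)
  ultimately show ?thesis by (simp only:)
qed

text \<open>Step functions in \<open>linf F\<close> that depend on \<open>f\<close> only through \<open>\<pi> s f\<close>, parametrized by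
  sequences of which only the coordinates \<open>to_nat_on (Fs s) ` Fs s\<close> matter.\<close>

context chaining
begin

definition embed :: "nat \<Rightarrow> (nat \<Rightarrow> real) \<Rightarrow> ('a \<Rightarrow> real) \<Rightarrow> real" where
  "embed s w = (\<lambda>f\<in>F. w (to_nat_on (Fs s) (\<pi> s f)))"

lemma index_in: "f \<in> F \<Longrightarrow> to_nat_on (Fs s) (\<pi> s f) \<in> to_nat_on (Fs s) ` Fs s"
  using pi_in by blast

lemma embed_mspace: "embed s w \<in> mspace (linf F)"
  unfolding embed_def
proof (rule linf_memI)
  fix f assume "f \<in> F"
  then show "\<bar>w (to_nat_on (Fs s) (\<pi> s f))\<bar> \<le> Max ((\<lambda>j. \<bar>w j\<bar>) ` to_nat_on (Fs s) ` Fs s)"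
    using index_in Fs by (intro Max_ge) auto
qed

text \<open>This is the finite dependence that the Cramer-Wold device demands of a test
  function.\<close>

lemma embed_cong: "(\<And>j. j \<in> to_nat_on (Fs s) ` Fs s \<Longrightarrow> w j = w' j) \<Longrightarrow> embed s w = embed s w'"
  using index_in by (auto simp: embed_def fun_eq_iff)

lemma embed_from_nat_into: "embed s (\<lambda>j. z (from_nat_into (Fs s) j)) = (\<lambda>f\<in>F. z (\<pi> s f))"
  using Fs pi_in by (auto simp: embed_def fun_eq_iff countable_finite)

lemma continuous_embed: "continuous_map euclidean (mtopology_of (linf F)) (embed s)"
  unfolding continuous_map_def
proof (intro conjI allI impI)
  show "embed s \<in> topspace euclidean \<rightarrow> topspace (mtopology_of (linf F))"
    using embed_mspace by (simp del: mspace_funspace)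
  fix U assume U: "openin (mtopology_of (linf F)) U"
  have "open {w. embed s w \<in> U}"
    unfolding open_subopen[of "{w. embed s w \<in> U}"]
  proof
    fix w assume "w \<in> {w. embed s w \<in> U}"
    then obtain r where r: "r > 0"
      "\<And>z. z \<in> mspace (linf F) \<Longrightarrow> mdist (linf F) (embed s w) z < r \<Longrightarrow> z \<in> U"
      using U unfolding openin_mtopology_of_iff by blast
    \<comment> \<open>Only finitely many coordinates are restricted, so \<open>V\<close> is open in
      the product topology. The radius \<open>r / 2\<close> is there because the supremum of
      distances below it is only known to be at most \<open>r / 2\<close>.\<close>
    define V where "V = {w'. \<forall>j\<in>to_nat_on (Fs s) ` Fs s. w' j \<in> ball (w j) (r / 2)}"
    have "open V"
      unfolding V_def using Fs by (intro product_topology_basis'[where x = "\<lambda>j. j"]) auto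
    moreover have "w \<in> V" using r by (simp add: V_def)
    moreover have "V \<subseteq> {w. embed s w \<in> U}"
    proof
      fix w' assume w': "w' \<in> V"
      have "\<bar>embed s w f - embed s w' f\<bar> \<le> r / 2" if "f \<in> F" for f
      proof -
        have "w' (to_nat_on (Fs s) (\<pi> s f)) \<in> ball (w (to_nat_on (Fs s) (\<pi> s f))) (r / 2)"
          using w' index_in[OF that] unfolding V_def by blast
        then show ?thesis using that by (simp add: embed_def dist_real_def)
      qed
      then have "mdist (linf F) (embed s w) (embed s w') \<le> r / 2"
        using linf_dist_le[OF embed_mspace embed_mspace F_nonempty] by blast
      then have "mdist (linf F) (embed s w) (embed s w') < r" using r(1) by linarith
      then show "w' \<in> {w. embed s w \<in> U}" using r(2)[OF embed_mspace] by blast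
    qed
    ultimately show "\<exists>T. open T \<and> w \<in> T \<and> T \<subseteq> {w. embed s w \<in> U}" by blast
  qed
  then show "openin euclidean {w \<in> topspace euclidean. embed s w \<in> U}" by simp
qed

text \<open>The Borel sets of \<open>linf F\<close> are too many to be checked coordinate by
  coordinate, but the step functions are continuous images of a sequence, for which coordinatewise
  measurability suffices.\<close>

lemma embed_measurable:
  assumes "\<And>j. (\<lambda>\<omega>. W \<omega> j) \<in> borel_measurable N"
  shows "(\<lambda>\<omega>. embed s (W \<omega>)) \<in> measurable N (borel_of_metric (linf F))"
proof (rule measurable_borel_of_metricI[OF embed_mspace])
  fix U assume "openin (mtopology_of (linf F)) U"
  then have "open {w. embed s w \<in> U}"
    using openin_continuous_map_preimage[OF continuous_embed] by simp
  moreover have "W \<in> measurable N borel"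
    using assms by (rule measurable_coordinatewise_then_product)
  ultimately have "W -` {w. embed s w \<in> U} \<inter> space N \<in> sets N"
    by (intro measurable_sets) auto
  then show "{\<omega> \<in> space N. embed s (W \<omega>) \<in> U} \<in> sets N"
    by (simp add: vimage_def Int_def conj_commute)
qed

text \<open>Since \<open>\<pi> s f\<close> tends to \<open>f\<close> uniformly on the class, uniform
  continuity makes \<open>z (\<pi> s f)\<close> tend to \<open>z f\<close> uniformly. Boundedness
  follows: \<open>z\<close> stays within 1 of its values on a finite set
  \<open>Fs S\<close>.\<close>

lemma continuous_path_properties:
  assumes "\<And>\<epsilon>. \<epsilon> > 0 \<Longrightarrow> \<exists>\<delta>>0. \<forall>f\<in>F. \<forall>g\<in>F. l2dist P f g < \<delta> \<longrightarrow> \<bar>z f - z g\<bar> < \<epsilon>"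
  shows "restrict z F \<in> mspace (linf F)"
    "(\<lambda>s. mdist (linf F) (\<lambda>f\<in>F. z (\<pi> s f)) (restrict z F)) \<longlonglongrightarrow> 0"
proof -
  have unif: "\<exists>S. \<forall>s\<ge>S. \<forall>f\<in>F. \<bar>z f - z (\<pi> s f)\<bar> < e" if "e > 0" for e
  proof -
    obtain d where "d > 0" "\<And>f g. f \<in> F \<Longrightarrow> g \<in> F \<Longrightarrow> l2dist P f g < d \<Longrightarrow> \<bar>z f - z g\<bar> < e"
      using assms[OF \<open>e > 0\<close>] by blast
    moreover from l2dist_uniform[OF \<open>d > 0\<close>] obtain S where
      "\<And>s f. s \<ge> S \<Longrightarrow> f \<in> F \<Longrightarrow> l2dist P f (\<pi> s f) < d" by blast
    ultimately show ?thesis using pi_F by blast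
  qed
  obtain S where S: "\<And>f. f \<in> F \<Longrightarrow> \<bar>z f - z (\<pi> S f)\<bar> < 1"
    using unif[of 1] by auto
  show mem: "restrict z F \<in> mspace (linf F)"
  proof (rule linf_memI)
    fix f assume f: "f \<in> F"
    have "\<bar>z (\<pi> S f)\<bar> \<le> Max ((\<lambda>g. \<bar>z g\<bar>) ` Fs S)"
      using Fs pi_in[OF f] by (intro Max_ge) auto
    then show "\<bar>z f\<bar> \<le> 1 + Max ((\<lambda>g. \<bar>z g\<bar>) ` Fs S)" using S[OF f] by linarith
  qed
  have mem': "(\<lambda>f\<in>F. z (\<pi> s f)) \<in> mspace (linf F)" for s
    using embed_mspace[of s "\<lambda>j. z (from_nat_into (Fs s) j)"] by (simp only: embed_from_nat_into)
  show "(\<lambda>s. mdist (linf F) (\<lambda>f\<in>F. z (\<pi> s f)) (restrict z F)) \<longlonglongrightarrow> 0"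
  proof (rule LIMSEQ_I)
    fix r :: real assume "r > 0"
    then obtain S where S: "\<And>s f. s \<ge> S \<Longrightarrow> f \<in> F \<Longrightarrow> \<bar>z f - z (\<pi> s f)\<bar> < r / 2"
      using unif[of "r / 2"] by auto
    have "mdist (linf F) (\<lambda>f\<in>F. z (\<pi> s f)) (restrict z F) \<le> r / 2" if "s \<ge> S" for s
      unfolding linf_dist_le[OF mem' mem F_nonempty]
      using S[OF that] by (auto simp: abs_minus_commute intro: less_imp_le)
    then show "\<exists>S. \<forall>s\<ge>S. norm (mdist (linf F) (\<lambda>f\<in>F. z (\<pi> s f)) (restrict z F) - 0) < r"
      using \<open>r > 0\<close> by (intro exI[of _ S] allI impI) (fastforce simp del: mdist_funspace)
  qed
qed

text \<open>\<open>Y\<close> equals \<open>G\<close> on a measurable set of full probability and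
  zero elsewhere, so that all paths are uniformly continuous. Measurability and tightness then
  follow from the uniform approximation of every path by its step functions.\<close>

lemma limit_process:
  assumes N: "prob_space N" and gp: "centered_gaussian_process N F cov G"
    and cont: "continuous_process N F (l2dist P) G"
  obtains Y where "AE \<omega> in N. \<forall>f\<in>F. Y \<omega> f = G f \<omega>"
    "\<And>f. f \<in> F \<Longrightarrow> (\<lambda>\<omega>. Y \<omega> f) \<in> borel_measurable N"
    "\<And>\<omega>. (\<lambda>s. mdist (linf F) (\<lambda>f\<in>F. Y \<omega> (\<pi> s f)) (Y \<omega>)) \<longlonglongrightarrow> 0"
    "Y \<in> measurable N (borel_of_metric (linf F))" "tight_map (linf F) N Y"
proof -
  interpret N: prob_space N by fact
  have [measurable]: "G f \<in> borel_measurable N" if "f \<in> F" for f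
    using gp that by (auto simp: centered_gaussian_process_def)
  let ?good = "\<lambda>\<omega>. \<forall>\<epsilon>>0. \<exists>\<delta>>0. \<forall>s\<in>F. \<forall>t\<in>F. l2dist P s t < \<delta> \<longrightarrow> \<bar>G s \<omega> - G t \<omega>\<bar> < \<epsilon>"
  \<comment> \<open>The set of good paths need not be measurable, so its complement is covered by a
    null set.\<close>
  obtain A where A: "A \<in> null_sets N" "{\<omega> \<in> space N. \<not> ?good \<omega>} \<subseteq> A"
    using cont unfolding continuous_process_def by (auto elim!: AE_E intro: that)
  define C where "C = space N - A"
  have [measurable]: "C \<in> sets N" using A by (auto simp: C_def)
  define y where "y \<omega> f = (if \<omega> \<in> C then G f \<omega> else 0)" for \<omega> f
  define Y where "Y \<omega> = restrict (y \<omega>) F" for \<omega>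
  have good: "\<exists>\<delta>>0. \<forall>f\<in>F. \<forall>g\<in>F. l2dist P f g < \<delta> \<longrightarrow> \<bar>y \<omega> f - y \<omega> g\<bar> < \<epsilon>" if "\<epsilon> > 0" for \<epsilon> \<omega>
  proof (cases "\<omega> \<in> C")
    case True
    then have "\<omega> \<notin> {\<omega> \<in> space N. \<not> ?good \<omega>}" "\<omega> \<in> space N" using A(2) by (auto simp only: C_def)
    then have "?good \<omega>" by blast
    with that show ?thesis using True by (simp add: y_def)
  qed (use that in \<open>auto simp: y_def intro: exI[of _ 1]\<close>)
  have eq: "(\<lambda>f\<in>F. Y \<omega> (\<pi> s f)) = (\<lambda>f\<in>F. y \<omega> (\<pi> s f))" for \<omega> s
    using pi_F by (auto simp: Y_def fun_eq_iff)
  have mem: "Y \<omega> \<in> mspace (linf F)" for \<omega>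
    unfolding Y_def by (rule continuous_path_properties(1)[OF good])
  have lim: "(\<lambda>s. mdist (linf F) (\<lambda>f\<in>F. Y \<omega> (\<pi> s f)) (Y \<omega>)) \<longlonglongrightarrow> 0" for \<omega>
    unfolding eq unfolding Y_def by (rule continuous_path_properties(2)[OF good])
  have Ym: "(\<lambda>\<omega>. Y \<omega> f) \<in> borel_measurable N" if "f \<in> F" for f
    using that unfolding Y_def y_def by simp
  have emb: "embed s (\<lambda>j. Y \<omega> (from_nat_into (Fs s) j)) = (\<lambda>f\<in>F. Y \<omega> (\<pi> s f))" for s \<omega>
    by (rule embed_from_nat_into)
  have nat_F: "from_nat_into (Fs s) j \<in> F" for s j using Fs(1) from_nat_into[OF Fs(3)] by (rule subsetD)
  have meas: "Y \<in> measurable N (borel_of_metric (linf F))"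
  proof (rule measurable_borel_of_metric_limit[OF _ mem lim])
    show "(\<lambda>\<omega>. \<lambda>f\<in>F. Y \<omega> (\<pi> s f)) \<in> measurable N (borel_of_metric (linf F))" for s
      unfolding emb[symmetric] by (rule embed_measurable[OF Ym[OF nat_F]])
  qed
  \<comment> \<open>A finite union of continuous images of compact cubes. The step function of a
    path at level \<open>s\<close> with values bounded by \<open>i\<close> lies in
    \<open>K (max s i)\<close>.\<close>
  define K where "K i = (\<Union>s\<le>i. embed s ` {w. \<forall>j. \<bar>w j\<bar> \<le> real i})" for i
  have "tight_map (linf F) N Y"
  proof (rule N.tight_mapI[OF mcomplete_linf meas])
    fix i
    have "compactin euclidean {w :: nat \<Rightarrow> real. \<forall>j. \<bar>w j\<bar> \<le> real i}"
      using compact_cube by simp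
    then show "compactin (mtopology_of (linf F)) (K i)"
      unfolding K_def by (intro compactin_Union) (auto intro: image_compactin[OF _ continuous_embed])
  next
    fix \<omega> e assume "e > (0::real)"
    obtain s where s: "mdist (linf F) (\<lambda>f\<in>F. Y \<omega> (\<pi> s f)) (Y \<omega>) < e"
      using order_tendstoD(2)[OF lim \<open>e > 0\<close>] eventually_happens'[OF sequentially_bot] by blast
    have "bounded (Y \<omega> ` F)" using mem linf_mspace_iff by blast
    then obtain B where B: "\<And>f. f \<in> F \<Longrightarrow> \<bar>Y \<omega> f\<bar> \<le> B" by (auto simp: bounded_iff)
    obtain i :: nat where i: "B \<le> i" using real_arch_simple by blast
    have "embed s (\<lambda>j. Y \<omega> (from_nat_into (Fs s) j)) \<in> K (max s i)"
      unfolding K_def using B[OF nat_F] i by (intro UN_I[of s] imageI) (force intro: order_trans)+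
    then show "\<exists>i. \<exists>x\<in>K i. mdist (linf F) (Y \<omega>) x < e"
      using s unfolding emb mdist_commute[of _ "Y \<omega>"] by blast
  qed
  moreover have "AE \<omega> in N. \<forall>f\<in>F. Y \<omega> f = G f \<omega>"
    using AE_not_in[OF A(1)] AE_space by eventually_elim (simp add: Y_def y_def C_def)
  ultimately show ?thesis using that Ym lim meas by blast
qed

end

section \<open>Convergence of the modified empirical process\<close>

text \<open>\<open>deviation\<close> is the requirement on \<open>c0\<close> at
  \<open>u = 1\<close>, where \<open>min (u\<^sup>2) u = 1\<close>. The deviations are then made
  small not by \<open>u\<close> but by the tails of \<open>weight\<close>.\<close>

locale empirical_chaining = iid_sample M P X + chaining P F Fs \<pi> c0
  for M :: "'b measure" and P :: "'a measure" and X :: "nat \<Rightarrow> 'b \<Rightarrow> 'a" and F Fs \<pi> c0 +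
  fixes a b :: real
  assumes a: "a > 0" and b: "b > 0"
    and deviation: "\<And>n s. n \<ge> 1 \<Longrightarrow> s \<ge> 1 \<Longrightarrow>
        measure (Pi\<^sub>M {..<n} (\<lambda>_. P))
          {x \<in> space (Pi\<^sub>M {..<n} (\<lambda>_. P)). \<forall>f\<in>F.
             \<bar>emp_mean n x (trunc_incr c0 P \<pi> n s f) - (\<integral>y. trunc_incr c0 P \<pi> n s f y \<partial>P)\<bar>
               \<le> b * 2 powr (real s / 2) * l2norm P (incr \<pi> s f) / sqrt (real n)}
        \<ge> 1 - 2 * exp (- a * 2 ^ s)"
    and base_zero: "\<And>f. f \<in> F \<Longrightarrow> AE x in P. \<pi> 0 f x = 0"
begin

definition deviation_ok :: "nat \<Rightarrow> nat \<Rightarrow> 'b \<Rightarrow> bool" where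
  "deviation_ok n s \<omega> \<longleftrightarrow> (\<forall>f\<in>F.
     \<bar>emp_mean n (\<lambda>i. X i \<omega>) (trunc_incr c0 P \<pi> n s f) - (\<integral>y. trunc_incr c0 P \<pi> n s f y \<partial>P)\<bar>
       \<le> b * 2 powr (real s / 2) * l2norm P (incr \<pi> s f) / sqrt (real n))"

text \<open>If the event in \<open>deviation\<close> were not measurable, its \<^const>\<open>measure\<close> would be 0; so no
  measurability has to be shown when the lower bound is positive.\<close>

lemma deviation_event:
  assumes n: "n \<ge> 1" and s: "s \<ge> 1"
  shows "\<exists>A\<in>sets M. M.prob A \<ge> 1 - 2 * exp (- a * 2 ^ s) \<and> (\<forall>\<omega>\<in>A. deviation_ok n s \<omega>)"
proof (cases "1 - 2 * exp (- a * 2 ^ s) \<le> 0")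
  case True
  then show ?thesis by (intro bexI[of _ "{}"]) auto
next
  case False
  let ?P = "Pi\<^sub>M {..<n} (\<lambda>_. P)" and ?X = "\<lambda>\<omega>. \<lambda>i\<in>{..<n}. X i \<omega>"
  let ?E = "{x \<in> space ?P. \<forall>f\<in>F.
             \<bar>emp_mean n x (trunc_incr c0 P \<pi> n s f) - (\<integral>y. trunc_incr c0 P \<pi> n s f y \<partial>P)\<bar>
               \<le> b * 2 powr (real s / 2) * l2norm P (incr \<pi> s f) / sqrt (real n)}"
  have E: "measure ?P ?E \<ge> 1 - 2 * exp (- a * 2 ^ s)" by (rule deviation[OF n s])
  then have "measure ?P ?E \<noteq> 0" using False by linarith
  then have Es: "?E \<in> sets ?P" using measure_notin_sets by blast
  have "0 \<in> {..<n}" using n by simp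
  \<comment> \<open>The description of independence by a product law requires a nonempty index set,
    hence \<open>n \<ge> 1\<close>.\<close>
  then have ne: "{..<n} \<noteq> {}" by blast
  have "M.indep_vars (\<lambda>_. P) X {..<n}" by (rule M.indep_vars_subset[OF indep]) simp
  then have "distr M ?P ?X = Pi\<^sub>M {..<n} (\<lambda>i. distr M P (X i))"
    using M.indep_vars_iff_distr_eq_PiM[OF ne, where X = X and M' = "\<lambda>_. P"] by simp
  then have d: "distr M ?P ?X = ?P" by (simp only: law)
  have Xm: "?X \<in> measurable M ?P" by measurable
  have "measure ?P ?E = measure (distr M ?P ?X) ?E" by (simp only: d)
  also have "\<dots> = M.prob (?X -` ?E \<inter> space M)" by (rule measure_distr[OF Xm Es])
  finally have "M.prob (?X -` ?E \<inter> space M) \<ge> 1 - 2 * exp (- a * 2 ^ s)" using E by simp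
  moreover have "?X -` ?E \<inter> space M \<in> sets M" by (rule measurable_sets[OF Xm Es])
  moreover have "deviation_ok n s \<omega>" if "\<omega> \<in> ?X -` ?E \<inter> space M" for \<omega>
  proof -
    have "emp_mean n (?X \<omega>) g = emp_mean n (\<lambda>i. X i \<omega>) g" for g
      by (simp add: emp_mean_def)
    then show ?thesis using that by (simp add: deviation_ok_def)
  qed
  ultimately show ?thesis by blast
qed

text \<open>A union bound over the levels from \<open>s0\<close> on. The failure probabilities do
  not involve \<open>n\<close> and are summable, so \<open>S\<close> can be chosen independently of
  \<open>n\<close>.\<close>

lemma deviation_tail_event:
  assumes "e > 0"
  shows "\<exists>S. \<forall>s0\<ge>S. \<forall>n\<ge>1. \<exists>A\<in>sets M. M.prob A \<ge> 1 - e \<and> (\<forall>\<omega>\<in>A. \<forall>s\<ge>s0. deviation_ok n (Suc s) \<omega>)"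
proof -
  let ?p = "\<lambda>s::nat. 2 * exp (- a * 2 ^ Suc s)"
  \<comment> \<open>As \<open>s \<le> 2 ^ Suc s\<close>, the doubly exponential terms are dominated
    by a geometric series with ratio \<open>exp (- a) < 1\<close>.\<close>
  have p_le: "?p s \<le> 2 * exp (- a) ^ s" for s
  proof -
    have "s \<le> 2 ^ Suc s" using less_exp[of "Suc s"] by linarith
    then have "real s \<le> 2 ^ Suc s" by (metis of_nat_le_iff of_nat_numeral of_nat_power)
    then have "exp (- a * 2 ^ Suc s) \<le> exp (real s * - a)"
      using a by (simp add: mult.commute[of a])
    then show ?thesis by (simp only: exp_of_nat_mult)
  qed
  have "summable (\<lambda>s. 2 * exp (- a) ^ s)"
    using a by (intro summable_mult summable_geometric) simp
  then have sp: "summable ?p"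
    by (rule summable_comparison_test[rotated]) (use p_le in auto)
  obtain S where S: "\<And>s0. s0 \<ge> S \<Longrightarrow> norm (\<Sum>s. ?p (s + s0)) < e"
    using suminf_exist_split[OF assms sp] by blast
  have "\<exists>A\<in>sets M. M.prob A \<ge> 1 - e \<and> (\<forall>\<omega>\<in>A. \<forall>s\<ge>s0. deviation_ok n (Suc s) \<omega>)"
    if s0: "s0 \<ge> S" and n: "n \<ge> 1" for s0 n
  proof -
    have "\<forall>s. \<exists>A. A \<in> sets M \<and> M.prob A \<ge> 1 - ?p s \<and> (\<forall>\<omega>\<in>A. deviation_ok n (Suc s) \<omega>)"
    proof
      fix s
      show "\<exists>A. A \<in> sets M \<and> M.prob A \<ge> 1 - ?p s \<and> (\<forall>\<omega>\<in>A. deviation_ok n (Suc s) \<omega>)"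
        using deviation_event[OF n, of "Suc s"] by (simp add: Bex_def)
    qed
    then obtain A where A: "\<And>s. A s \<in> sets M" "\<And>s. M.prob (A s) \<ge> 1 - ?p s"
      "\<And>s \<omega>. \<omega> \<in> A s \<Longrightarrow> deviation_ok n (Suc s) \<omega>"
      by (metis (no_types))
    let ?B = "\<lambda>s. space M - A (s + s0)"
    have sB: "?B s \<in> sets M" for s using A(1) by auto
    have pB: "M.prob (?B s) \<le> ?p (s + s0)" for s
      using M.prob_compl[OF A(1), of "s + s0"] A(2)[of "s + s0"] by simp
    have ss: "summable (\<lambda>s. ?p (s + s0))" by (rule summable_ignore_initial_segment[OF sp])
    have sB': "summable (\<lambda>s. M.prob (?B s))"
      by (rule summable_comparison_test[OF _ ss]) (use pB in auto)
    have "M.prob (\<Union>s. ?B s) \<le> (\<Sum>s. M.prob (?B s))"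
      using sB by (intro M.finite_measure_subadditive_countably sB') auto
    also have "\<dots> \<le> (\<Sum>s. ?p (s + s0))" by (rule suminf_le[OF pB sB' ss])
    also have "\<dots> < e" using S[OF s0] by simp
    finally have "M.prob (\<Union>s. ?B s) \<le> e" by simp
    moreover have "M.prob (space M - (\<Union>s. ?B s)) = 1 - M.prob (\<Union>s. ?B s)"
      by (intro M.prob_compl sets.countable_UN image_subsetI sB)
    moreover have "deviation_ok n (Suc s) \<omega>" if \<omega>: "\<omega> \<in> space M - (\<Union>s. ?B s)" and s: "s \<ge> s0" for \<omega> s
    proof -
      have "\<omega> \<notin> ?B (s - s0)" using \<omega> by blast
      then have "\<omega> \<in> A s" using \<omega> s by simp
      then show ?thesis by (rule A(3))
    qed
    moreover have "space M - (\<Union>s. ?B s) \<in> sets M"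
      by (intro sets.Diff sets.top sets.countable_UN image_subsetI sB)
    ultimately show ?thesis
      by (intro bexI[of _ "space M - (\<Union>s. ?B s)"]) auto
  qed
  then show ?thesis by blast
qed

section \<open>Comparison with finitely many coordinates\<close>

definition emp_process :: "nat \<Rightarrow> 'b \<Rightarrow> ('a \<Rightarrow> real) \<Rightarrow> real" where
  "emp_process n \<omega> g = sqrt (real n) * emp_mean n (\<lambda>i. X i \<omega>) g"

text \<open>The subtraction of the mean of \<open>f\<close> is left out because that mean is zero on
  the class.\<close>

definition modified_process :: "nat \<Rightarrow> 'b \<Rightarrow> ('a \<Rightarrow> real) \<Rightarrow> real" where
  "modified_process n \<omega> = (\<lambda>f\<in>F. emp_process n \<omega> (modification c0 P \<pi> n f))"

definition step_process :: "nat \<Rightarrow> nat \<Rightarrow> 'b \<Rightarrow> ('a \<Rightarrow> real) \<Rightarrow> real" where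
  "step_process s n \<omega> = (\<lambda>f\<in>F. emp_process n \<omega> (\<pi> s f))"

lemma step_process_embed: "step_process s n \<omega> = embed s (\<lambda>j. emp_process n \<omega> (from_nat_into (Fs s) j))"
  unfolding step_process_def by (rule embed_from_nat_into[symmetric])

lemma from_nat_into_F: "from_nat_into (Fs s) j \<in> F"
  using Fs(1) from_nat_into[OF Fs(3)] by (rule subsetD)

lemma emp_process_measurable: "g \<in> L2 P \<Longrightarrow> (\<lambda>\<omega>. emp_process n \<omega> g) \<in> borel_measurable M"
  unfolding emp_process_def using L2_measurable[of g P] by simp

lemma modified_process_mspace: "modified_process n \<omega> \<in> mspace (linf F)"
proof -
  obtain B where B: "\<And>f y. f \<in> F \<Longrightarrow> \<bar>emp_mean n y (modification c0 P \<pi> n f)\<bar> \<le> B"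
    using emp_mean_modification_bounded by blast
  show ?thesis
    unfolding modified_process_def emp_process_def
    by (rule linf_memI[of _ _ "sqrt (real n) * B"]) (simp add: abs_mult B mult_left_mono)
qed

lemma modified_process_approx:
  assumes "n \<ge> 1" and w: "\<And>f. f \<in> F \<Longrightarrow> (\<Sum>s. weight f (s + s0)) \<le> e"
    and dev: "\<And>s. s \<ge> s0 \<Longrightarrow> deviation_ok n (Suc s) \<omega>"
    and zero: "\<And>f i. f \<in> F \<Longrightarrow> \<pi> 0 f (X i \<omega>) = 0"
  shows "mdist (linf F) (modified_process n \<omega>) (step_process s0 n \<omega>)
    \<le> (b + 1 / c0) * e + head s0 n (\<lambda>i. X i \<omega>)"
  unfolding linf_dist_le[OF modified_process_mspace embed_mspace[of s0 "\<lambda>j. emp_process n \<omega> (from_nat_into (Fs s0) j)", folded step_process_embed] F_nonempty]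
proof
  fix f assume f: "f \<in> F"
  have "\<bar>emp_process n \<omega> (modification c0 P \<pi> n f) - emp_process n \<omega> (\<pi> s0 f)\<bar>
      \<le> (b + 1 / c0) * (\<Sum>s. weight f (s + s0)) + head s0 n (\<lambda>i. X i \<omega>)"
    unfolding emp_process_def
    using dev f b by (intro emp_mean_modification_approx f \<open>n \<ge> 1\<close> zero) (auto simp: deviation_ok_def)
  also have "\<dots> \<le> (b + 1 / c0) * e + head s0 n (\<lambda>i. X i \<omega>)"
    using w[OF f] b c0 by (intro add_right_mono mult_left_mono) auto
  finally show "\<bar>modified_process n \<omega> f - step_process s0 n \<omega> f\<bar> \<le> (b + 1 / c0) * e + head s0 n (\<lambda>i. X i \<omega>)"
    using f by (simp add: modified_process_def step_process_def)
qed

lemma step_process_expectation_tendsto: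
  assumes N: "prob_space N" and gp: "centered_gaussian_process N F (\<lambda>f g. \<integral>x. f x * g x \<partial>P) G"
    and Y: "AE \<omega> in N. \<forall>f\<in>F. Y \<omega> f = G f \<omega>"
      "\<And>f. f \<in> F \<Longrightarrow> (\<lambda>\<omega>. Y \<omega> f) \<in> borel_measurable N"
    and h: "continuous_map (mtopology_of (linf F)) euclideanreal h"
      "\<And>z. z \<in> mspace (linf F) \<Longrightarrow> \<bar>h z\<bar> \<le> B"
  shows "(\<lambda>n. \<integral>\<omega>. h (step_process s n \<omega>) \<partial>M) \<longlonglongrightarrow> (\<integral>\<omega>. h (\<lambda>f\<in>F. Y \<omega> (\<pi> s f)) \<partial>N)"
proof -
  interpret N: prob_space N by fact
  let ?g = "from_nat_into (Fs s)"
  have gF: "?g j \<in> F" for j by (rule from_nat_into_F)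
  have gL: "?g j \<in> L2 P" for j using gF F by blast
  note [measurable] = L2_measurable[OF gL] Y(2)[OF gF]
  have [measurable]: "G f \<in> borel_measurable N" if "f \<in> F" for f
    using gp that by (auto simp: centered_gaussian_process_def)
  note [measurable] = this[OF gF]
  have g2: "integrable P (\<lambda>x. (?g j x)\<^sup>2)" for j by (rule L2_integrable[OF gL])
  have g0: "(\<integral>x. ?g j x \<partial>P) = 0" for j by (rule centred[OF gF])
  have YG: "AE \<omega> in N. Y \<omega> (?g j) = G (?g j) \<omega>" for j
    using Y(1) gF by (auto elim: eventually_mono)
  let ?J = "to_nat_on (Fs s) ` Fs s"
  \<comment> \<open>One bound for both sides: centring bounds the second moments of the scaled
    empirical means by those under \<open>P\<close> for every \<open>n\<close>, and those of the
    Gaussian coordinates equal them by the covariance.\<close>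
  let ?C = "Max ((\<lambda>g. \<integral>x. (g x)\<^sup>2 \<partial>P) ` Fs s)"
  have C: "(\<integral>x. (?g j x)\<^sup>2 \<partial>P) \<le> ?C" for j
    using Fs from_nat_into[OF Fs(3)] by (intro Max_ge) auto
  have lim: "(\<lambda>n. \<integral>\<omega>. h (embed s (\<lambda>j. emp_process n \<omega> (?g j))) \<partial>M)
      \<longlonglongrightarrow> (\<integral>\<omega>. h (embed s (\<lambda>j. Y \<omega> (?g j))) \<partial>N)"
  proof (rule cramer_wold_expectation[where J = ?J and C = ?C and \<phi> = "\<lambda>w. h (embed s w)" and B = B])
    show "prob_space M" "prob_space N" by unfold_locales
    show "(\<lambda>\<omega>. emp_process n \<omega> (?g j)) \<in> borel_measurable M" for n j
      by (rule emp_process_measurable[OF gL])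
    show "(\<lambda>\<omega>. Y \<omega> (?g j)) \<in> borel_measurable N" for j by measurable
    show "integrable M (\<lambda>\<omega>. (emp_process n \<omega> (?g j))\<^sup>2)" for n j
      unfolding emp_process_def by (rule scaled_emp_mean_second_moment[OF _ g2 g0]) measurable
    show "(\<integral>\<omega>. (emp_process n \<omega> (?g j))\<^sup>2 \<partial>M) \<le> ?C" for n j
      unfolding emp_process_def
      by (rule order_trans[OF scaled_emp_mean_second_moment(2)[OF _ g2 g0] C]) measurable
    have Y2: "integrable N (\<lambda>\<omega>. (Y \<omega> (?g j))\<^sup>2) = integrable N (\<lambda>\<omega>. (G (?g j) \<omega>)\<^sup>2)"
      "(\<integral>\<omega>. (Y \<omega> (?g j))\<^sup>2 \<partial>N) = (\<integral>\<omega>. (G (?g j) \<omega>)\<^sup>2 \<partial>N)" for j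
    proof -
      have ae: "AE \<omega> in N. (Y \<omega> (?g j))\<^sup>2 = (G (?g j) \<omega>)\<^sup>2" using YG[of j] by eventually_elim simp
      have m: "(\<lambda>\<omega>. (Y \<omega> (?g j))\<^sup>2) \<in> borel_measurable N" "(\<lambda>\<omega>. (G (?g j) \<omega>)\<^sup>2) \<in> borel_measurable N"
        by measurable
      show "integrable N (\<lambda>\<omega>. (Y \<omega> (?g j))\<^sup>2) = integrable N (\<lambda>\<omega>. (G (?g j) \<omega>)\<^sup>2)"
        "(\<integral>\<omega>. (Y \<omega> (?g j))\<^sup>2 \<partial>N) = (\<integral>\<omega>. (G (?g j) \<omega>)\<^sup>2 \<partial>N)"
        by (rule integrable_cong_AE[OF m ae], rule integral_cong_AE[OF m ae])
    qed
    show "integrable N (\<lambda>\<omega>. (Y \<omega> (?g j))\<^sup>2)" for j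
      unfolding Y2 by (rule N.gaussian_process_square_integrable[OF gp gF])
    show "(\<integral>\<omega>. (Y \<omega> (?g j))\<^sup>2 \<partial>N) \<le> ?C" for j
    proof -
      have "(\<integral>\<omega>. (G (?g j) \<omega>)\<^sup>2 \<partial>N) = (\<integral>x. (?g j x)\<^sup>2 \<partial>P)"
        using gp gF unfolding centered_gaussian_process_def power2_eq_square by blast
      then show ?thesis unfolding Y2 using C by simp
    qed
    show "finite ?J" using Fs by simp
    show "continuous_on UNIV (\<lambda>w. h (embed s w))"
      using continuous_map_compose[OF continuous_embed h(1)] by (simp add: comp_def)
    show "\<bar>h (embed s w)\<bar> \<le> B" for w by (rule h(2)[OF embed_mspace])
    show "h (embed s w) = h (embed s w')" if "\<And>j. j \<in> ?J \<Longrightarrow> w j = w' j" for w w'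
      using embed_cong[OF that] by simp
    \<comment> \<open>By linearity the combination of coordinates is the empirical process of the
      single function \<open>?h\<close>. Its limiting variance is the quadratic form that also
      appears in the characteristic function of the Gaussian combination.\<close>
    fix k c
    let ?h = "\<lambda>x. \<Sum>j<k. c j * ?g j x"
    have hm: "?h \<in> borel_measurable P" by measurable
    have h2: "integrable P (\<lambda>x. (?h x)\<^sup>2)"
      "(\<integral>x. (?h x)\<^sup>2 \<partial>P) = (\<Sum>i<k. \<Sum>j<k. c i * c j * (\<integral>x. ?g i x * ?g j x \<partial>P))"
      using integrable_integral_square_sum[of "{..<k}" ?g P c] L2_measurable[OF gL] g2 by auto
    have h0: "(\<integral>x. ?h x \<partial>P) = 0"
      using P.L2_trunc_integrable(1)[OF gL] by (simp add: g0)
    have "(\<Sum>j<k. c j * emp_process n \<omega> (?g j)) = sqrt (real n) * emp_mean n (\<lambda>i. X i \<omega>) ?h" for n \<omega>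
    proof -
      have "emp_mean n y (\<lambda>x. r * u x) = r * emp_mean n y u" for y r and u :: "'a \<Rightarrow> real"
        by (simp add: emp_mean_def sum_distrib_left)
      then show ?thesis
        by (simp add: emp_process_def emp_mean_sum sum_distrib_left mult_ac)
    qed
    moreover have "(CLINT \<omega>|N. iexp (\<Sum>j<k. c j * Y \<omega> (?g j))) = (CLINT \<omega>|N. iexp (\<Sum>j<k. c j * G (?g j) \<omega>))"
    proof (rule integral_cong_AE)
      have "AE \<omega> in N. \<forall>j. Y \<omega> (?g j) = G (?g j) \<omega>" using YG by (simp add: AE_all_countable)
      then show "AE \<omega> in N. iexp (\<Sum>j<k. c j * Y \<omega> (?g j)) = iexp (\<Sum>j<k. c j * G (?g j) \<omega>)"
        by eventually_elim simp
    qed measurable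
    ultimately show "(\<lambda>n. CLINT \<omega>|M. iexp (\<Sum>j<k. c j * emp_process n \<omega> (?g j)))
        \<longlonglongrightarrow> (CLINT \<omega>|N. iexp (\<Sum>j<k. c j * Y \<omega> (?g j)))"
      using emp_process_char_tendsto[OF hm h2(1) h0] N.gaussian_process_char[OF gp gF]
      by (simp only: h2(2))
  qed
  then show ?thesis unfolding step_process_embed embed_from_nat_into .
qed

text \<open>The step process is measurable and the pathwise distance of the test function values is
  at most an integrable \<open>q\<close>, so the outer expectation lies between the integrals of
  \<open>h (step_process s0 n \<omega>) - q \<omega>\<close> and
  \<open>h (step_process s0 n \<omega>) + q \<omega>\<close>. The threshold \<open>S\<close> depends
  on \<open>e\<close> but not on \<open>n\<close>.\<close>

lemma outer_expectation_step_approx: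
  assumes e: "e > 0" and h: "\<And>z. z \<in> mspace (linf F) \<Longrightarrow> \<bar>h z\<bar> \<le> B"
    and lip: "\<And>x y. x \<in> mspace (linf F) \<Longrightarrow> y \<in> mspace (linf F) \<Longrightarrow> \<bar>h x - h y\<bar> \<le> k * mdist (linf F) x y"
    and k: "k \<ge> 0"
  shows "\<exists>S. \<forall>s0\<ge>S. \<forall>n\<ge>1.
    \<bar>outer_expectation M (\<lambda>\<omega>. h (modified_process n \<omega>)) - (\<integral>\<omega>. h (step_process s0 n \<omega>) \<partial>M)\<bar>
      \<le> 2 * B * e + k * ((b + 1 / c0) * e + (\<integral>\<omega>. head s0 n (\<lambda>i. X i \<omega>) \<partial>M))"
proof -
  obtain S1 where S1: "\<And>s0 n. s0 \<ge> S1 \<Longrightarrow> n \<ge> 1 \<Longrightarrow>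
      \<exists>A\<in>sets M. M.prob A \<ge> 1 - e \<and> (\<forall>\<omega>\<in>A. \<forall>s\<ge>s0. deviation_ok n (Suc s) \<omega>)"
    using deviation_tail_event[OF e] by blast
  obtain S2 where S2: "\<And>s0 f. s0 \<ge> S2 \<Longrightarrow> f \<in> F \<Longrightarrow> (\<Sum>s. weight f (s + s0)) \<le> e"
    using weight_tail[OF e] by blast
  have "\<bar>outer_expectation M (\<lambda>\<omega>. h (modified_process n \<omega>)) - (\<integral>\<omega>. h (step_process s0 n \<omega>) \<partial>M)\<bar>
      \<le> 2 * B * e + k * ((b + 1 / c0) * e + (\<integral>\<omega>. head s0 n (\<lambda>i. X i \<omega>) \<partial>M))"
    if s0: "s0 \<ge> max S1 S2" and n: "n \<ge> 1" for s0 n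
  proof -
    obtain A where A: "A \<in> sets M" "M.prob A \<ge> 1 - e" "\<And>\<omega> s. \<omega> \<in> A \<Longrightarrow> s \<ge> s0 \<Longrightarrow> deviation_ok n (Suc s) \<omega>"
      using S1[of s0 n] s0 n by auto
    \<comment> \<open>The exceptional null sets can be united since \<open>\<pi> 0\<close> takes
      only finitely many values on the class, however large the class is.\<close>
    have "AE \<omega> in M. \<forall>i. \<forall>g\<in>\<pi> 0 ` F. g (X i \<omega>) = 0"
    proof -
      have "finite (\<pi> 0 ` F)" using pi_in by (intro finite_subset[OF _ Fs(2)[of 0]]) auto
      then have "AE \<omega> in M. \<forall>g\<in>\<pi> 0 ` F. g (X i \<omega>) = 0" for i
        by (subst AE_finite_all) (auto intro!: sample_AE base_zero)
      then show ?thesis unfolding AE_all_countable by blast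
    qed
    then obtain E where "{\<omega> \<in> space M. \<not> (\<forall>i. \<forall>g\<in>\<pi> 0 ` F. g (X i \<omega>) = 0)} \<subseteq> E"
      "emeasure M E = 0" "E \<in> sets M" by (rule AE_E)
    then have E: "E \<in> null_sets M" "{\<omega> \<in> space M. \<not> (\<forall>i. \<forall>g\<in>\<pi> 0 ` F. g (X i \<omega>) = 0)} \<subseteq> E"
      by auto
    define D where "D = space M - (A - E)"
    have D: "D \<in> sets M" using A E by (auto simp: D_def)
    have "M.prob D = 1 - M.prob (A - E)" unfolding D_def using A E by (intro M.prob_compl) auto
    also have "M.prob (A - E) = M.prob A" using A E by (intro measure_Diff_null_set)
    finally have pD: "M.prob D \<le> e" using A by simp
    \<comment> \<open>On the exceptional event \<open>D\<close> only the trivial bound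
      \<open>2 * B\<close> is available; off \<open>D\<close> the Lipschitz property applies to the
      distance of the two paths.\<close>
    define q where "q \<omega> = 2 * B * indicator D \<omega> + k * ((b + 1 / c0) * e + head s0 n (\<lambda>i. X i \<omega>))" for \<omega>
    note head = head_integral_tendsto(1)[OF iid_sample_axioms, of s0 n]
    have iD: "integrable M (indicator D :: _ \<Rightarrow> real)" using D by (simp add: M.emeasure_eq_measure)
    have iq: "integrable M q" unfolding q_def using head iD by simp
    have "(\<integral>\<omega>. q \<omega> \<partial>M) = 2 * B * M.prob D + k * ((b + 1 / c0) * e + (\<integral>\<omega>. head s0 n (\<lambda>i. X i \<omega>) \<partial>M))"
      unfolding q_def using head iD D by (simp add: M.prob_space)
    moreover have B: "B \<ge> 0" using h[OF modified_process_mspace[of n undefined]] by linarith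
    ultimately have q_le: "(\<integral>\<omega>. q \<omega> \<partial>M) \<le> 2 * B * e + k * ((b + 1 / c0) * e + (\<integral>\<omega>. head s0 n (\<lambda>i. X i \<omega>) \<partial>M))"
      using pD by (simp add: mult_left_mono)
    have mem: "step_process s0 n \<omega> \<in> mspace (linf F)" for \<omega>
      unfolding step_process_embed by (rule embed_mspace)
    have head_nonneg: "head s0 n y \<ge> 0" for y
      unfolding head_def emp_mean_def by (intro sum_nonneg mult_nonneg_nonneg divide_nonneg_nonneg) auto
    have diff: "\<bar>h (modified_process n \<omega>) - h (step_process s0 n \<omega>)\<bar> \<le> q \<omega>" if \<omega>: "\<omega> \<in> space M" for \<omega>
    proof (cases "\<omega> \<in> D")
      case True
      have "0 \<le> k * ((b + 1 / c0) * e + head s0 n (\<lambda>i. X i \<omega>))"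
        using k b c0 e head_nonneg by (intro mult_nonneg_nonneg add_nonneg_nonneg) auto
      then show ?thesis
        using True h[OF modified_process_mspace[of n \<omega>]] h[OF mem[of \<omega>]] by (simp add: q_def)
    next
      case False
      then have A\<omega>: "\<omega> \<in> A" "\<omega> \<notin> E" using \<omega> by (auto simp: D_def)
      then have "\<forall>i. \<forall>g\<in>\<pi> 0 ` F. g (X i \<omega>) = 0" using E(2) \<omega> by blast
      then have "mdist (linf F) (modified_process n \<omega>) (step_process s0 n \<omega>)
          \<le> (b + 1 / c0) * e + head s0 n (\<lambda>i. X i \<omega>)"
        using S2[of s0] s0 A(3)[OF A\<omega>(1)] by (intro modified_process_approx n) auto
      then have "k * mdist (linf F) (modified_process n \<omega>) (step_process s0 n \<omega>)
          \<le> k * ((b + 1 / c0) * e + head s0 n (\<lambda>i. X i \<omega>))" using k by (rule mult_left_mono)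
      then show ?thesis
        using lip[OF modified_process_mspace[of n \<omega>] mem[of \<omega>]] False by (simp add: q_def)
    qed
    have "(\<lambda>\<omega>. step_process s0 n \<omega>) \<in> measurable M (borel_of_metric (linf F))"
      unfolding step_process_embed
      using from_nat_into_F F by (intro embed_measurable emp_process_measurable) blast
    then have "(\<lambda>\<omega>. h (step_process s0 n \<omega>)) \<in> borel_measurable M"
      by (rule continuous_map_measurable_comp) (rule lipschitz_imp_continuous_map[OF lip])
    then have ih: "integrable M (\<lambda>\<omega>. h (step_process s0 n \<omega>))"
      by (rule M.integrable_const_bound[rotated]) (use h[OF mem] in auto)
    have "outer_expectation M (\<lambda>\<omega>. h (modified_process n \<omega>)) \<le> (\<integral>\<omega>. h (step_process s0 n \<omega>) + q \<omega> \<partial>M)"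
    proof (rule M.outer_expectation_le)
      show "- B \<le> h (modified_process n \<omega>)" for \<omega>
        using h[OF modified_process_mspace[of n \<omega>]] by linarith
      show "h (modified_process n \<omega>) \<le> h (step_process s0 n \<omega>) + q \<omega>" if "\<omega> \<in> space M" for \<omega>
        using diff[OF that] by linarith
    qed (use ih iq in simp)
    moreover have "(\<integral>\<omega>. h (step_process s0 n \<omega>) - q \<omega> \<partial>M) \<le> outer_expectation M (\<lambda>\<omega>. h (modified_process n \<omega>))"
    proof (rule M.le_outer_expectation)
      show "h (modified_process n \<omega>) \<le> B" for \<omega>
        using h[OF modified_process_mspace[of n \<omega>]] by linarith
      have "h (step_process s0 n \<omega>) - q \<omega> \<le> h (modified_process n \<omega>)" if "\<omega> \<in> space M" for \<omega>
        using diff[OF that] by linarith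
      then show "AE \<omega> in M. h (step_process s0 n \<omega>) - q \<omega> \<le> h (modified_process n \<omega>)" by simp
    qed (use ih iq in simp)
    ultimately show ?thesis using ih iq q_le by simp
  qed
  then show ?thesis by blast
qed

theorem modified_process_weak_convergence:
  assumes N: "prob_space N" and gp: "centered_gaussian_process N F (\<lambda>f g. \<integral>x. f x * g x \<partial>P) G"
    and cont: "continuous_process N F (l2dist P) G"
  shows "\<exists>Y. (AE \<omega> in N. \<forall>f\<in>F. Y \<omega> f = G f \<omega>) \<and> outer_weak_convergence (linf F) M modified_process N Y"
proof -
  interpret N: prob_space N by fact
  obtain Y where Y: "AE \<omega> in N. \<forall>f\<in>F. Y \<omega> f = G f \<omega>"
    "\<And>f. f \<in> F \<Longrightarrow> (\<lambda>\<omega>. Y \<omega> f) \<in> borel_measurable N"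
    "\<And>\<omega>. (\<lambda>s. mdist (linf F) (\<lambda>f\<in>F. Y \<omega> (\<pi> s f)) (Y \<omega>)) \<longlonglongrightarrow> 0"
    "Y \<in> measurable N (borel_of_metric (linf F))" "tight_map (linf F) N Y"
    using limit_process[OF N gp cont] by blast
  have "outer_weak_convergence (linf F) M modified_process N Y"
  proof (rule outer_weak_convergence_lipschitz[OF M.prob_space_axioms N modified_process_mspace Y(4,5)])
    fix h k B
    assume hB: "\<And>x. x \<in> mspace (linf F) \<Longrightarrow> \<bar>h x\<bar> \<le> B"
      and lip: "\<And>x y. x \<in> mspace (linf F) \<Longrightarrow> y \<in> mspace (linf F) \<Longrightarrow> \<bar>h x - h y\<bar> \<le> k * mdist (linf F) x y"
      and k: "(k::real) \<ge> 0"
    have hc: "continuous_map (mtopology_of (linf F)) euclideanreal h"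
      by (rule lipschitz_imp_continuous_map[OF lip])
    have B: "B \<ge> 0" using hB[OF modified_process_mspace[of 0 undefined]] by linarith
    let ?Y = "\<lambda>s \<omega>. \<lambda>f\<in>F. Y \<omega> (\<pi> s f)"
    have Ys: "?Y s \<omega> = embed s (\<lambda>j. Y \<omega> (from_nat_into (Fs s) j))" for s \<omega>
      by (rule embed_from_nat_into[symmetric])
    have Ys_mem: "?Y s \<omega> \<in> mspace (linf F)" for s \<omega> unfolding Ys by (rule embed_mspace)
    have Ys_meas: "(\<lambda>\<omega>. h (?Y s \<omega>)) \<in> borel_measurable N" for s
      unfolding Ys
      by (rule continuous_map_measurable_comp[OF embed_measurable hc]) (rule Y(2)[OF from_nat_into_F])
    have limY: "(\<lambda>s. \<integral>\<omega>. h (?Y s \<omega>) \<partial>N) \<longlonglongrightarrow> (\<integral>\<omega>. h (Y \<omega>) \<partial>N)"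
    proof (rule integral_dominated_convergence[where w = "\<lambda>_. B"])
      show "(\<lambda>\<omega>. h (Y \<omega>)) \<in> borel_measurable N" by (rule continuous_map_measurable_comp[OF Y(4) hc])
      have "(\<lambda>s. h (?Y s \<omega>)) \<longlonglongrightarrow> h (Y \<omega>)" if "\<omega> \<in> space N" for \<omega>
      proof (rule LIM_zero_cancel, rule Lim_null_comparison)
        show "\<forall>\<^sub>F s in sequentially. norm (h (?Y s \<omega>) - h (Y \<omega>)) \<le> k * mdist (linf F) (?Y s \<omega>) (Y \<omega>)"
          using lip[OF Ys_mem measurable_borel_of_metric_space[OF Y(4) that]] by (simp del: mdist_funspace)
        show "(\<lambda>s. k * mdist (linf F) (?Y s \<omega>) (Y \<omega>)) \<longlonglongrightarrow> 0"
          using tendsto_mult_right_zero[OF Y(3)] .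
      qed
      then show "AE \<omega> in N. (\<lambda>s. h (?Y s \<omega>)) \<longlonglongrightarrow> h (Y \<omega>)" by simp
    qed (use Ys_meas hB[OF Ys_mem] in auto)
    show "(\<lambda>n. outer_expectation M (\<lambda>\<omega>. h (modified_process n \<omega>))) \<longlonglongrightarrow> (\<integral>\<omega>. h (Y \<omega>) \<partial>N)"
    proof (rule LIMSEQ_I)
      fix r :: real assume r: "r > 0"
      \<comment> \<open>The coefficient of \<open>e\<close> in the total error; the summand 1 keeps
        it positive when \<open>B\<close> and \<open>k\<close> vanish. With
        \<open>e = r / (4 * L)\<close> this error is one of four quarters of \<open>r\<close>. The
        others are for \<open>head\<close>, for the finite-dimensional convergence and for the step
        functions of \<open>Y\<close>.\<close>
      define L where "L = 2 * B + k * (b + 1 / c0) + 1"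
      have L: "L > 0" using B k b c0 by (auto simp: L_def intro!: add_nonneg_pos add_nonneg_nonneg)
      define e where "e = r / (4 * L)"
      have e: "e > 0" using r L by (simp add: e_def)
      have Le: "2 * B * e + k * ((b + 1 / c0) * e) \<le> r / 4"
      proof -
        have "2 * B * e + k * ((b + 1 / c0) * e) \<le> L * e" using e by (simp add: L_def algebra_simps)
        also have "\<dots> = r / 4" using L by (simp add: e_def)
        finally show ?thesis .
      qed
      obtain S where S: "\<And>s0 n. s0 \<ge> S \<Longrightarrow> n \<ge> 1 \<Longrightarrow>
        \<bar>outer_expectation M (\<lambda>\<omega>. h (modified_process n \<omega>)) - (\<integral>\<omega>. h (step_process s0 n \<omega>) \<partial>M)\<bar>
          \<le> 2 * B * e + k * ((b + 1 / c0) * e + (\<integral>\<omega>. head s0 n (\<lambda>i. X i \<omega>) \<partial>M))"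
        using outer_expectation_step_approx[OF e hB lip k] by blast
      obtain S' where S': "\<And>s. s \<ge> S' \<Longrightarrow> norm ((\<integral>\<omega>. h (?Y s \<omega>) \<partial>N) - (\<integral>\<omega>. h (Y \<omega>) \<partial>N)) < r / 4"
        using LIMSEQ_D[OF limY, of "r / 4"] r by auto
      \<comment> \<open>The level is fixed before \<open>n\<close> grows: the thresholds
        \<open>n1\<close> and \<open>n2\<close> may depend on \<open>s0\<close>, while the bound in
        \<open>S\<close> holds for every \<open>n \<ge> 1\<close>.\<close>
      define s0 where "s0 = max S S'"
      obtain n1 where n1: "\<And>n. n \<ge> n1 \<Longrightarrow>
          norm ((\<integral>\<omega>. h (step_process s0 n \<omega>) \<partial>M) - (\<integral>\<omega>. h (?Y s0 \<omega>) \<partial>N)) < r / 4"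
        using LIMSEQ_D[OF step_process_expectation_tendsto[OF N gp Y(1,2) hc hB], of "r / 4" s0] r by auto
      have "(\<lambda>n. k * (\<integral>\<omega>. head s0 n (\<lambda>i. X i \<omega>) \<partial>M)) \<longlonglongrightarrow> 0"
        using tendsto_mult_right_zero[OF head_integral_tendsto(2)[OF iid_sample_axioms]] .
      then have "\<exists>n2. \<forall>n\<ge>n2. norm (k * (\<integral>\<omega>. head s0 n (\<lambda>i. X i \<omega>) \<partial>M) - 0) < r / 4"
        using r by (intro LIMSEQ_D) auto
      then obtain n2 where n2: "\<And>n. n \<ge> n2 \<Longrightarrow> norm (k * (\<integral>\<omega>. head s0 n (\<lambda>i. X i \<omega>) \<partial>M)) < r / 4"
        by (auto simp only: diff_zero)
      have "norm (outer_expectation M (\<lambda>\<omega>. h (modified_process n \<omega>)) - (\<integral>\<omega>. h (Y \<omega>) \<partial>N)) < r"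
        if n: "n \<ge> max 1 (max n1 n2)" for n
      proof -
        have "n \<ge> 1" "n \<ge> n1" "n \<ge> n2" "s0 \<ge> S" "s0 \<ge> S'" using n by (auto simp: s0_def)
        then show ?thesis
          using S[of s0 n] S'[of s0] n1[of n] n2[of n] Le
          unfolding real_norm_def distrib_left[of k] by linarith
      qed
      then show "\<exists>n0. \<forall>n\<ge>n0. norm (outer_expectation M (\<lambda>\<omega>. h (modified_process n \<omega>)) - (\<integral>\<omega>. h (Y \<omega>) \<partial>N)) < r"
        by blast
    qed
  qed
  then show ?thesis using Y(1) by blast
qed

end

text \<open>The central limit theorem produces the covariance of the centred functions, which is the
  integral of \<open>f * g\<close> on a class of mean zero. The modification sums increments from
  level 1 on, so it stands for \<open>f\<close> itself when the base \<open>\<pi> 0 f\<close>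
  vanishes almost everywhere. The limit is a version of \<open>G\<close>, as the paths of
  \<open>G\<close> are controlled only almost surely.\<close>

theorem theorem2p7:
  fixes P :: "'a measure" and M :: "'b measure" and N :: "'c measure"
    and X :: "nat \<Rightarrow> 'b \<Rightarrow> 'a"
    and F :: "('a \<Rightarrow> real) set"
    and G :: "('a \<Rightarrow> real) \<Rightarrow> 'c \<Rightarrow> real"
    and Fs :: "nat \<Rightarrow> ('a \<Rightarrow> real) set"
    and \<pi> :: "nat \<Rightarrow> ('a \<Rightarrow> real) \<Rightarrow> ('a \<Rightarrow> real)"
    and K c0 :: real
  assumes "prob_space P" and "prob_space M" and "prob_space N"
    and indep: "prob_space.indep_vars M (\<lambda>_. P) X UNIV"
    and law: "\<And>i. distr M P (X i) = P"
    and F: "F \<subseteq> L2 P"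
    and gauss: "centered_gaussian_process N F (\<lambda>f g. \<integral>x. f x * g x \<partial>P) G"
    and bounded: "outer_nn_expectation N (\<lambda>\<omega>. SUP f\<in>F. ennreal \<bar>G f \<omega>\<bar>) < \<infinity>"
    and K: "K > 0"
    and adm: "admissible F Fs"
    and near: "nearest_maps P F Fs \<pi>"
    and opt: "almost_optimal K P F \<pi>"
    and c0: "truncation_constant TYPE('a) c0"
    and cont: "continuous_process N F (l2dist P) G"
    and centred_class: "\<And>f. f \<in> F \<Longrightarrow> (\<integral>x. f x \<partial>P) = 0"
    and base_zero: "\<And>f. f \<in> F \<Longrightarrow> AE x in P. \<pi> 0 f x = 0"
  shows "\<exists>Y. (AE \<omega> in N. \<forall>f\<in>F. Y \<omega> f = G f \<omega>) \<and>
    outer_weak_convergence (linf F) M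
      (\<lambda>n \<omega>. \<lambda>f\<in>F. sqrt (real n) *
         (emp_mean n (\<lambda>i. X i \<omega>) (modification c0 P \<pi> n f) - (\<integral>x. f x \<partial>P)))
      N Y"
proof -
  obtain a b where ab: "a > 0" "b > 0" and dev: "\<And>Q F Fs \<pi> (n::nat) (u::real) (s::nat).
        prob_space (Q :: 'a measure) \<Longrightarrow> F \<subseteq> L2 Q \<Longrightarrow> admissible F Fs \<Longrightarrow> nearest_maps Q F Fs \<pi> \<Longrightarrow>
        n \<ge> 1 \<Longrightarrow> u > 1/2 \<Longrightarrow> s \<ge> 1 \<Longrightarrow>
        measure (Pi\<^sub>M {..<n} (\<lambda>_. Q))
          {x \<in> space (Pi\<^sub>M {..<n} (\<lambda>_. Q)). \<forall>f\<in>F.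
             \<bar>emp_mean n x (trunc_incr c0 Q \<pi> n s f) - (\<integral>y. trunc_incr c0 Q \<pi> n s f y \<partial>Q)\<bar>
               \<le> b * u * 2 powr (real s / 2) * l2norm Q (incr \<pi> s f) / sqrt (real n)}
        \<ge> 1 - 2 * exp (- a * 2 ^ s * min (u\<^sup>2) u)"
    using c0 unfolding truncation_constant_def by (elim conjE exE) blast
  interpret P: prob_space P by fact
  interpret M: prob_space M by fact
  interpret empirical_chaining M P X F Fs \<pi> c0 a b
  proof unfold_locales
    fix n s :: nat assume "n \<ge> 1" "s \<ge> 1"
    from dev[OF \<open>prob_space P\<close> F adm near this(1) _ this(2), of 1]
    show "measure (Pi\<^sub>M {..<n} (\<lambda>_. P))
          {x \<in> space (Pi\<^sub>M {..<n} (\<lambda>_. P)). \<forall>f\<in>F.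
             \<bar>emp_mean n x (trunc_incr c0 P \<pi> n s f) - (\<integral>y. trunc_incr c0 P \<pi> n s f y \<partial>P)\<bar>
               \<le> b * 2 powr (real s / 2) * l2norm P (incr \<pi> s f) / sqrt (real n)}
        \<ge> 1 - 2 * exp (- a * 2 ^ s)" by simp
  qed (use assms ab in \<open>auto simp: almost_optimal_def truncation_constant_def\<close>)
  have "modified_process n \<omega> = (\<lambda>f\<in>F. sqrt (real n) *
         (emp_mean n (\<lambda>i. X i \<omega>) (modification c0 P \<pi> n f) - (\<integral>x. f x \<partial>P)))" for n \<omega>
    by (auto simp: modified_process_def emp_process_def fun_eq_iff centred_class)
  then have "modified_process = (\<lambda>n \<omega>. \<lambda>f\<in>F. sqrt (real n) *
         (emp_mean n (\<lambda>i. X i \<omega>) (modification c0 P \<pi> n f) - (\<integral>x. f x \<partial>P)))" by blast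
  with modified_process_weak_convergence[OF \<open>prob_space N\<close> gauss cont] show ?thesis by simp
qed

end
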